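(* Assume $0<\gamma<\frac{2}{3}$. Then there exist positive constants $c_0$ and $\delta_0$ such that for every $0<\delta\le\delta_0$ one has $$\limsup_{\varepsilon\downarrow0}\ \varepsilon\log\mu^\varepsilon\bigl\{u:\ \mathrm{dist}_{L^2}(u,M)\ge\delta\bigr\}\le -c_0\delta^2 .$$
   Context: $F:\mathbb R\to\mathbb R$ is a (at least $C^3$) function satisfying: (a) $F(u)\ge 0$ for all $u$, and $F(u)=0$ iff $u=\pm1$; (b) $F'$ has exactly the three zeros $-1,0,1$, and $F''(0)<0$, $F''(\pm1)>0$; (c) $F(u)=F(-u)$ for all $u$. For $\varepsilon>0$, $\tilde\nu^\varepsilon$ is the law on $L^2[-1,1]$ of the (continuous) Gaussian process with mean $\mathbb E[\tilde u(s)]=s$ and covariance $\mathrm{Cov}(\tilde u(s),\tilde u(s'))=\varepsilon^{1-\gamma}\bigl(s\wedge s'+1-\frac{(s+1)(s'+1)}{2}\bigr)$, $s,s'\in[-1,1]$, and $\tilde\mu^\varepsilon$ is the probability measure with density proportional to $\exp\bigl(-\varepsilon^{-1-\gamma}\int_{-1}^1F(\tilde u(s))\,ds\bigr)$ with respect to $\tilde\nu^\varepsilon$. Let $T^\varepsilon:L^2[-1,1]\to L^2[-\varepsilon^{-\gamma},\varepsilon^{-\gamma}]$, $T^\varepsilon\tilde u(s)=\tilde u(\varepsilon^\gamma s)$, and let $\mu^\varepsilon=T^\varepsilon_\#\tilde\mu^\varepsilon$ be the pushforward measure. Let $m:\mathbb R\to\mathbb R$ be the unique solution of $m'(s)=\sqrt{2F(m(s))}$,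 $m(0)=0$, $m(\pm\infty)=\pm1$; write $m_\xi(s)=m(s-\xi)$ and $M=\{m_\xi:\xi\in\mathbb R\}$. Functions on $[-\varepsilon^{-\gamma},\varepsilon^{-\gamma}]$ are extended to $\mathbb R$ by $-1$ to the left and $+1$ to the right of this interval, so that $\mu^\varepsilon$ is regarded as a measure on $m+L^2(\mathbb R)=\{u:\mathbb R\to\mathbb R:\ u-m\in L^2(\mathbb R)\}$. Finally $\mathrm{dist}_{L^2}(u,M)=\inf_{\xi\in\mathbb R}\|u-m_\xi\|_{L^2(\mathbb R)}$. *)

theory Defs
  imports "HOL-Probability.Probability"
begin

definition C3 :: "(real \<Rightarrow> real) \<Rightarrow> bool" where
  "C3 F \<longleftrightarrow> (\<forall>k<3. \<forall>x. (deriv ^^ k) F field_differentiable (at x)) \<and>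
             continuous_on UNIV ((deriv ^^ 3) F)"

definition double_well :: "(real \<Rightarrow> real) \<Rightarrow> bool" where
  "double_well F \<longleftrightarrow>
     C3 F \<and>
     (\<forall>u. F u \<ge> 0) \<and> (\<forall>u. F u = 0 \<longleftrightarrow> u = 1 \<or> u = -1) \<and>
     {u. deriv F u = 0} = {-1, 0, 1} \<and>
     deriv (deriv F) 0 < 0 \<and> deriv (deriv F) 1 > 0 \<and> deriv (deriv F) (-1) > 0 \<and>
     (\<forall>u. F (- u) = F u)"

definition kink :: "(real \<Rightarrow> real) \<Rightarrow> (real \<Rightarrow> real) \<Rightarrow> bool" where
  "kink F m \<longleftrightarrow>
     (\<forall>s. (m has_real_derivative sqrt (2 * F (m s))) (at s)) \<and> m 0 = 0 \<and>
     (m \<longlongrightarrow> 1) at_top \<and> (m \<longlongrightarrow> -1) at_bot"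

definition kinks :: "(real \<Rightarrow> real) \<Rightarrow> (real \<Rightarrow> real) set" where
  "kinks m = range (\<lambda>\<xi>. \<lambda>s. m (s - \<xi>))"


text \<open>Elements of the L2 spaces are represented by functions on the real line; the values outside
  \<open>S\<close> are irrelevant and functions that agree almost everywhere on \<open>S\<close> are not identified.
  Every set in the sigma-algebra \<open>L2_borel\<close> is a union of such classes of functions, so a measure on
  it is the same thing as a Borel measure on the quotient.\<close>

definition L2 :: "real set \<Rightarrow> (real \<Rightarrow> real) set" where
  "L2 S = {f. set_borel_measurable lborel S f \<and> set_integrable lborel S (\<lambda>x. (f x)\<^sup>2)}"

definition L2norm :: "real set \<Rightarrow> (real \<Rightarrow> real) \<Rightarrow> real" where
  "L2norm S f = sqrt (LINT x:S|lborel. (f x)\<^sup>2)"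

text \<open>\<open>affine_L2 S g\<close> is the affine space \<open>g + L2 S\<close>.\<close>

definition affine_L2 :: "real set \<Rightarrow> (real \<Rightarrow> real) \<Rightarrow> (real \<Rightarrow> real) set" where
  "affine_L2 S g = {u. (\<lambda>x. u x - g x) \<in> L2 S}"

definition L2_open :: "real set \<Rightarrow> (real \<Rightarrow> real) set \<Rightarrow> (real \<Rightarrow> real) set \<Rightarrow> bool" where
  "L2_open S X A \<longleftrightarrow> A \<subseteq> X \<and>
     (\<forall>u\<in>A. \<exists>r>0. \<forall>v\<in>X. L2norm S (\<lambda>x. v x - u x) < r \<longrightarrow> v \<in> A)"

definition L2_borel :: "real set \<Rightarrow> (real \<Rightarrow> real) set \<Rightarrow> (real \<Rightarrow> real) measure" where
  "L2_borel S X = sigma X {A. L2_open S X A}"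

definition L2_dist_set :: "(real \<Rightarrow> real) \<Rightarrow> (real \<Rightarrow> real) set \<Rightarrow> real" where
  "L2_dist_set u M = (INF v\<in>M. L2norm UNIV (\<lambda>x. u x - v x))"


text \<open>Constants count as Gaussian: the bridge below is deterministic at its endpoints.\<close>

definition gaussian_rv :: "'w measure \<Rightarrow> ('w \<Rightarrow> real) \<Rightarrow> bool" where
  "gaussian_rv P X \<longleftrightarrow> X \<in> borel_measurable P \<and>
     ((\<exists>a \<sigma>. 0 < \<sigma> \<and> distributed P lborel X (normal_density a \<sigma>)) \<or> (\<exists>a. AE \<omega> in P. X \<omega> = a))"

definition gaussian_process :: "'w measure \<Rightarrow> real set \<Rightarrow> ('w \<Rightarrow> real \<Rightarrow> real) \<Rightarrow> bool" where
  "gaussian_process P I U \<longleftrightarrow>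
     (\<forall>J c. finite J \<and> J \<subseteq> I \<longrightarrow> gaussian_rv P (\<lambda>\<omega>. \<Sum>s\<in>J. c s * U \<omega> s))"

definition covariance :: "'w measure \<Rightarrow> ('w \<Rightarrow> real) \<Rightarrow> ('w \<Rightarrow> real) \<Rightarrow> real" where
  "covariance P X Y =
     (\<integral>\<omega>. (X \<omega> - (\<integral>\<omega>'. X \<omega>' \<partial>P)) * (Y \<omega> - (\<integral>\<omega>'. Y \<omega>' \<partial>P)) \<partial>P)"

definition bridge_process ::
    "real \<Rightarrow> real \<Rightarrow> 'w measure \<Rightarrow> ('w \<Rightarrow> real \<Rightarrow> real) \<Rightarrow> bool" where
  "bridge_process \<gamma> \<epsilon> P U \<longleftrightarrow>
     prob_space P \<and>
     (\<forall>\<omega>\<in>space P. continuous_on {-1..1} (U \<omega>)) \<and>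
     gaussian_process P {-1..1} U \<and>
     (\<forall>s\<in>{-1..1}. (\<integral>\<omega>. U \<omega> s \<partial>P) = s) \<and>
     (\<forall>s\<in>{-1..1}. \<forall>t\<in>{-1..1}. covariance P (\<lambda>\<omega>. U \<omega> s) (\<lambda>\<omega>. U \<omega> t) =
        \<epsilon> powr (1 - \<gamma>) * (min s t + 1 - (s + 1) * (t + 1) / 2))"

text \<open>This law does not depend on the realisation \<open>(P, U)\<close>: it is determined by the mean and the
  covariance required in \<open>bridge_process\<close>.\<close>

definition nu_tilde :: "'w measure \<Rightarrow> ('w \<Rightarrow> real \<Rightarrow> real) \<Rightarrow> (real \<Rightarrow> real) measure" where
  "nu_tilde P U = distr P (L2_borel {-1..1} (L2 {-1..1})) U"

text \<open>The convention \<open>exp (-\<infinity>) = 0\<close> for elements of L2 on which the potential energy diverges.\<close>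

definition weight :: "(real \<Rightarrow> real) \<Rightarrow> real \<Rightarrow> real \<Rightarrow> (real \<Rightarrow> real) \<Rightarrow> real" where
  "weight F \<gamma> \<epsilon> u =
     (if set_integrable lborel {-1..1} (\<lambda>s. F (u s))
      then exp (- (\<epsilon> powr (- 1 - \<gamma>)) * (LINT s:{-1..1}|lborel. F (u s))) else 0)"

definition mu_tilde ::
    "(real \<Rightarrow> real) \<Rightarrow> real \<Rightarrow> real \<Rightarrow> (real \<Rightarrow> real) measure \<Rightarrow> (real \<Rightarrow> real) measure" where
  "mu_tilde F \<gamma> \<epsilon> \<nu> =
     density \<nu> (\<lambda>u. ennreal (weight F \<gamma> \<epsilon> u / (\<integral>v. weight F \<gamma> \<epsilon> v \<partial>\<nu>)))"

definition domain_scaled :: "real \<Rightarrow> real \<Rightarrow> real set" where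
  "domain_scaled \<gamma> \<epsilon> = {- (\<epsilon> powr (- \<gamma>)) .. \<epsilon> powr (- \<gamma>)}"

definition rescale :: "real \<Rightarrow> real \<Rightarrow> (real \<Rightarrow> real) \<Rightarrow> real \<Rightarrow> real" where
  "rescale \<gamma> \<epsilon> u = (\<lambda>s. u (\<epsilon> powr \<gamma> * s))"

definition extend :: "real \<Rightarrow> real \<Rightarrow> (real \<Rightarrow> real) \<Rightarrow> real \<Rightarrow> real" where
  "extend \<gamma> \<epsilon> u = (\<lambda>s. if s < - (\<epsilon> powr (- \<gamma>)) then -1 else if s > \<epsilon> powr (- \<gamma>) then 1 else u s)"

definition mu ::
    "(real \<Rightarrow> real) \<Rightarrow> real \<Rightarrow> real \<Rightarrow> (real \<Rightarrow> real) measure \<Rightarrow> (real \<Rightarrow> real) measure" where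
  "mu F \<gamma> \<epsilon> \<nu> =
     distr (mu_tilde F \<gamma> \<epsilon> \<nu>)
       (L2_borel (domain_scaled \<gamma> \<epsilon>) (L2 (domain_scaled \<gamma> \<epsilon>))) (rescale \<gamma> \<epsilon>)"

definition mu_line ::
    "(real \<Rightarrow> real) \<Rightarrow> (real \<Rightarrow> real) \<Rightarrow> real \<Rightarrow> real \<Rightarrow> (real \<Rightarrow> real) measure \<Rightarrow>
     (real \<Rightarrow> real) measure" where
  "mu_line F m \<gamma> \<epsilon> \<nu> =
     distr (mu F \<gamma> \<epsilon> \<nu>) (L2_borel UNIV (affine_L2 UNIV m)) (extend \<gamma> \<epsilon>)"

text \<open>The logarithm of a probability, with \<open>log 0 = -\<infinity>\<close> (whereas \<open>ln 0 = 0\<close> in the library).\<close>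

definition log_prob :: "real \<Rightarrow> ereal" where
  "log_prob p = (if p \<le> 0 then -\<infinity> else ereal (ln p))"

end

theory Submission
  imports Defs
begin

text \<open>Let \<open>b\<close> be a Lipschitz drift with \<open>b\<^sup>2 \<le> 2 F\<close> everywhere and \<open>b = sqrt (2 F)\<close> on \<open>[-1, 1]\<close>, and let
  \<open>\<sigma>\<close> be the integral of \<open>b\<close> over \<open>[-1, 1]\<close>. Completing the square as Bogomolny and Modica--Mortola do,
  a path \<open>v\<close> from \<open>-1\<close> to \<open>1\<close> has energy \<open>\<integral> v'\<^sup>2 / 2 + F v \<ge> \<sigma> + \<integral> (v' - b v)\<^sup>2 / 2\<close>. The kinks solve
  \<open>m' = b m\<close>, and this equation contracts near the wells, so \<open>v\<close> is within \<open>C \<integral> (v' - b v)\<^sup>2\<close> of a kink in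
  squared \<open>L\<^sup>2\<close> distance: at distance \<open>\<delta>\<close> from all kinks the energy is at least \<open>\<sigma> + c \<delta>\<^sup>2\<close>.

  In the rescaled variable the bridge has variance of order \<open>\<epsilon>\<close>, and its Schauder coefficients at dyadic
  levels below \<open>J\<close> are independent Gaussians. With \<open>2\<^sup>J\<close> of order \<open>\<epsilon> powr (- 5/6)\<close> the exponential moment
  of almost the whole Dirichlet energy of the interpolation at level \<open>J\<close> costs only \<open>exp (o(1) / \<epsilon>)\<close>,
  while the interpolation error is negligible in \<open>L\<^sup>2\<close>; this bounds the unnormalised weight of the event by
  \<open>exp (- (\<sigma> + c \<delta>\<^sup>2 / 2) / \<epsilon>)\<close>. The partition function is at least
  \<open>exp (- (\<sigma> + c \<delta>\<^sup>2 / 8) / \<epsilon>)\<close>, by restricting to a small tube around a kink and bounding its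
  probability by the product of the small-ball probabilities of the shifted coefficients.\<close>

section \<open>The drift of the kink\<close>

text \<open>Almost every bridge path has infinite Dirichlet energy, so the square cannot be
  completed along the path itself, only along an interpolation. Even there the whole energy over
  \<epsilon> has no finite exponential moment: it is half a sum of squares of standard normals, and
  \<open>exp (a * Y\<^sup>2 / 2)\<close> is integrable only for a < 1. A fraction \<kappa> of the
  energy is therefore left unspent, at the price of a factor \<open>1 / sqrt \<kappa>\<close> per
  coefficient. This fixes the level. Write 2^J = \<epsilon>^(-p). The price is exp (o(1) /
  \<epsilon>) if p < 1. The tail of the interpolation error has exponent of order 1 / (\<epsilon>
  h^2) with mesh h of order \<epsilon>^(p - \<gamma>), which beats any fixed multiple of 1 /
  \<epsilon> as soon as p > \<gamma>. The value 5/6 is halfway between 2/3 and 1. The gap c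
  \<delta>^2 is small against \<sigma>, so \<sigma> has to appear with the exact constant both in
  the bound on the event and in the bound on the partition function; cruder energy estimates on
  either side would swallow the gap.\<close>

lemma taylor_second_order:
  fixes f f' f'' :: "real \<Rightarrow> real"
  assumes d1: "\<And>x. (f has_real_derivative f' x) (at x)"
    and d2: "\<And>x. (f' has_real_derivative f'' x) (at x)"
  shows "\<exists>t. \<bar>t - u\<bar> \<le> \<bar>y\<bar> \<and> f (u + y) = f u + f' u * y + f'' t / 2 * y\<^sup>2"
proof (cases "y = 0")
  case False
  define dd where "dd = (\<lambda>m::nat. if m = 0 then f else if m = 1 then f' else f'')"
  have "\<exists>t. (if u + y < u then u + y < t \<and> t < u else u < t \<and> t < u + y) \<and>
      f (u + y) = (\<Sum>m<2. dd m u / fact m * (u + y - u) ^ m) + dd 2 t / fact 2 * (u + y - u) ^ 2"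
    by (rule Taylor[of 2 dd f "min u (u+y)" "max u (u+y)" u "u + y"])
      (use False d1 d2 in \<open>auto simp: dd_def less_2_cases_iff\<close>)
  then obtain t where "if u + y < u then u + y < t \<and> t < u else u < t \<and> t < u + y"
    and eq: "f (u + y) = f u + f' u * y + f'' t / 2 * y\<^sup>2"
    by (auto simp: dd_def numeral_2_eq_2)
  then have "\<bar>t - u\<bar> \<le> \<bar>y\<bar>" by (auto split: if_splits)
  then show ?thesis using eq by blast
qed auto

lemma taylor_upper:
  fixes f f' f'' :: "real \<Rightarrow> real"
  assumes d1: "\<And>x. (f has_real_derivative f' x) (at x)"
    and d2: "\<And>x. (f' has_real_derivative f'' x) (at x)"
    and b: "\<And>x. \<bar>x - u\<bar> \<le> 1 \<Longrightarrow> \<bar>f'' x\<bar> \<le> A" and y: "\<bar>y\<bar> \<le> 1"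
  shows "f (u + y) \<le> f u + f' u * y + A / 2 * y\<^sup>2"
proof -
  obtain t where t: "\<bar>t - u\<bar> \<le> \<bar>y\<bar>" and eq: "f (u + y) = f u + f' u * y + f'' t / 2 * y\<^sup>2"
    using taylor_second_order[OF d1 d2] by blast
  have "\<bar>f'' t\<bar> \<le> A" using t y by (intro b) auto
  then have "f'' t / 2 * y\<^sup>2 \<le> A / 2 * y\<^sup>2" by (intro mult_right_mono) auto
  then show ?thesis using eq by simp
qed

text \<open>Glaeser's inequality: minimise the quadratic upper bound at \<open>y = - f' u / A\<close>.\<close>

lemma glaeser:
  fixes f f' f'' :: "real \<Rightarrow> real"
  assumes d1: "\<And>x. (f has_real_derivative f' x) (at x)"
    and d2: "\<And>x. (f' has_real_derivative f'' x) (at x)"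
    and b: "\<And>x. \<bar>x - u\<bar> \<le> 1 \<Longrightarrow> \<bar>f'' x\<bar> \<le> A"
    and nn: "\<And>x. 0 \<le> f x" and A: "\<bar>f' u\<bar> \<le> A" "0 < A"
  shows "\<bar>f' u\<bar> \<le> sqrt A * sqrt (2 * f u)"
proof -
  have "0 \<le> f (u + - (f' u / A))" by (rule nn)
  also have "\<dots> \<le> f u + f' u * (- (f' u / A)) + A / 2 * (- (f' u / A))\<^sup>2"
    by (rule taylor_upper[OF d1 d2 b]) (use A in auto)
  also have "\<dots> = f u - (f' u)\<^sup>2 / (2 * A)"
    using A by (simp add: field_simps power2_eq_square)
  finally have "(f' u)\<^sup>2 \<le> A * (2 * f u)" using A by (simp add: field_simps)
  then have "sqrt ((f' u)\<^sup>2) \<le> sqrt (A * (2 * f u))" by (rule real_sqrt_le_mono)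
  then show ?thesis by (simp add: real_sqrt_mult)
qed

text \<open>The root need not be differentiable where f vanishes. The bound is proved for
  \<open>sqrt (2 * f x + t)\<close> with t > 0, whose derivative
  \<open>f' x / sqrt (2 * f x + t)\<close> inherits the bound K from the hypothesis, and then t
  tends to 0.\<close>

lemma sqrt_lipschitz:
  fixes f f' :: "real \<Rightarrow> real"
  assumes d1: "\<And>x. (f has_real_derivative f' x) (at x)"
    and g: "\<And>x. x \<in> {a..b} \<Longrightarrow> \<bar>f' x\<bar> \<le> K * sqrt (2 * f x)"
    and nn: "\<And>x. 0 \<le> f x" and K: "0 \<le> K" and xy: "x \<in> {a..b}" "y \<in> {a..b}"
  shows "\<bar>sqrt (2 * f x) - sqrt (2 * f y)\<bar> \<le> K * \<bar>x - y\<bar>"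
proof -
  have *: "\<bar>sqrt (2 * f x + t) - sqrt (2 * f y + t)\<bar> \<le> K * \<bar>x - y\<bar>" if t: "t > 0" for t
  proof -
    have pos: "2 * f z + t > 0" for z using nn[of z] t by linarith
    have d: "((\<lambda>z. sqrt (2 * f z + t)) has_real_derivative f' z / sqrt (2 * f z + t)) (at z)" for z
      by (rule derivative_eq_intros d1 refl | use pos[of z] in \<open>simp add: field_simps\<close>)+
    have bd: "norm (f' z / sqrt (2 * f z + t)) \<le> K" if "z \<in> {a..b}" for z
    proof -
      have "\<bar>f' z\<bar> \<le> K * sqrt (2 * f z)" by (rule g[OF that])
      also have "\<dots> \<le> K * sqrt (2 * f z + t)" using K t by (intro mult_left_mono real_sqrt_le_mono) auto
      finally have le: "\<bar>f' z\<bar> \<le> K * sqrt (2 * f z + t)" .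
      have sp: "0 < sqrt (2 * f z + t)" using pos[of z] by simp
      have "norm (f' z / sqrt (2 * f z + t)) = \<bar>f' z\<bar> / sqrt (2 * f z + t)"
        using sp by (simp only: real_norm_def abs_divide abs_of_pos)
      also have "\<dots> \<le> K" by (subst pos_divide_le_eq[OF sp]) (rule le)
      finally show ?thesis .
    qed
    have "norm (sqrt (2 * f x + t) - sqrt (2 * f y + t)) \<le> K * norm (x - y)"
      by (rule field_differentiable_bound[of "{a..b}" _ "\<lambda>z. f' z / sqrt (2 * f z + t)"])
        (use d bd xy in \<open>auto intro: has_field_derivative_at_within\<close>)
    then show ?thesis by simp
  qed
  have "((\<lambda>t. \<bar>sqrt (2 * f x + t) - sqrt (2 * f y + t)\<bar>) \<longlongrightarrow> \<bar>sqrt (2 * f x + 0) - sqrt (2 * f y + 0)\<bar>) (at_right 0)"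
    by (intro tendsto_intros)
  then have "\<bar>sqrt (2 * f x + 0) - sqrt (2 * f y + 0)\<bar> \<le> K * \<bar>x - y\<bar>"
    by (rule tendsto_upperbound) (auto intro!: eventually_at_rightI[of 0 1] *)
  then show ?thesis by simp
qed

section \<open>Behaviour of the potential and of \<open>sqrt (2 * F u)\<close> at the wells\<close>

locale well_potential =
  fixes F :: "real \<Rightarrow> real"
  assumes dw: "double_well F"
begin

abbreviation "F1 \<equiv> deriv F"
abbreviation "F2 \<equiv> deriv (deriv F)"

lemma C3: "C3 F" and F_nonneg: "0 \<le> F u" and F_zero: "F u = 0 \<longleftrightarrow> u = 1 \<or> u = -1"
  and F1_zero: "F1 u = 0 \<longleftrightarrow> u \<in> {-1, 0, 1}" and F2_1: "F2 1 > 0"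
  and F_even: "F (- u) = F u"
  using dw unfolding double_well_def by auto

lemma F_deriv: "(F has_real_derivative F1 u) (at u)"
  and F1_deriv: "(F1 has_real_derivative F2 u) (at u)"
  and F2_diff: "F2 field_differentiable at u"
proof -
  have *: "(deriv ^^ k) F field_differentiable (at u)" if "k < 3" for k
    using C3 that unfolding C3_def by auto
  show "(F has_real_derivative F1 u) (at u)" using *[of 0] field_differentiable_derivI by auto
  show "(F1 has_real_derivative F2 u) (at u)" using *[of 1] field_differentiable_derivI by auto
  show "F2 field_differentiable at u" using *[of 2] by (simp add: numeral_2_eq_2)
qed

lemma F_cont: "continuous_on S F" and F1_cont: "continuous_on S F1" and F2_cont: "continuous_on S F2"
  and F2_isCont: "isCont F2 u"
proof -
  show "isCont F2 u" for u using F2_diff by (rule field_differentiable_imp_continuous_at)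
  then show "continuous_on S F2" by (simp add: continuous_at_imp_continuous_on)
  show "continuous_on S F" "continuous_on S F1"
    using F_deriv F1_deriv by (meson DERIV_isCont continuous_at_imp_continuous_on)+
qed

definition bt :: "real \<Rightarrow> real" where "bt u = sqrt (2 * F u)"

lemma bt_nonneg: "0 \<le> bt u" and bt_sq: "(bt u)\<^sup>2 = 2 * F u" and bt_even: "bt (- u) = bt u"
  and bt_1: "bt 1 = 0" "bt (-1) = 0"
  using F_nonneg[of u] F_zero[of 1] F_zero[of "-1"] by (auto simp: bt_def F_even)

lemma bt_lipschitz: "\<exists>K>0. \<forall>x\<in>{-2..2}. \<forall>y\<in>{-2..2}. \<bar>bt x - bt y\<bar> \<le> K * \<bar>x - y\<bar>"
proof -
  have "compact (F2 ` {-3..3})" "compact (F1 ` {-3..3})"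
    by (intro compact_continuous_image F1_cont F2_cont compact_Icc)+
  then obtain A1 A2 where "\<And>x. x \<in> {-3..3} \<Longrightarrow> \<bar>F2 x\<bar> \<le> A2" "\<And>x. x \<in> {-3..3} \<Longrightarrow> \<bar>F1 x\<bar> \<le> A1"
    unfolding compact_eq_bounded_closed bounded_iff by fastforce
  then have A: "\<bar>F2 x\<bar> \<le> max 1 (max A1 A2)" "\<bar>F1 x\<bar> \<le> max 1 (max A1 A2)" if "x \<in> {-3..3}" for x
    using that by (auto simp: le_max_iff_disj)
  \<comment> \<open>One constant dominates both derivatives: \<open>F2\<close> as the curvature
    bound, and \<open>F1\<close> so that the minimiser in Glaeser's inequality stays within distance
    1. Hence bounds on [-3, 3] for a conclusion on [-2, 2].\<close>
  define A where "A = max 1 (max A1 A2)"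
  have Apos: "A > 0" by (auto simp: A_def)
  have g: "\<bar>F1 x\<bar> \<le> sqrt A * sqrt (2 * F x)" if "x \<in> {-2..2}" for x
    by (rule glaeser[OF F_deriv F1_deriv _ F_nonneg])
      (use A[folded A_def] Apos that in \<open>auto simp: abs_le_iff\<close>)
  show ?thesis
  proof (intro exI[of _ "sqrt A"] conjI ballI)
    show "\<bar>bt x - bt y\<bar> \<le> sqrt A * \<bar>x - y\<bar>" if "x \<in> {-2..2}" "y \<in> {-2..2}" for x y
      unfolding bt_def by (rule sqrt_lipschitz[OF F_deriv g F_nonneg _ that]) (use Apos in auto)
  qed (use Apos in auto)
qed

text \<open>\<open>F1\<close> has no zero beyond 1, so it keeps one sign there; a negative value at
  z would persist on all of (1, z) and push F below F 1 = 0.\<close>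

lemma F_mono: "1 \<le> x \<Longrightarrow> x \<le> y \<Longrightarrow> F x \<le> F y"
proof -
  have pos: "0 < F1 z" if "1 < z" for z
  proof (rule ccontr)
    assume "\<not> 0 < F1 z"
    moreover have "F1 z \<noteq> 0" using F1_zero[of z] that by auto
    ultimately have neg: "F1 z < 0" by auto
    have "F1 w < 0" if "1 < w" "w < z" for w
    proof (rule ccontr)
      assume "\<not> F1 w < 0"
      then have "\<exists>x. w \<le> x \<and> x \<le> z \<and> F1 x = 0"
        using neg that IVT2'[of F1 z 0 w] F1_cont by auto
      then show False using F1_zero that by fastforce
    qed
    then have "F z < F 1"
      using DERIV_neg_imp_decreasing_open[of 1 z F] that F_deriv F_cont by blast
    then show False using F_zero[of 1] F_nonneg[of z] by auto
  qed
  show "F x \<le> F y" if "1 \<le> x" "x \<le> y"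
  proof (cases "x = y")
    case False
    have "F x < F y"
    proof (rule DERIV_pos_imp_increasing_open[of x y F])
      show "\<exists>y. (F has_real_derivative y) (at z) \<and> y > 0" if "x < z" "z < y" for z
        using F_deriv[of z] pos[of z] that \<open>1 \<le> x\<close> by auto
    qed (use that False F_cont in auto)
    then show ?thesis by simp
  qed simp
qed

lemma bt_deriv: "0 < F z \<Longrightarrow> (bt has_real_derivative (F1 z / bt z)) (at z)"
proof -
  assume "0 < F z"
  then have "(sqrt has_real_derivative inverse (sqrt (2 * F z)) / 2) (at (2 * F z))"
    by (intro DERIV_real_sqrt) simp
  then have "((\<lambda>x. sqrt (2 * F x)) has_real_derivative inverse (sqrt (2 * F z)) / 2 * (2 * F1 z)) (at z)"
    by (rule DERIV_chain2[where f = sqrt and g = "\<lambda>x. 2 * F x" and x = z]) (rule DERIV_cmult[OF F_deriv])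
  moreover have "inverse p / 2 * (2 * q) = q / p" for p q :: real by (simp add: field_simps)
  moreover have "bt = (\<lambda>x. sqrt (2 * F x))" by (rule ext) (rule bt_def)
  ultimately show ?thesis by (simp only:)
qed

lemma F2_near_1: "\<exists>\<rho>>0. \<rho> \<le> 1/2 \<and> (\<forall>u. \<bar>u - 1\<bar> \<le> \<rho> \<longrightarrow> F2 1 / 2 \<le> F2 u)"
proof -
  have "\<exists>d>0. \<forall>u. dist u 1 < d \<longrightarrow> dist (F2 u) (F2 1) < F2 1 / 2"
    using F2_isCont[of 1] F2_1 unfolding continuous_at_eps_delta by (metis half_gt_zero)
  then obtain d where d: "d > 0" "\<And>u. \<bar>u - 1\<bar> < d \<Longrightarrow> \<bar>F2 u - F2 1\<bar> < F2 1 / 2"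
    by (auto simp: dist_real_def)
  show ?thesis
  proof (intro exI[of _ "min (1/2) (d/2)"] conjI allI impI)
    show "F2 1 / 2 \<le> F2 u" if "\<bar>u - 1\<bar> \<le> min (1/2) (d/2)" for u
    proof -
      have "\<bar>u - 1\<bar> < d" using that d(1) by linarith
      then show ?thesis using d(2)[of u] by linarith
    qed
  qed (use d in auto)
qed

text \<open>The well at 1 is nondegenerate, so F grows quadratically near it; on the rest of [0, 1]
  compactness gives a positive minimum, and beyond the well monotonicity carries on the value
  reached at the edge of the neighbourhood. Evenness covers the other half line. The truncation at 1
  is there because F may stay bounded at infinity.\<close>

lemma bt_lower: "\<exists>k>0. \<forall>u. k * min \<bar>\<bar>u\<bar> - 1\<bar> 1 \<le> bt u"
proof -
  obtain \<rho> where \<rho>: "\<rho> > 0" "\<rho> \<le> 1/2" and near: "\<And>u. \<bar>u - 1\<bar> \<le> \<rho> \<Longrightarrow> F2 1 / 2 \<le> F2 u"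
    using F2_near_1 by blast
  define a where "a = F2 1 / 4"
  have a: "a > 0" using F2_1 by (simp add: a_def)
  have Fnear: "a * (u - 1)\<^sup>2 \<le> F u" if "\<bar>u - 1\<bar> \<le> \<rho>" for u
  proof -
    obtain t where t: "\<bar>t - 1\<bar> \<le> \<bar>u - 1\<bar>" "F (1 + (u - 1)) = F 1 + F1 1 * (u - 1) + F2 t / 2 * (u - 1)\<^sup>2"
      using taylor_second_order[OF F_deriv F1_deriv, of 1 "u - 1"] by blast
    have "2 * a \<le> F2 t" using near[of t] t(1) that by (simp add: a_def)
    then have "2 * a / 2 * (u - 1)\<^sup>2 \<le> F2 t / 2 * (u - 1)\<^sup>2" by (intro mult_right_mono) auto
    moreover have "F 1 = 0" "F1 1 = 0" using F_zero[of 1] F1_zero[of 1] by auto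
    ultimately show ?thesis using t(2) by simp
  qed
  have "compact {0..1-\<rho>}" "{0..1-\<rho>} \<noteq> {}" using \<rho> by auto
  from continuous_attains_inf[OF this F_cont]
  obtain x where x: "x \<in> {0..1-\<rho>}" "\<And>y. y \<in> {0..1-\<rho>} \<Longrightarrow> F x \<le> F y" by blast
  have Fx: "F x > 0" using F_nonneg[of x] F_zero[of x] x(1) \<rho> by (simp add: less_le)
  define q where "q = min (a * \<rho>\<^sup>2) (min (F x) a)"
  have q: "q > 0" using a \<rho> Fx by (simp add: q_def)
  have main: "q * (min \<bar>u - 1\<bar> 1)\<^sup>2 \<le> F u" if "u \<ge> 0" for u
  proof (cases "\<bar>u - 1\<bar> \<le> \<rho>")
    case True
    have "q * (min \<bar>u - 1\<bar> 1)\<^sup>2 \<le> a * (u - 1)\<^sup>2"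
      using True \<rho> a by (auto simp: q_def intro!: mult_mono)
    then show ?thesis using Fnear[OF True] by linarith
  next
    case False
    have "q * (min \<bar>u - 1\<bar> 1)\<^sup>2 \<le> q * 1"
      using q by (intro mult_left_mono power_le_one) auto
    also have "q \<le> F u"
    proof (cases "u \<le> 1")
      case True
      then show ?thesis using x(2)[of u] False that by (auto simp: q_def)
    next
      case gt: False
      have "a * \<rho>\<^sup>2 \<le> F (1 + \<rho>)" using Fnear[of "1 + \<rho>"] \<rho> by simp
      also have "\<dots> \<le> F u" using F_mono[of "1 + \<rho>" u] \<rho> gt False by auto
      finally show ?thesis by (simp add: q_def)
    qed
    finally show ?thesis by simp
  qed
  have "sqrt (2 * q) * min \<bar>\<bar>u\<bar> - 1\<bar> 1 \<le> bt u" for u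
  proof -
    have "q * (min \<bar>\<bar>u\<bar> - 1\<bar> 1)\<^sup>2 \<le> F u" using main[of "\<bar>u\<bar>"] F_even[of u] by (cases "u \<ge> 0") auto
    then have "sqrt (2 * q * (min \<bar>\<bar>u\<bar> - 1\<bar> 1)\<^sup>2) \<le> sqrt (2 * F u)" by (intro real_sqrt_le_mono) simp
    then show ?thesis by (simp add: real_sqrt_mult bt_def)
  qed
  then show ?thesis using q by (intro exI[of _ "sqrt (2 * q)"]) auto
qed

end

text \<open>Off \<open>[-1, 1]\<close> the drift \<open>b\<close> is not the one of the paper's Modica--Mortola trick: it points back
  to the wells and is truncated, so that it is Lipschitz for every growth of \<open>F\<close> at infinity.\<close>

locale drift = well_potential F for F +
  fixes m :: "real \<Rightarrow> real" and k K :: real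
  assumes kink: "kink F m" and k: "k > 0" and K: "K > 0"
    and klow: "\<And>u. k * min \<bar>\<bar>u\<bar> - 1\<bar> 1 \<le> bt u"
    and lip: "\<And>x y. x \<in> {-2..2} \<Longrightarrow> y \<in> {-2..2} \<Longrightarrow> \<bar>bt x - bt y\<bar> \<le> K * \<bar>x - y\<bar>"
begin

definition b :: "real \<Rightarrow> real" where
  "b u = bt (max (-1) (min 1 u)) - k * min (max (\<bar>u\<bar> - 1) 0) 1"

lemma b_inside: "\<bar>u\<bar> \<le> 1 \<Longrightarrow> b u = bt u"
  by (auto simp: b_def abs_le_iff min_def max_def)

lemma b_outside: "1 \<le> \<bar>u\<bar> \<Longrightarrow> b u = - k * min (\<bar>u\<bar> - 1) 1"
  using bt_1 by (auto simp: b_def min_def max_def abs_if split: if_splits)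

lemma b_1: "b 1 = 0" "b (-1) = 0"
  using b_inside[of 1] b_inside[of "-1"] bt_1 by auto

lemma b_even: "b (- u) = b u"
  using bt_even by (cases "\<bar>u\<bar> \<le> 1") (auto simp: b_inside b_outside)

text \<open>Outside [-1, 1] this is the reason for giving b the slope k of
  \<open>klow\<close>.\<close>

lemma b_sq_le: "(b u)\<^sup>2 \<le> 2 * F u"
proof (cases "\<bar>u\<bar> \<le> 1")
  case False
  have "\<bar>b u\<bar> \<le> bt u" using klow[of u] k False by (simp add: b_outside abs_mult)
  then have "\<bar>b u\<bar>\<^sup>2 \<le> (bt u)\<^sup>2" by (intro power_mono) auto
  then show ?thesis by (simp add: bt_sq)
qed (simp add: b_inside bt_sq)

lemma b_lip: "\<bar>b x - b y\<bar> \<le> (K + k) * \<bar>x - y\<bar>"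
proof -
  have "\<bar>bt (max (-1) (min 1 x)) - bt (max (-1) (min 1 y))\<bar> \<le> K * \<bar>max (-1) (min 1 x) - max (-1) (min 1 y)\<bar>"
    by (rule lip) auto
  also have "\<dots> \<le> K * \<bar>x - y\<bar>" using K by (intro mult_left_mono) auto
  finally have 1: "\<bar>bt (max (-1) (min 1 x)) - bt (max (-1) (min 1 y))\<bar> \<le> K * \<bar>x - y\<bar>" .
  have "\<bar>k * min (max (\<bar>x\<bar> - 1) 0) 1 - k * min (max (\<bar>y\<bar> - 1) 0) 1\<bar>
     = k * \<bar>min (max (\<bar>x\<bar> - 1) 0) 1 - min (max (\<bar>y\<bar> - 1) 0) 1\<bar>"
    using k by (simp add: abs_mult flip: right_diff_distrib)
  also have "\<dots> \<le> k * \<bar>x - y\<bar>"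
  proof (intro mult_left_mono)
    have "\<bar>min (max p 0) 1 - min (max q 0) 1\<bar> \<le> \<bar>p - q\<bar>" for p q :: real
      by (auto simp: min_def max_def)
    then have "\<bar>min (max (\<bar>x\<bar> - 1) 0) 1 - min (max (\<bar>y\<bar> - 1) 0) 1\<bar> \<le> \<bar>(\<bar>x\<bar> - 1) - (\<bar>y\<bar> - 1)\<bar>" .
    also have "\<dots> \<le> \<bar>x - y\<bar>" by simp
    finally show "\<bar>min (max (\<bar>x\<bar> - 1) 0) 1 - min (max (\<bar>y\<bar> - 1) 0) 1\<bar> \<le> \<bar>x - y\<bar>" .
  qed (use k in simp)
  finally have 2: "\<bar>k * min (max (\<bar>x\<bar> - 1) 0) 1 - k * min (max (\<bar>y\<bar> - 1) 0) 1\<bar> \<le> k * \<bar>x - y\<bar>" .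
  have "\<bar>(p - q) - (r - s)\<bar> \<le> K' + k'" if "\<bar>p - r\<bar> \<le> K'" "\<bar>q - s\<bar> \<le> k'" for p q r s K' k' :: real
    using that by linarith
  from this[OF 1 2] show ?thesis unfolding b_def distrib_right .
qed

lemma b_isCont: "isCont b u"
proof -
  have "(K + k)-lipschitz_on UNIV b"
    using b_lip K k by (intro lipschitz_onI) (auto simp: dist_real_def)
  then show ?thesis using lipschitz_on_continuous_on continuous_on_eq_continuous_at by blast
qed

lemma b_cont: "continuous_on S b"
  using b_isCont by (simp add: continuous_at_imp_continuous_on)

text \<open>The antiderivative that turns the cross term of the completed square into a boundary
  term.\<close>

definition Phi :: "real \<Rightarrow> real" where "Phi = (SOME P. \<forall>u. (P has_real_derivative b u) (at u))"

lemma Phi_deriv: "(Phi has_real_derivative b u) (at u)"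
proof -
  have "\<exists>P. \<forall>u. (P has_real_derivative b u) (at u)"
    using einterval_antiderivative[of "-\<infinity>" "\<infinity>" b] b_isCont by (auto simp: has_real_derivative_iff_has_vector_derivative)
  then show ?thesis unfolding Phi_def by (rule someI2_ex) auto
qed

definition surface_tension :: real where "surface_tension = Phi 1 - Phi (-1)"

text \<open>Left of the well the mean value theorem applies to \<open>bt\<close>, whose slope
  \<open>F1 z / bt z\<close> is at most - a / K because \<open>F1 z \<le> - a * (1 - z)\<close> and
  \<open>bt z \<le> K * (1 - z)\<close>; right of the well the slope is - k by construction of b.
  The two one-sided estimates are glued at 1. The well at -1 is reached later by reflection.\<close>

lemma b_contracting:
  "\<exists>\<rho> c. \<rho> > 0 \<and> \<rho> \<le> 1/2 \<and> c > 0 \<and> (\<forall>w z. 1 - \<rho> \<le> w \<longrightarrow> w \<le> 1 \<longrightarrow> \<bar>z\<bar> \<le> \<rho> \<longrightarrow> z * (b (w + z) - b w) \<le> - c * z\<^sup>2)"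
proof -
  obtain r where r: "r > 0" "r \<le> 1/2" and near: "\<And>u. \<bar>u - 1\<bar> \<le> r \<Longrightarrow> F2 1 / 2 \<le> F2 u"
    using F2_near_1 by blast
  define a where "a = F2 1 / 2"
  define c where "c = min k (a / K)"
  have a: "a > 0" using F2_1 by (simp add: a_def)
  have c: "c > 0" "c \<le> k" "c * K \<le> a" using a k K by (auto simp: c_def min_def field_simps)
  have F1_near: "F1 u \<le> - a * (1 - u)" if u: "1 - r \<le> u" "u < 1" for u
  proof -
    obtain t where t: "t > u" "t < 1" "F1 1 - F1 u = (1 - u) * F2 t"
      using MVT2[of u 1 F1 F2] F1_deriv u(2) by blast
    have "(1 - u) * a \<le> (1 - u) * F2 t" using near[of t] t that by (intro mult_left_mono) (auto simp: a_def)
    then show ?thesis using t(3) F1_zero[of 1] by (simp add: algebra_simps)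
  qed
  have left: "b y - b x \<le> - c * (y - x)" if "1 - r \<le> x" "x < y" "y \<le> 1" for x y
  proof -
    have "\<exists>l z. x < z \<and> z < y \<and> (bt has_real_derivative l) (at z) \<and> bt y - bt x = (y - x) * l"
    proof (rule MVT[OF that(2)])
      show "continuous_on {x..y} bt" unfolding bt_def by (intro continuous_intros F_cont)
      show "bt differentiable (at z)" if "x < z" "z < y" for z
      proof -
        have "F z > 0" using F_nonneg[of z] F_zero[of z] that \<open>y \<le> 1\<close> \<open>1 - r \<le> x\<close> r by (simp add: less_le)
        then show ?thesis using bt_deriv real_differentiable_def by blast
      qed
    qed
    then obtain l z where z: "x < z" "z < y" "(bt has_real_derivative l) (at z)" "bt y - bt x = (y - x) * l" by blast
    have Fz: "F z > 0" using F_nonneg[of z] F_zero[of z] z that r by (simp add: less_le)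
    then have "(bt has_real_derivative (F1 z / bt z)) (at z)" by (rule bt_deriv)
    then have l: "l = F1 z / bt z" using z(3) DERIV_unique by blast
    have bz: "bt z > 0" using Fz by (simp add: bt_def)
    have "bt z \<le> K * (1 - z)" using lip[of z 1] bt_1 z that r bz by auto
    then have "c * bt z \<le> c * (K * (1 - z))" using c by (intro mult_left_mono) auto
    also have "\<dots> \<le> a * (1 - z)" using mult_right_mono[OF c(3), of "1 - z"] z that by (simp add: mult.assoc)
    also have "\<dots> \<le> - F1 z" using F1_near[of z] z that by simp
    finally have "l \<le> - c" unfolding l using bz by (simp add: field_simps)
    then have "(y - x) * l \<le> (y - x) * (- c)" using that by (intro mult_left_mono) auto
    then show ?thesis using z(4) b_inside[of y] b_inside[of x] that r by (simp add: mult.commute)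
  qed
  have right: "b y - b x \<le> - c * (y - x)" if "1 \<le> x" "x < y" "y \<le> 1 + r" for x y
  proof -
    have "b y - b x = - k * (y - x)" using that r by (simp add: b_outside algebra_simps)
    also have "\<dots> \<le> - c * (y - x)" using c that by (intro mult_right_mono) auto
    finally show ?thesis .
  qed
  have mono: "b y - b x \<le> - c * (y - x)" if "1 - r \<le> x" "x \<le> y" "y \<le> 1 + r" for x y
  proof -
    consider "x = y" | "x < y" "y \<le> 1" | "1 \<le> x" "x < y" | "x < 1" "1 < y" using \<open>x \<le> y\<close> by linarith
    then show ?thesis
    proof cases
      case 4
      then show ?thesis using left[of x 1] right[of 1 y] that by (simp add: algebra_simps)
    qed (use left right that in auto)
  qed
  \<comment> \<open>Half the radius, so that both w and w + z stay within r of 1.\<close>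
  show ?thesis
  proof (rule exI[of _ "r / 2"], rule exI[of _ c], intro conjI allI impI)
    fix w z assume w: "1 - r / 2 \<le> w" "w \<le> 1" "\<bar>z\<bar> \<le> r / 2"
    show "z * (b (w + z) - b w) \<le> - c * z\<^sup>2"
    proof (cases "z \<ge> 0")
      case True
      have "z * (b (w + z) - b w) \<le> z * (- c * ((w + z) - w))"
        using True w r by (intro mult_left_mono mono) auto
      then show ?thesis by (simp add: power2_eq_square algebra_simps)
    next
      case False
      have "(- z) * (b w - b (w + z)) \<le> (- z) * (- c * (w - (w + z)))"
        using False w r by (intro mult_left_mono mono) auto
      then show ?thesis by (simp add: power2_eq_square algebra_simps)
    qed
  qed (use r c in auto)
qed

section \<open>Bounds, decay and reflection of the kink\<close>

lemma m_deriv0: "(m has_real_derivative bt (m s)) (at s)"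
  and m_0: "m 0 = 0" and m_top: "(m \<longlongrightarrow> 1) at_top" and m_bot: "(m \<longlongrightarrow> -1) at_bot"
  using kink by (auto simp: kink_def bt_def)

lemma m_mono: "s \<le> t \<Longrightarrow> m s \<le> m t"
  by (rule DERIV_nonneg_imp_nondecreasing) (use m_deriv0 bt_nonneg in blast)+

lemma m_bounds: "-1 \<le> m s" "m s \<le> 1"
proof -
  show "m s \<le> 1"
    by (rule tendsto_lowerbound[OF m_top]) (auto simp: eventually_at_top_linorder intro!: exI[of _ s] m_mono)
  show "-1 \<le> m s"
    by (rule tendsto_upperbound[OF m_bot]) (auto simp: eventually_at_bot_linorder intro!: exI[of _ s] m_mono)
qed

lemma m_deriv: "(m has_real_derivative b (m s)) (at s)"
  using m_deriv0[of s] b_inside[of "m s"] m_bounds[of s] by auto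

lemma m_cont: "continuous_on S m"
  using m_deriv by (meson DERIV_isCont continuous_at_imp_continuous_on)

lemma m_bt_le: "bt (m s) \<ge> k * (1 - \<bar>m s\<bar>)"
proof -
  have "\<bar>\<bar>m s\<bar> - 1\<bar> = 1 - \<bar>m s\<bar>" "1 - \<bar>m s\<bar> \<le> 1" using m_bounds[of s] by auto
  then show ?thesis using klow[of "m s"] by simp
qed

text \<open>For positive times the kink is nonnegative and satisfies m' \<ge> k (1 - m), so
  \<open>(1 - m s) * exp (k * s)\<close> cannot increase.\<close>

lemma m_decay:
  assumes "s \<ge> 0" shows "1 - m s \<le> exp (- k * s)"
proof -
  have "(1 - m s) * exp (k * s) \<le> (1 - m 0) * exp (k * 0)"
  proof (rule DERIV_nonpos_imp_nonincreasing[OF assms], intro exI conjI)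
    fix t :: real assume t: "0 \<le> t" "t \<le> s"
    show "((\<lambda>s. (1 - m s) * exp (k * s)) has_real_derivative (k * (1 - m t) - bt (m t)) * exp (k * t)) (at t)"
      by (rule derivative_eq_intros m_deriv0 refl)+ (simp add: algebra_simps)
    have "m 0 \<le> m t" using t m_mono by auto
    then show "(k * (1 - m t) - bt (m t)) * exp (k * t) \<le> 0"
      using m_bt_le[of t] m_0 by (intro mult_nonpos_nonneg) auto
  qed
  then show ?thesis by (simp add: m_0 exp_minus field_simps)
qed

text \<open>Evenness of F makes the point reflection of a kink a kink with the same constants.
  Interpreting the locale for it transfers statements about the well at 1, forward in time, to the
  well at -1, backward in time.\<close>

lemma m_reflect: "drift F (\<lambda>s. - m (- s)) k K"
proof
  have d: "((\<lambda>s. - m (- s)) has_real_derivative sqrt (2 * F (- m (- s)))) (at s)" for s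
  proof -
    have "(uminus has_real_derivative -1) (at s)" by (auto intro!: derivative_eq_intros)
    from DERIV_minus[OF DERIV_chain2[OF m_deriv0 this]] show ?thesis by (simp add: bt_def F_even)
  qed
  have t: "((\<lambda>s. - m (- s)) \<longlongrightarrow> - (-1)) at_top" "((\<lambda>s. - m (- s)) \<longlongrightarrow> -1) at_bot"
    by (intro tendsto_intros filterlim_compose[OF m_bot] filterlim_compose[OF m_top] filterlim_uminus_at_bot_at_top filterlim_uminus_at_top_at_bot)+
  show "Defs.kink F (\<lambda>s. - m (- s))"
    unfolding kink_def using d t m_0 by auto
qed (use k K klow lip in auto)

lemma m_decay': "s \<le> 0 \<Longrightarrow> m s + 1 \<le> exp (k * s)"
  using drift.m_decay[OF m_reflect, of "- s"] by simp

end

section \<open>Stability of the kink equation\<close>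

text \<open>Meant for functions that are differentiable off the finitely many nodes of an
  interpolation. Integrability of the derivative comes out of the fundamental theorem; replacing it
  by h at the exceptional points makes the comparison hold everywhere.\<close>

lemma ftc_le:
  fixes G G' h :: "real \<Rightarrow> real"
  assumes ab: "a \<le> b" and X: "finite X" and cont: "continuous_on {a..b} G"
    and d: "\<And>s. a < s \<Longrightarrow> s < b \<Longrightarrow> s \<notin> X \<Longrightarrow> (G has_real_derivative G' s) (at s)"
    and le: "\<And>s. a < s \<Longrightarrow> s < b \<Longrightarrow> s \<notin> X \<Longrightarrow> G' s \<le> h s"
    and h: "h integrable_on {a..b}"
  shows "G b - G a \<le> integral {a..b} h"
proof -
  define G2 where "G2 s = (if a < s \<and> s < b \<and> s \<notin> X then G' s else h s)" for s
  have "(G2 has_integral (G b - G a)) {a..b}"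
    by (rule fundamental_theorem_of_calculus_interior_strong[OF X ab _ cont])
      (use d in \<open>auto simp: G2_def has_real_derivative_iff_has_vector_derivative\<close>)
  from has_integral_le[OF this integrable_integral[OF h]] show ?thesis
    using le by (auto simp: G2_def)
qed

text \<open>The difference z between v and the shifted kink starts at 0. Up to time T, Gronwall's
  inequality bounds it by the forcing f, with a constant A that grows with T. After T the kink is in
  the contracting zone and (z^2)' \<le> f^2 / c - c z^2 as long as |z| \<le> \<rho>; integrating
  gives the integral bound, and small forcing keeps |z| below \<rho>. Since T is independent of S,
  so are e and C.\<close>

lemma half_line_stability:
  fixes b m :: "real \<Rightarrow> real"
  assumes lip: "\<And>x y. \<bar>b x - b y\<bar> \<le> K * \<bar>x - y\<bar>" and K: "K > 0"
    and c: "c > 0" and \<rho>: "\<rho> > 0"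
    and contr: "\<And>w z. 1 - \<rho> \<le> w \<Longrightarrow> w \<le> 1 \<Longrightarrow> \<bar>z\<bar> \<le> \<rho> \<Longrightarrow> z * (b (w + z) - b w) \<le> - c * z\<^sup>2"
    and m: "\<And>s. (m has_real_derivative b (m s)) (at s)"
    and T: "T \<ge> 0" "\<And>s. s \<ge> T \<Longrightarrow> 1 - \<rho> \<le> m s \<and> m s \<le> 1"
  shows "\<exists>e>0. \<exists>C>0. \<forall>v f X \<xi> S. \<xi> \<le> S \<longrightarrow> finite X \<longrightarrow> continuous_on {\<xi>..S} v \<longrightarrow>
    (\<forall>s. \<xi> < s \<and> s < S \<and> s \<notin> X \<longrightarrow> (v has_real_derivative b (v s) + f s) (at s)) \<longrightarrow>
    (\<lambda>s. (f s)\<^sup>2) integrable_on {\<xi>..S} \<longrightarrow> v \<xi> = m 0 \<longrightarrow> integral {\<xi>..S} (\<lambda>s. (f s)\<^sup>2) \<le> e \<longrightarrow>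
    integral {\<xi>..S} (\<lambda>s. (v s - m (s - \<xi>))\<^sup>2) \<le> C * integral {\<xi>..S} (\<lambda>s. (f s)\<^sup>2)"
proof -
  define A where "A = exp ((2 * K + 1) * T)"
  define B where "B = A + 1 / c"
  \<comment> \<open>Forcing of size at most e makes B * E at most \<rho>^2 / 4, which closes the
    continuity argument in \<open>bound\<close>.\<close>
  define e where "e = \<rho>\<^sup>2 / (4 * B)"
  define C where "C = T * A + B / c + 1"
  have A: "A > 0" by (simp add: A_def)
  have B: "B > 0" using A c by (simp add: B_def add_pos_pos)
  have e: "e > 0" using B \<rho> by (simp add: e_def)
  have C: "C > 0" using A T B c by (simp add: C_def add_nonneg_pos)
  have main: "integral {\<xi>..S} (\<lambda>s. (v s - m (s - \<xi>))\<^sup>2) \<le> C * integral {\<xi>..S} (\<lambda>s. (f s)\<^sup>2)"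
    if S: "\<xi> \<le> S" and X: "finite X" and cv: "continuous_on {\<xi>..S} v"
      and dv0: "\<forall>s. \<xi> < s \<and> s < S \<and> s \<notin> X \<longrightarrow> (v has_real_derivative b (v s) + f s) (at s)"
      and fi: "(\<lambda>s. (f s)\<^sup>2) integrable_on {\<xi>..S}" and v0: "v \<xi> = m 0"
      and small: "integral {\<xi>..S} (\<lambda>s. (f s)\<^sup>2) \<le> e"
    for v f :: "real \<Rightarrow> real" and X \<xi> S
  proof -
    have dv: "(v has_real_derivative b (v s) + f s) (at s)" if "\<xi> < s" "s < S" "s \<notin> X" for s
      using dv0 that by simp
    define E where "E = integral {\<xi>..S} (\<lambda>s. (f s)\<^sup>2)"
    define z where "z s = v s - m (s - \<xi>)" for s
    define z' where "z' s = b (v s) - b (m (s - \<xi>)) + f s" for s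
    have E0: "E \<ge> 0" by (simp add: E_def integral_nonneg fi)
    have cm: "continuous_on UNIV m" using m by (meson DERIV_isCont continuous_at_imp_continuous_on)
    have cz: "continuous_on {\<xi>..S} z" unfolding z_def
      by (intro continuous_intros cv continuous_on_compose2[OF cm]) auto
    have dz: "(z has_real_derivative z' s) (at s)" if "\<xi> < s" "s < S" "s \<notin> X" for s
      unfolding z_def z'_def
      by (rule derivative_eq_intros dv DERIV_chain2[OF m] that refl | simp)+
    have fi': "(\<lambda>s. (f s)\<^sup>2) integrable_on {p..q}" if "\<xi> \<le> p" "q \<le> S" for p q
      by (rule integrable_on_subinterval[OF fi]) (use that in auto)
    have fE: "integral {p..q} (\<lambda>s. (f s)\<^sup>2) \<le> E" if "\<xi> \<le> p" "q \<le> S" for p q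
      unfolding E_def by (rule integral_subset_le) (use that fi fi' in auto)
    have z0: "z \<xi> = 0" by (simp add: z_def v0)
    have P1: "(z s)\<^sup>2 \<le> A * E" if s: "\<xi> \<le> s" "s \<le> S" "s \<le> \<xi> + T" for s
    proof -
      have "(z s)\<^sup>2 * exp (- (2 * K + 1) * (s - \<xi>)) - (z \<xi>)\<^sup>2 * exp (- (2 * K + 1) * (\<xi> - \<xi>))
         \<le> integral {\<xi>..s} (\<lambda>s. (f s)\<^sup>2)"
      proof (rule ftc_le[OF s(1) X])
        show "continuous_on {\<xi>..s} (\<lambda>s. (z s)\<^sup>2 * exp (- (2 * K + 1) * (s - \<xi>)))"
          by (intro continuous_intros continuous_on_subset[OF cz]) (use s in auto)
        show "((\<lambda>s. (z s)\<^sup>2 * exp (- (2 * K + 1) * (s - \<xi>))) has_real_derivative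
          (2 * z t * z' t - (2 * K + 1) * (z t)\<^sup>2) * exp (- (2 * K + 1) * (t - \<xi>))) (at t)"
          if "\<xi> < t" "t < s" "t \<notin> X" for t
        proof -
          have dz': "(z has_real_derivative z' t) (at t)" by (rule dz) (use that s in auto)
          show ?thesis by (rule derivative_eq_intros dz' refl)+ (simp add: algebra_simps)
        qed
        show "(2 * z t * z' t - (2 * K + 1) * (z t)\<^sup>2) * exp (- (2 * K + 1) * (t - \<xi>)) \<le> (f t)\<^sup>2"
          if "\<xi> < t" "t < s" "t \<notin> X" for t
        proof -
          have "z t * (b (v t) - b (m (t - \<xi>))) \<le> \<bar>z t\<bar> * \<bar>b (v t) - b (m (t - \<xi>))\<bar>"
            by (metis abs_ge_self abs_mult)
          also have "\<dots> \<le> \<bar>z t\<bar> * (K * \<bar>z t\<bar>)" unfolding z_def by (intro mult_left_mono lip) auto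
          also have "\<dots> = K * (z t)\<^sup>2" by (simp add: power2_eq_square)
          finally have 1: "z t * (b (v t) - b (m (t - \<xi>))) \<le> K * (z t)\<^sup>2" .
          have 2: "2 * z t * f t \<le> (z t)\<^sup>2 + (f t)\<^sup>2"
            using sum_squares_bound[of "z t" "f t"] by simp
          have "2 * z t * z' t - (2 * K + 1) * (z t)\<^sup>2 \<le> (f t)\<^sup>2"
            using 1 2 unfolding z'_def by (simp add: algebra_simps)
          then have "(2 * z t * z' t - (2 * K + 1) * (z t)\<^sup>2) * exp (- (2 * K + 1) * (t - \<xi>))
             \<le> (f t)\<^sup>2 * exp (- (2 * K + 1) * (t - \<xi>))" by (intro mult_right_mono) auto
          also have "\<dots> \<le> (f t)\<^sup>2 * 1" using K that by (intro mult_left_mono) (auto intro!: mult_nonpos_nonneg)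
          finally show ?thesis by simp
        qed
        show "(\<lambda>s. (f s)\<^sup>2) integrable_on {\<xi>..s}" by (rule fi') (use s in auto)
      qed
      also have "\<dots> \<le> E" by (rule fE) (use s in auto)
      finally have "(z s)\<^sup>2 * exp (- (2 * K + 1) * (s - \<xi>)) \<le> E" using z0 by simp
      then have "(z s)\<^sup>2 * exp (- ((2 * K + 1) * (s - \<xi>))) \<le> E" by (simp only: mult_minus_left)
      then have "(z s)\<^sup>2 / exp ((2 * K + 1) * (s - \<xi>)) \<le> E" by (simp only: exp_minus divide_inverse)
      then have "(z s)\<^sup>2 \<le> exp ((2 * K + 1) * (s - \<xi>)) * E"
        by (simp only: pos_divide_le_eq[OF exp_gt_zero] mult.commute)
      also have "\<dots> \<le> A * E" unfolding A_def using K s E0 by (intro mult_right_mono) auto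
      finally show ?thesis .
    qed
    show ?thesis
    proof (cases "\<xi> + T \<le> S")
      case False
      have "integral {\<xi>..S} (\<lambda>s. (z s)\<^sup>2) \<le> integral {\<xi>..S} (\<lambda>s. A * E)"
        by (rule integral_le) (use P1 False in \<open>auto intro!: integrable_continuous_interval continuous_intros cz\<close>)
      also have "\<dots> = (S - \<xi>) * (A * E)" using S by simp
      also have "\<dots> \<le> T * (A * E)" using False A E0 by (intro mult_right_mono) auto
      also have "\<dots> \<le> C * E" unfolding C_def using E0 B c by (simp add: algebra_simps)
      finally show ?thesis by (simp add: z_def E_def)
    next
      case True
      define T' where "T' = \<xi> + T"
      have T': "\<xi> \<le> T'" "T' \<le> S" using T True by (auto simp: T'_def)
      have ci: "(\<lambda>s. (z s)\<^sup>2) integrable_on {p..q}" if "\<xi> \<le> p" "q \<le> S" for p q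
        by (intro integrable_continuous_interval continuous_intros continuous_on_subset[OF cz]) (use that in auto)
      have P2: "(z s)\<^sup>2 + c * integral {T'..s} (\<lambda>s. (z s)\<^sup>2) \<le> B * E"
        if s: "T' \<le> s" "s \<le> S" and zs: "\<And>t. T' < t \<Longrightarrow> t < s \<Longrightarrow> \<bar>z t\<bar> \<le> \<rho>" for s
      proof -
        have "(z s)\<^sup>2 - (z T')\<^sup>2 \<le> integral {T'..s} (\<lambda>s. (f s)\<^sup>2 / c - c * (z s)\<^sup>2)"
        proof (rule ftc_le[OF s(1) X])
          show "continuous_on {T'..s} (\<lambda>s. (z s)\<^sup>2)"
            by (intro continuous_intros continuous_on_subset[OF cz]) (use s T' in auto)
          show "((\<lambda>s. (z s)\<^sup>2) has_real_derivative 2 * z t * z' t) (at t)" if "T' < t" "t < s" "t \<notin> X" for t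
          proof -
            have dz': "(z has_real_derivative z' t) (at t)" by (rule dz) (use that s T' in auto)
            show ?thesis by (rule derivative_eq_intros dz' refl)+ simp
          qed
          show "2 * z t * z' t \<le> (f t)\<^sup>2 / c - c * (z t)\<^sup>2" if "T' < t" "t < s" "t \<notin> X" for t
          proof -
            have 1: "z t * (b (m (t - \<xi>) + z t) - b (m (t - \<xi>))) \<le> - c * (z t)\<^sup>2"
              using T(2)[of "t - \<xi>"] zs[of t] that by (intro contr) (auto simp: T'_def)
            \<comment> \<open>Young's inequality with weight c: the contraction yields - 2 c z^2,
              and half of it pays for the forcing.\<close>
            have "0 \<le> (f t - c * z t)\<^sup>2 / c" using c by simp
            also have "\<dots> = (f t)\<^sup>2 / c - 2 * (z t * f t) + c * (z t)\<^sup>2"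
              using c by (simp add: field_simps power2_eq_square)
            finally have 2: "2 * (z t * f t) \<le> (f t)\<^sup>2 / c + c * (z t)\<^sup>2" by simp
            have 3: "m (t - \<xi>) + z t = v t" by (simp add: z_def)
            have "2 * z t * z' t = 2 * (z t * (b (v t) - b (m (t - \<xi>)))) + 2 * (z t * f t)"
              by (simp add: z'_def algebra_simps)
            then show ?thesis using 1 2 unfolding 3 by linarith
          qed
          show "(\<lambda>s. (f s)\<^sup>2 / c - c * (z s)\<^sup>2) integrable_on {T'..s}"
            using T' s by (auto intro!: integrable_diff integrable_on_mult_right integrable_on_divide fi' ci)
        qed
        also have "\<dots> = integral {T'..s} (\<lambda>s. (f s)\<^sup>2) / c - c * integral {T'..s} (\<lambda>s. (z s)\<^sup>2)"
          using T' s by (subst integral_diff) (auto intro!: integrable_on_mult_right integrable_on_divide fi' ci)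
        also have "\<dots> \<le> E / c - c * integral {T'..s} (\<lambda>s. (z s)\<^sup>2)"
          using fE[of T' s] T' s c by (simp add: divide_right_mono)
        finally show ?thesis using P1[of T'] T' by (simp add: B_def T'_def algebra_simps)
      qed
      have EB: "B * E < \<rho>\<^sup>2"
      proof -
        have "B * E \<le> B * e" using small B by (simp add: E_def)
        also have "\<dots> = \<rho>\<^sup>2 / 4" using B by (simp add: e_def)
        also have "\<dots> < \<rho>\<^sup>2" using \<rho> by simp
        finally show ?thesis .
      qed
      have bound: "\<bar>z s\<bar> < \<rho>" if "T' \<le> s" "s \<le> S" for s
      proof (rule ccontr)
        assume neg: "\<not> \<bar>z s\<bar> < \<rho>"
        \<comment> \<open>The closed set of times at which |z| has reached \<rho>. At its first
          element t the estimate \<open>P2\<close> is still available, since it asks for |z| \<le>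
          \<rho> only before t, and it forces |z t| < \<rho>.\<close>
        define D where "D = {T'..S} \<inter> (\<lambda>s. \<bar>z s\<bar>) -` {\<rho>..}"
        have "closed D" unfolding D_def
          by (intro continuous_closed_preimage continuous_intros continuous_on_subset[OF cz]) (use T' in auto)
        then have "compact D" using compact_Int_closed[of "{T'..S}" D] by (auto simp: D_def Int_absorb1 inf_assoc[symmetric])
        moreover have "D \<noteq> {}" using that neg by (auto simp: D_def)
        ultimately have "\<exists>t\<in>D. \<forall>t'\<in>D. t \<le> t'" by (rule compact_attains_inf)
        then obtain t where t: "t \<in> D" "\<And>t'. t' \<in> D \<Longrightarrow> t \<le> t'" by blast
        have "(z t)\<^sup>2 + c * integral {T'..t} (\<lambda>s. (z s)\<^sup>2) \<le> B * E"
        proof (rule P2)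
          show "\<bar>z r\<bar> \<le> \<rho>" if "T' < r" "r < t" for r
            using t(2)[of r] that t(1) by (fastforce simp: D_def)
        qed (use t in \<open>auto simp: D_def\<close>)
        moreover have "0 \<le> integral {T'..t} (\<lambda>s. (z s)\<^sup>2)"
          using t T' by (intro integral_nonneg ci) (auto simp: D_def)
        ultimately have "(z t)\<^sup>2 < \<rho>\<^sup>2" using EB c by (smt (verit) mult_nonneg_nonneg)
        then have "\<bar>z t\<bar> < \<rho>" using \<rho> by (metis abs_of_pos power2_less_imp_less power2_abs less_imp_le)
        then show False using t by (auto simp: D_def)
      qed
      have "(z S)\<^sup>2 + c * integral {T'..S} (\<lambda>s. (z s)\<^sup>2) \<le> B * E"
        by (rule P2) (use T' bound in \<open>auto intro: less_imp_le\<close>)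
      then have "c * integral {T'..S} (\<lambda>s. (z s)\<^sup>2) \<le> B * E"
        using zero_le_power2[of "z S"] by linarith
      then have 2: "integral {T'..S} (\<lambda>s. (z s)\<^sup>2) \<le> B / c * E" using c by (simp add: field_simps)
      have "integral {\<xi>..T'} (\<lambda>s. (z s)\<^sup>2) \<le> integral {\<xi>..T'} (\<lambda>s. A * E)"
        by (rule integral_le) (use P1 T' ci in \<open>auto simp: T'_def\<close>)
      also have "\<dots> = T * A * E" using T by (simp add: T'_def)
      finally have "integral {\<xi>..T'} (\<lambda>s. (z s)\<^sup>2) + integral {T'..S} (\<lambda>s. (z s)\<^sup>2) \<le> C * E"
        using 2 E0 by (simp add: C_def algebra_simps)
      then show ?thesis using Henstock_Kurzweil_Integration.integral_combine[OF T' ci] by (simp add: z_def E_def)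
    qed
  qed
  show ?thesis
    by (rule exI[of _ e], intro conjI e, rule exI[of _ C], intro conjI C allI impI) (rule main; assumption)
qed

context drift
begin

lemma lip_const_pos: "K + k > 0" using K k by simp

lemma half_line:
  "\<exists>e>0. \<exists>C>0. \<forall>v f X \<xi> S. \<xi> \<le> S \<longrightarrow> finite X \<longrightarrow> continuous_on {\<xi>..S} v \<longrightarrow>
    (\<forall>s. \<xi> < s \<and> s < S \<and> s \<notin> X \<longrightarrow> (v has_real_derivative b (v s) + f s) (at s)) \<longrightarrow>
    (\<lambda>s. (f s)\<^sup>2) integrable_on {\<xi>..S} \<longrightarrow> v \<xi> = 0 \<longrightarrow> integral {\<xi>..S} (\<lambda>s. (f s)\<^sup>2) \<le> e \<longrightarrow>
    integral {\<xi>..S} (\<lambda>s. (v s - m (s - \<xi>))\<^sup>2) \<le> C * integral {\<xi>..S} (\<lambda>s. (f s)\<^sup>2)"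
proof -
  obtain \<rho> c where \<rho>: "\<rho> > 0" "\<rho> \<le> 1/2" "c > 0"
    and contr: "\<And>w z. 1 - \<rho> \<le> w \<Longrightarrow> w \<le> 1 \<Longrightarrow> \<bar>z\<bar> \<le> \<rho> \<Longrightarrow> z * (b (w + z) - b w) \<le> - c * z\<^sup>2"
    using b_contracting by blast
  have "eventually (\<lambda>s. 1 - \<rho> < m s) at_top" by (rule order_tendstoD[OF m_top]) (use \<rho> in simp)
  then obtain T0 where "\<And>s. s \<ge> T0 \<Longrightarrow> 1 - \<rho> < m s" by (auto simp: eventually_at_top_linorder)
  then have T: "\<And>s. s \<ge> max T0 0 \<Longrightarrow> 1 - \<rho> \<le> m s \<and> m s \<le> 1" using m_bounds by (simp add: less_imp_le)
  have "0 \<le> max T0 0" by simp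
  from half_line_stability[OF b_lip lip_const_pos \<rho>(3) \<rho>(1) contr m_deriv this T]
  show ?thesis by (simp only: m_0)
qed

text \<open>The path \<open>v\<close> is compared with the kink through its own zero, forward in time directly and backward through the reflection \<open>s \<mapsto> - v (- s)\<close>.\<close>

lemma landscape:
  "\<exists>e>0. \<exists>C>0. \<forall>v g X a. a \<ge> 0 \<longrightarrow> continuous_on UNIV v \<longrightarrow> finite X \<longrightarrow>
    (\<forall>s. s \<notin> X \<longrightarrow> (v has_real_derivative g s) (at s)) \<longrightarrow>
    (\<lambda>s. (g s - b (v s))\<^sup>2) integrable_on {-a..a} \<longrightarrow>
    (\<forall>s. s < -a \<longrightarrow> g s = 0) \<longrightarrow> (\<forall>s. s > a \<longrightarrow> g s = 0) \<longrightarrow>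
    (\<forall>s. s \<le> -a \<longrightarrow> v s = -1) \<longrightarrow> (\<forall>s. s \<ge> a \<longrightarrow> v s = 1) \<longrightarrow>
    integral {-a..a} (\<lambda>s. (g s - b (v s))\<^sup>2) \<le> e \<longrightarrow>
    (\<exists>\<xi>. \<forall>p q. p \<le> q \<longrightarrow>
      integral {p..q} (\<lambda>s. (v s - m (s - \<xi>))\<^sup>2) \<le> C * integral {-a..a} (\<lambda>s. (g s - b (v s))\<^sup>2))"
proof -
  interpret R: drift F "\<lambda>s. - m (- s)" k K by (rule m_reflect)
  obtain e1 C1 where e1: "e1 > 0" "C1 > 0" and H1: "\<And>v f X \<xi> S. \<xi> \<le> S \<Longrightarrow> finite X \<Longrightarrow> continuous_on {\<xi>..S} v \<Longrightarrow>
    (\<forall>s. \<xi> < s \<and> s < S \<and> s \<notin> X \<longrightarrow> (v has_real_derivative b (v s) + f s) (at s)) \<Longrightarrow>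
    (\<lambda>s. (f s)\<^sup>2) integrable_on {\<xi>..S} \<Longrightarrow> v \<xi> = 0 \<Longrightarrow> integral {\<xi>..S} (\<lambda>s. (f s)\<^sup>2) \<le> e1 \<Longrightarrow>
    integral {\<xi>..S} (\<lambda>s. (v s - m (s - \<xi>))\<^sup>2) \<le> C1 * integral {\<xi>..S} (\<lambda>s. (f s)\<^sup>2)"
    using half_line by blast
  obtain e2 C2 where e2: "e2 > 0" "C2 > 0" and H2: "\<And>v f X \<xi> S. \<xi> \<le> S \<Longrightarrow> finite X \<Longrightarrow> continuous_on {\<xi>..S} v \<Longrightarrow>
    (\<forall>s. \<xi> < s \<and> s < S \<and> s \<notin> X \<longrightarrow> (v has_real_derivative b (v s) + f s) (at s)) \<Longrightarrow>
    (\<lambda>s. (f s)\<^sup>2) integrable_on {\<xi>..S} \<Longrightarrow> v \<xi> = 0 \<Longrightarrow> integral {\<xi>..S} (\<lambda>s. (f s)\<^sup>2) \<le> e2 \<Longrightarrow>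
    integral {\<xi>..S} (\<lambda>s. (v s - - m (- (s - \<xi>)))\<^sup>2) \<le> C2 * integral {\<xi>..S} (\<lambda>s. (f s)\<^sup>2)"
    using R.half_line by blast
  have main: "\<exists>\<xi>. \<forall>p q. p \<le> q \<longrightarrow>
      integral {p..q} (\<lambda>s. (v s - m (s - \<xi>))\<^sup>2) \<le> (C1 + C2) * integral {-a..a} (\<lambda>s. (g s - b (v s))\<^sup>2)"
    if a: "a \<ge> 0" and cv: "continuous_on UNIV v" and X: "finite X"
      and dv: "\<forall>s. s \<notin> X \<longrightarrow> (v has_real_derivative g s) (at s)"
      and fi: "(\<lambda>s. (g s - b (v s))\<^sup>2) integrable_on {-a..a}"
      and g0: "\<forall>s. s < -a \<longrightarrow> g s = 0" "\<forall>s. s > a \<longrightarrow> g s = 0"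
      and v1: "\<forall>s. s \<le> -a \<longrightarrow> v s = -1" "\<forall>s. s \<ge> a \<longrightarrow> v s = 1"
      and small: "integral {-a..a} (\<lambda>s. (g s - b (v s))\<^sup>2) \<le> min e1 e2"
    for v g :: "real \<Rightarrow> real" and X a
  proof -
    define f where "f s = g s - b (v s)" for s
    define E where "E = integral {-a..a} (\<lambda>s. (f s)\<^sup>2)"
    \<comment> \<open>The constant tails -1 and 1 are zeros of b and solve the kink equation
      exactly, so the forcing vanishes off [-a, a] and the intervals of integration may reach beyond
      it.\<close>
    have f0: "f s = 0" if "s \<notin> {-a..a}" for s
      using that g0 v1 b_1 by (auto simp: f_def not_le)
    have fi': "(\<lambda>s. (f s)\<^sup>2) integrable_on {p..q}" and fE: "integral {p..q} (\<lambda>s. (f s)\<^sup>2) \<le> E" for p q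
    proof -
      define P Q where "P = min p (-a)" and "Q = max q a"
      have I: "((\<lambda>s. (f s)\<^sup>2) has_integral E) {P..Q}"
      proof (rule has_integral_on_superset)
        show "((\<lambda>s. (f s)\<^sup>2) has_integral E) {-a..a}"
          unfolding E_def using fi by (simp add: f_def integrable_integral)
      qed (use f0 in \<open>auto simp: P_def Q_def\<close>)
      show i: "(\<lambda>s. (f s)\<^sup>2) integrable_on {p..q}"
        by (rule integrable_on_subinterval[OF has_integral_integrable[OF I]]) (auto simp: P_def Q_def)
      show "integral {p..q} (\<lambda>s. (f s)\<^sup>2) \<le> E"
        using integral_subset_le[OF _ i has_integral_integrable[OF I]] integral_unique[OF I]
        by (auto simp: P_def Q_def)
    qed
    have dv': "(v has_real_derivative b (v s) + f s) (at s)" if "s \<notin> X" for s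
      using dv that by (simp add: f_def)
    have "\<exists>x\<ge>-a. x \<le> a \<and> v x = 0"
      by (rule IVT') (use v1 a cv in \<open>auto intro: continuous_on_subset\<close>)
    then obtain \<xi> where \<xi>: "v \<xi> = 0" by blast
    have fwd: "integral {\<xi>..S} (\<lambda>s. (v s - m (s - \<xi>))\<^sup>2) \<le> C1 * E" if "\<xi> \<le> S" for S
    proof -
      have "integral {\<xi>..S} (\<lambda>s. (v s - m (s - \<xi>))\<^sup>2) \<le> C1 * integral {\<xi>..S} (\<lambda>s. (f s)\<^sup>2)"
        by (rule H1[OF that X]) (use dv' fi' \<xi> fE[of \<xi> S] small in \<open>auto intro: continuous_on_subset[OF cv] simp: E_def f_def\<close>)
      also have "\<dots> \<le> C1 * E" using e1 by (intro mult_left_mono fE) auto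
      finally show ?thesis .
    qed
    have bwd: "integral {S..\<xi>} (\<lambda>s. (v s - m (s - \<xi>))\<^sup>2) \<le> C2 * E" if "S \<le> \<xi>" for S
    proof -
      have d: "((\<lambda>s. - v (- s)) has_real_derivative b (- v (- s)) + f (- s)) (at s)" if "s \<notin> uminus ` X" for s
      proof -
        have "- s \<notin> X" using that by force
        then have "(v has_real_derivative b (v (- s)) + f (- s)) (at (- s))" by (rule dv')
        then have "((\<lambda>s. v (- s)) has_real_derivative (b (v (- s)) + f (- s)) * (- 1)) (at s)"
          by (rule DERIV_chain2[where g = uminus]) (auto intro!: derivative_eq_intros)
        from DERIV_minus[OF this] show ?thesis by (simp add: b_even add.commute)
      qed
      have refl: "integral {- \<xi>..- S} (\<lambda>s. (f (- s))\<^sup>2) = integral {S..\<xi>} (\<lambda>s. (f s)\<^sup>2)"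
        using Henstock_Kurzweil_Integration.integral_reflect_real[of "\<xi>" S "\<lambda>s. (f s)\<^sup>2"] by simp
      have "integral {- \<xi>..- S} (\<lambda>s. (- v (- s) - - m (- (s - - \<xi>)))\<^sup>2) \<le> C2 * integral {- \<xi>..- S} (\<lambda>s. (f (- s))\<^sup>2)"
      proof (rule H2)
        show "continuous_on {- \<xi>..- S} (\<lambda>s. - v (- s))"
          by (intro continuous_intros continuous_on_compose2[OF cv]) auto
        show "(\<lambda>s. (f (- s))\<^sup>2) integrable_on {- \<xi>..- S}"
          using fi'[of S \<xi>] Henstock_Kurzweil_Integration.integrable_reflect_real[of "\<lambda>s. (f s)\<^sup>2" \<xi> S] by simp
        show "integral {- \<xi>..- S} (\<lambda>s. (f (- s))\<^sup>2) \<le> e2"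
          unfolding refl using fE[of S \<xi>] small by (simp add: E_def f_def)
        show "finite (uminus ` X)" using X by simp
      qed (use that d \<xi> in auto)
      also have "\<dots> \<le> C2 * E" unfolding refl using e2 by (intro mult_left_mono fE) auto
      also have "integral {- \<xi>..- S} (\<lambda>s. (- v (- s) - - m (- (s - - \<xi>)))\<^sup>2)
          = integral {- \<xi>..- S} (\<lambda>s. (\<lambda>s. (v s - m (s - \<xi>))\<^sup>2) (- s))"
        by (intro integral_cong) (simp add: power2_commute algebra_simps)
      also have "\<dots> = integral {S..\<xi>} (\<lambda>s. (v s - m (s - \<xi>))\<^sup>2)"
        using Henstock_Kurzweil_Integration.integral_reflect_real[of "\<xi>" S "\<lambda>s. (v s - m (s - \<xi>))\<^sup>2"] by simp
      finally show ?thesis .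
    qed
    have ci: "(\<lambda>s. (v s - m (s - \<xi>))\<^sup>2) integrable_on {p..q}" for p q
      by (intro integrable_continuous_interval continuous_intros continuous_on_subset[OF cv]
           continuous_on_compose2[OF m_cont[of UNIV]]) auto
    have "integral {p..q} (\<lambda>s. (v s - m (s - \<xi>))\<^sup>2) \<le> (C1 + C2) * E" for p q
    proof -
      define P Q where "P = min p \<xi>" and "Q = max q \<xi>"
      have PQ: "P \<le> \<xi>" "\<xi> \<le> Q" by (auto simp: P_def Q_def)
      have "integral {p..q} (\<lambda>s. (v s - m (s - \<xi>))\<^sup>2) \<le> integral {P..Q} (\<lambda>s. (v s - m (s - \<xi>))\<^sup>2)"
        by (rule integral_subset_le[OF _ ci ci]) (auto simp: P_def Q_def)
      also have "\<dots> = integral {P..\<xi>} (\<lambda>s. (v s - m (s - \<xi>))\<^sup>2) + integral {\<xi>..Q} (\<lambda>s. (v s - m (s - \<xi>))\<^sup>2)"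
        using Henstock_Kurzweil_Integration.integral_combine[OF PQ ci] by simp
      also have "\<dots> \<le> C2 * E + C1 * E" by (intro add_mono fwd bwd PQ)
      finally show ?thesis by (simp add: algebra_simps)
    qed
    then show ?thesis by (auto simp: E_def f_def)
  qed
  show ?thesis
    by (rule exI[of _ "min e1 e2"], rule conjI, use e1 e2 in simp, rule exI[of _ "C1 + C2"], rule conjI,
        use e1 e2 in simp, intro allI impI, rule main; assumption)
qed

end

section \<open>Dyadic interpolation\<close>

definition dyadic :: "real \<Rightarrow> nat \<Rightarrow> nat \<Rightarrow> real" where
  "dyadic L j k = - L + 2 * L * real k / 2 ^ j"

text \<open>The Schauder coefficient of x on a cell: the deviation of the midpoint value from the
  chord. For the Brownian bridge these are independent over all cells and levels.\<close>

definition second_diff :: "real \<Rightarrow> (real \<Rightarrow> real) \<Rightarrow> nat \<Rightarrow> nat \<Rightarrow> real" where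
  "second_diff L x j k = x (dyadic L (Suc j) (2 * k + 1)) - (x (dyadic L j k) + x (dyadic L j (k + 1))) / 2"

text \<open>Half the Dirichlet integral of the piecewise linear interpolation at level J, whose mesh
  is \<open>2 * L / 2 ^ J\<close>.\<close>

definition energy :: "real \<Rightarrow> nat \<Rightarrow> (real \<Rightarrow> real) \<Rightarrow> real" where
  "energy L J x = (\<Sum>k<2 ^ J. (x (dyadic L J (k + 1)) - x (dyadic L J k))\<^sup>2) * 2 ^ J / (4 * L)"

lemma dyadic_double: "dyadic L (Suc j) (2 * k) = dyadic L j k"
  by (simp add: dyadic_def)

lemma dyadic_refine: "dyadic L (j + i) (k * 2 ^ i) = dyadic L j k"
  by (simp add: dyadic_def power_add)

lemma dyadic_0: "dyadic L j 0 = - L" and dyadic_end: "dyadic L j (2 ^ j) = L"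
  by (auto simp: dyadic_def)

lemma dyadic_mono: "0 < L \<Longrightarrow> k \<le> l \<Longrightarrow> dyadic L j k \<le> dyadic L j l"
  and dyadic_strict_mono: "0 < L \<Longrightarrow> k < l \<Longrightarrow> dyadic L j k < dyadic L j l"
  by (auto simp: dyadic_def divide_right_mono divide_strict_right_mono)

lemma dyadic_bounds:
  assumes "0 < L" "k \<le> 2 ^ j" shows "- L \<le> dyadic L j k" "dyadic L j k \<le> L"
  using dyadic_mono[of L 0 k j] dyadic_mono[of L k "2 ^ j" j] assms by (auto simp: dyadic_0 dyadic_end)

lemma dyadic_step: "dyadic L j (k + 1) - dyadic L j k = 2 * L / 2 ^ j"
  by (simp add: dyadic_def field_simps)

lemma dyadic_mid: "dyadic L (Suc j) (2 * k + 1) = (dyadic L j k + dyadic L j (k + 1)) / 2"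
  by (simp add: dyadic_def field_simps)

lemma sum_lessThan_double: "(\<Sum>k<2 * n. f k) = (\<Sum>k<n. f (2 * k) + f (2 * k + 1 :: nat))"
  for f :: "nat \<Rightarrow> 'a :: comm_monoid_add"
  by (induction n) (auto simp: add.assoc)

text \<open>Parallelogram law on each cell: if its two halves have increments p and q, then p^2 +
  q^2 = (p + q)^2 / 2 + (p - q)^2 / 2, and p - q is twice the coefficient.\<close>

lemma energy_Suc:
  assumes "L > 0"
  shows "energy L (Suc J) x = energy L J x + (\<Sum>k<2 ^ J. (second_diff L x J k)\<^sup>2 * 2 ^ J / L)"
proof -
  have "(\<Sum>k<2 ^ Suc J. (x (dyadic L (Suc J) (k + 1)) - x (dyadic L (Suc J) k))\<^sup>2)
    = (\<Sum>k<2 ^ J. (x (dyadic L (Suc J) (2 * k + 1)) - x (dyadic L J k))\<^sup>2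
        + (x (dyadic L J (k + 1)) - x (dyadic L (Suc J) (2 * k + 1)))\<^sup>2)"
    unfolding power_Suc sum_lessThan_double
    using dyadic_double[of L J] dyadic_double[of L J "_ + 1"] by (simp del: dyadic_double)
  also have "\<dots> = (\<Sum>k<2 ^ J. (x (dyadic L J (k + 1)) - x (dyadic L J k))\<^sup>2 / 2 + 2 * (second_diff L x J k)\<^sup>2)"
    by (intro sum.cong refl) (simp add: second_diff_def power2_eq_square field_simps)
  also have "\<dots> = (\<Sum>k<2 ^ J. (x (dyadic L J (k + 1)) - x (dyadic L J k))\<^sup>2) / 2 + 2 * (\<Sum>k<2 ^ J. (second_diff L x J k)\<^sup>2)"
    by (simp add: sum.distrib sum_divide_distrib sum_distrib_left)
  finally have eq: "(\<Sum>k<2 ^ Suc J. (x (dyadic L (Suc J) (k + 1)) - x (dyadic L (Suc J) k))\<^sup>2) = \<dots>" .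
  have "(\<Sum>k<2 ^ J. (second_diff L x J k)\<^sup>2 * 2 ^ J / L) = (\<Sum>k<2 ^ J. (second_diff L x J k)\<^sup>2) * 2 ^ J / L"
    by (simp add: sum_distrib_right sum_divide_distrib)
  then show ?thesis unfolding energy_def eq using assms by (simp add: field_simps)
qed

text \<open>Parseval's identity for the Schauder expansion of the interpolation; the first term is
  the energy of the chord over [-L, L].\<close>

lemma energy_eq:
  assumes "L > 0"
  shows "energy L J x = (x L - x (- L))\<^sup>2 / (4 * L) + (\<Sum>j<J. \<Sum>k<2 ^ j. (second_diff L x j k)\<^sup>2 * 2 ^ j / L)"
proof (induction J)
  case 0
  then show ?case by (simp add: energy_def dyadic_def)
next
  case (Suc J)
  then show ?case using assms by (simp add: energy_Suc)
qed

section \<open>Uniform bounds from Schauder coefficients\<close>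

lemma dyadic_grid_bound:
  fixes e :: "real \<Rightarrow> real"
  assumes L: "L > 0" and e0: "e (- L) = 0" "e L = 0"
    and sd: "\<And>j k. k < 2 ^ j \<Longrightarrow> \<bar>second_diff L e j k\<bar> \<le> A j" and A: "\<And>j. 0 \<le> A j"
  shows "k \<le> 2 ^ J \<Longrightarrow> \<bar>e (dyadic L J k)\<bar> \<le> (\<Sum>j<J. A j)"
proof (induction J arbitrary: k)
  case 0
  then have "k = 0 \<or> k = 1" by auto
  then show ?case using e0 by (auto simp: dyadic_def)
next
  case (Suc J)
  show ?case
  proof (cases "even k")
    case True
    then obtain i where "k = 2 * i" by auto
    then show ?thesis using Suc.IH[of i] Suc.prems A[of J] by (simp add: dyadic_double)
  next
    case False
    then obtain i where i: "k = 2 * i + 1" by (auto elim: oddE)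
    then have "i < 2 ^ J" using Suc.prems by auto
    then have "\<bar>e (dyadic L J i)\<bar> \<le> (\<Sum>j<J. A j)" "\<bar>e (dyadic L J (i + 1))\<bar> \<le> (\<Sum>j<J. A j)"
      "\<bar>e (dyadic L (Suc J) (2 * i + 1)) - (e (dyadic L J i) + e (dyadic L J (i + 1))) / 2\<bar> \<le> A J"
      using Suc.IH[of i] Suc.IH[of "i + 1"] sd[of i J] by (auto simp: second_diff_def)
    moreover have "\<bar>m\<bar> \<le> S + B" if "\<bar>p\<bar> \<le> S" "\<bar>q\<bar> \<le> S" "\<bar>m - (p + q) / 2\<bar> \<le> B" for m p q S B :: real
    proof -
      have "- S \<le> (p + q) / 2" "(p + q) / 2 \<le> S" using that(1,2) by (auto simp: abs_le_iff)
      then show ?thesis using that(3) by linarith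
    qed
    ultimately show ?thesis unfolding i sum.lessThan_Suc by blast
  qed
qed

lemma dyadic_approx:
  assumes L: "L > 0" and t: "t \<in> {-L..L}"
  defines "k \<equiv> \<lambda>J. nat \<lfloor>(t + L) / (2 * L) * 2 ^ J\<rfloor>"
  shows "k J \<le> 2 ^ J" "(\<lambda>J. dyadic L J (k J)) \<longlonglongrightarrow> t"
proof -
  define q where "q = (t + L) / (2 * L)"
  have q: "0 \<le> q" "q \<le> 1" using L t by (auto simp: q_def)
  have kq: "real (k J) \<le> q * 2 ^ J" "q * 2 ^ J < real (k J) + 1" for J
  proof -
    have "k J = nat \<lfloor>q * 2 ^ J\<rfloor>" by (simp only: k_def q_def)
    moreover have "0 \<le> q * 2 ^ J" using q by simp
    ultimately have "real (k J) = of_int \<lfloor>q * 2 ^ J\<rfloor>" by simp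
    then show "real (k J) \<le> q * 2 ^ J" "q * 2 ^ J < real (k J) + 1"
      using floor_correct[of "q * 2 ^ J"] by auto
  qed
  have "q * 2 ^ J \<le> 2 ^ J" for J using q by (simp add: mult_left_le_one_le)
  then have "real (k J) \<le> real (2 ^ J)" for J
    using kq(1)[of J] order_trans[of "real (k J)" "q * 2 ^ J" "2 ^ J"] by simp
  then show "k J \<le> 2 ^ J" by (simp only: of_nat_le_iff)
  have tq: "t = - L + 2 * L * q" using L by (simp add: q_def)
  have bd: "\<bar>dyadic L J (k J) - t\<bar> \<le> 2 * L * (1/2) ^ J" for J
  proof -
    have "dyadic L J (k J) - t = 2 * L * ((real (k J) - q * 2 ^ J) / 2 ^ J)"
      unfolding tq dyadic_def by (simp add: field_simps)
    then have "\<bar>dyadic L J (k J) - t\<bar> = 2 * L * (\<bar>real (k J) - q * 2 ^ J\<bar> / 2 ^ J)" using L by (simp add: abs_mult)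
    also have "\<dots> \<le> 2 * L * (1 / 2 ^ J)"
      using kq[of J] L by (intro mult_left_mono divide_right_mono) auto
    finally show ?thesis by (simp add: power_one_over)
  qed
  have "(\<lambda>J. 2 * L * (1/2 :: real) ^ J) \<longlonglongrightarrow> 0"
    by (intro tendsto_mult_right_zero LIMSEQ_power_zero) auto
  moreover have "\<forall>\<^sub>F J in sequentially. norm (dyadic L J (k J) - t) \<le> 2 * L * (1/2) ^ J"
    by (intro always_eventually allI) (simp only: real_norm_def bd)
  ultimately have "(\<lambda>J. dyadic L J (k J) - t) \<longlonglongrightarrow> 0" by (rule Lim_null_comparison[rotated])
  then show "(\<lambda>J. dyadic L J (k J)) \<longlonglongrightarrow> t" by (rule LIM_zero_cancel)
qed

text \<open>Density of the dyadic points and continuity turn countably many coefficient bounds into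
  a uniform one. This is how an event about independent coefficients becomes a tube around a
  profile.\<close>

lemma dyadic_sup_bound:
  fixes e :: "real \<Rightarrow> real"
  assumes L: "L > 0" and c: "continuous_on {-L..L} e" and e0: "e (- L) = 0" "e L = 0"
    and sd: "\<And>j k. k < 2 ^ j \<Longrightarrow> \<bar>second_diff L e j k\<bar> \<le> A j" and A: "\<And>j. 0 \<le> A j"
    and R: "\<And>J. (\<Sum>j<J. A j) \<le> R" and t: "t \<in> {-L..L}"
  shows "\<bar>e t\<bar> \<le> R"
proof -
  define k where "k = (\<lambda>J. nat \<lfloor>(t + L) / (2 * L) * 2 ^ J\<rfloor>)"
  have k: "k J \<le> 2 ^ J" "(\<lambda>J. dyadic L J (k J)) \<longlonglongrightarrow> t" for J
    using dyadic_approx[OF L t] by (auto simp: k_def)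
  have "(\<lambda>J. e (dyadic L J (k J))) \<longlonglongrightarrow> e t"
    by (rule continuous_on_tendsto_compose[OF c k(2) t]) (use dyadic_bounds[OF L k(1)] in auto)
  then have "(\<lambda>J. \<bar>e (dyadic L J (k J))\<bar>) \<longlonglongrightarrow> \<bar>e t\<bar>" by (rule tendsto_rabs)
  then show ?thesis
    using dyadic_grid_bound[OF L e0 sd A k(1)] R by (intro LIMSEQ_le_const2) (auto intro: order_trans)
qed

text \<open>The complement of the open cell. Bridge values at such t are uncorrelated with the
  deviation from the chord inside the cell.\<close>

definition off :: "real \<Rightarrow> real \<Rightarrow> real \<Rightarrow> bool" where "off l r t \<longleftrightarrow> t \<le> l \<or> r \<le> t"

lemma dyadic_off_grid:
  assumes "L > 0" shows "off (dyadic L j k) (dyadic L j (k + 1)) (dyadic L j n)"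
proof (cases "n \<le> k")
  case False
  then show ?thesis using dyadic_mono[OF assms, of "k + 1" n j] by (auto simp: off_def)
qed (use dyadic_mono[OF assms, of n k j] in \<open>auto simp: off_def\<close>)

text \<open>The three nodes of a coarse coefficient are grid points of every strictly finer level,
  so none falls inside a finer open cell; two cells of one level meet at most in an endpoint. The
  order j \<le> j' reflects that the finer deviation will be tested against the coarser
  nodes.\<close>

lemma dyadic_cells_separated:
  assumes L: "L > 0" and ne: "(j, k) \<noteq> (j', k')" and jj: "j \<le> j'"
    and t: "t \<in> {dyadic L j k, dyadic L (Suc j) (2 * k + 1), dyadic L j (k + 1)}"
  shows "off (dyadic L j' k') (dyadic L j' (k' + 1)) t"
proof (cases "j = j'")
  case True
  have b: "dyadic L j k \<le> t" "t \<le> dyadic L j (k + 1)"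
    using t dyadic_mono[OF L, of k "k + 1" j] unfolding dyadic_mid by auto
  consider "k < k'" | "k' < k" using True ne by force
  then show ?thesis
  proof cases
    case 1
    then show ?thesis using b dyadic_mono[OF L, of "k + 1" k' j] True by (auto simp: off_def)
  next
    case 2
    then show ?thesis using b dyadic_mono[OF L, of "k' + 1" k j] True by (auto simp: off_def)
  qed
next
  case False
  have "t = dyadic L (Suc j) (2 * k) \<or> t = dyadic L (Suc j) (2 * k + 1) \<or> t = dyadic L (Suc j) (2 * (k + 1))"
    using t unfolding dyadic_double by simp
  then have "\<exists>n. t = dyadic L (Suc j) n" by blast
  then obtain n where "t = dyadic L (Suc j) n" by blast
  also have "\<dots> = dyadic L (Suc j + (j' - Suc j)) (n * 2 ^ (j' - Suc j))" by (rule dyadic_refine[symmetric])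
  also have "Suc j + (j' - Suc j) = j'" using False jj by simp
  finally show ?thesis using dyadic_off_grid[OF L] by simp
qed

section \<open>Integrals over cells and the piecewise linear interpolation\<close>

lemma has_integral_cells:
  fixes f :: "real \<Rightarrow> real" and d :: "nat \<Rightarrow> real"
  assumes "\<And>k. k < n \<Longrightarrow> (f has_integral I k) {d k..d (k + 1)}" "\<And>k. k < n \<Longrightarrow> d k \<le> d (k + 1)"
  shows "(f has_integral (\<Sum>k<n. I k)) {d 0..d n} \<and> d 0 \<le> d n"
  using assms
proof (induction n)
  case 0
  then show ?case by (simp add: has_integral_refl)
next
  case (Suc n)
  then have IH: "(f has_integral (\<Sum>k<n. I k)) {d 0..d n}" "d 0 \<le> d n" by auto
  have "(f has_integral ((\<Sum>k<n. I k) + I n)) {d 0..d (n + 1)}"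
    by (rule has_integral_combine[OF IH(2) _ IH(1)]) (use Suc.prems in auto)
  then show ?case using IH Suc.prems(2)[of n] by auto
qed

lemma has_integral_unit_interval:
  fixes f :: "real \<Rightarrow> real"
  assumes lr: "l < r" and c: "continuous_on {l..r} f"
  shows "(f has_integral (r - l) * integral {0..1} (\<lambda>\<theta>. f ((1 - \<theta>) * l + \<theta> * r))) {l..r}"
proof -
  have "((\<lambda>\<theta>. (r - l) *\<^sub>R f ((1 - \<theta>) * l + \<theta> * r)) has_integral (integral {(1 - 0) * l + 0 * r..(1 - 1) * l + 1 * r} f)) {0..1}"
  proof (rule has_integral_substitution[where c = l and d = r])
    show "(\<lambda>\<theta>. (1 - \<theta>) * l + \<theta> * r) ` {0..1} \<subseteq> {l..r}"
    proof clarsimp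
      fix \<theta> :: real assume "0 \<le> \<theta>" "\<theta> \<le> 1"
      then have "0 \<le> \<theta> * (r - l)" "0 \<le> (1 - \<theta>) * (r - l)" using lr by auto
      then show "l \<le> (1 - \<theta>) * l + \<theta> * r \<and> (1 - \<theta>) * l + \<theta> * r \<le> r" by (auto simp: algebra_simps)
    qed
    show "((\<lambda>\<theta>. (1 - \<theta>) * l + \<theta> * r) has_field_derivative r - l) (at \<theta> within {0..1})" for \<theta>
      by (auto intro!: derivative_eq_intros)
  qed (use lr c in auto)
  from integral_unique[OF this] have "(r - l) * integral {0..1} (\<lambda>\<theta>. f ((1 - \<theta>) * l + \<theta> * r)) = integral {l..r} f" by simp
  then show ?thesis using integrable_continuous_interval[OF c] by (simp add: integrable_integral)
qed

text \<open>A sum of clamped ramps instead of a case distinction over cells: it is continuous by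
  inspection and constant outside [-L, L], so the extension by the boundary values is already built
  in.\<close>

definition interp :: "real \<Rightarrow> nat \<Rightarrow> (real \<Rightarrow> real) \<Rightarrow> real \<Rightarrow> real" where
  "interp L J x t = x (- L) + (\<Sum>k<2 ^ J. (x (dyadic L J (k + 1)) - x (dyadic L J k)) *
     max 0 (min 1 ((t - dyadic L J k) / (2 * L / 2 ^ J))))"

definition interp_slope :: "real \<Rightarrow> nat \<Rightarrow> (real \<Rightarrow> real) \<Rightarrow> real \<Rightarrow> real" where
  "interp_slope L J x t = (\<Sum>k<2 ^ J. (x (dyadic L J (k + 1)) - x (dyadic L J k)) / (2 * L / 2 ^ J) *
     indicator {dyadic L J k<..<dyadic L J (k + 1)} t)"

text \<open>The squared \<open>L\<^sup>2\<close> distance to the interpolation, with every cell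
  parametrised by the same \<theta>. For the bridge and fixed \<theta> the summands are squares of
  uncorrelated Gaussians, which is what the tail estimate exploits.\<close>

definition interp_error :: "real \<Rightarrow> nat \<Rightarrow> (real \<Rightarrow> real) \<Rightarrow> real" where
  "interp_error L J x = (\<Sum>k<2 ^ J. 2 * L / 2 ^ J * integral {0..1} (\<lambda>\<theta>.
     (x ((1 - \<theta>) * dyadic L J k + \<theta> * dyadic L J (k + 1))
       - (1 - \<theta>) * x (dyadic L J k) - \<theta> * x (dyadic L J (k + 1)))\<^sup>2))"

context
  fixes L :: real and J :: nat and x :: "real \<Rightarrow> real"
  assumes L: "L > 0"
begin

private abbreviation (input) "D k \<equiv> dyadic L J k"
private abbreviation (input) "h \<equiv> 2 * L / 2 ^ J"

lemma h_pos: "h > 0" using L by simp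

lemma D_Suc: "D (k + 1) = D k + h"
  using dyadic_step[of L J k] by simp

lemma interp_cont: "continuous_on S (interp L J x)"
  unfolding interp_def by (intro continuous_intros) (use L in auto)

lemma interp_left: "t \<le> - L \<Longrightarrow> interp L J x t = x (- L)"
proof -
  assume t: "t \<le> - L"
  have "max 0 (min 1 ((t - D k) / h)) = 0" for k
  proof -
    have "t - D k \<le> 0" using t dyadic_mono[OF L, of 0 k J] by (simp add: dyadic_0)
    then have "(t - D k) / h \<le> 0" using h_pos by (rule divide_nonpos_pos)
    then show ?thesis by simp
  qed
  then show ?thesis by (simp add: interp_def)
qed

lemma clamp_one: "D (i + 1) \<le> t \<Longrightarrow> max 0 (min 1 ((t - D i) / h)) = 1"
proof -
  assume "D (i + 1) \<le> t"
  then have "1 \<le> (t - D i) / h" unfolding pos_le_divide_eq[OF h_pos] using D_Suc[of i] by linarith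
  then show ?thesis by simp
qed

lemma clamp_zero: "t \<le> D i \<Longrightarrow> max 0 (min 1 ((t - D i) / h)) = 0"
proof -
  assume "t \<le> D i"
  then have "(t - D i) / h \<le> 0" using h_pos by (intro divide_nonpos_pos) auto
  then show ?thesis by simp
qed

lemma interp_right: "L \<le> t \<Longrightarrow> interp L J x t = x L"
proof -
  assume t: "L \<le> t"
  have "(\<Sum>k<2 ^ J. (x (D (k + 1)) - x (D k)) * max 0 (min 1 ((t - D k) / h))) = (\<Sum>k<2 ^ J. x (D (Suc k)) - x (D k))"
  proof (intro sum.cong refl)
    fix k assume "k \<in> {..<2 ^ J :: nat}"
    then have "D (k + 1) \<le> t" using dyadic_bounds(2)[OF L, of "k + 1" J] t by auto
    from clamp_one[OF this] show "(x (D (k + 1)) - x (D k)) * max 0 (min 1 ((t - D k) / h)) = x (D (Suc k)) - x (D k)" by simp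
  qed
  also have "\<dots> = x (D (2 ^ J)) - x (D 0)" by (rule sum_lessThan_telescope)
  finally show ?thesis by (simp add: interp_def dyadic_0 dyadic_end)
qed

lemma interp_cell:
  assumes k: "k < 2 ^ J" and t: "D k \<le> t" "t \<le> D (k + 1)"
  shows "interp L J x t = x (D k) + (x (D (k + 1)) - x (D k)) / h * (t - D k)"
proof -
  define f where "f i = (x (D (i + 1)) - x (D i)) * max 0 (min 1 ((t - D i) / h))" for i
  \<comment> \<open>Ramps to the left of the cell are saturated and telescope to
    \<open>x (D k) - x (D 0)\<close>; those to the right vanish.\<close>
  have 1: "(\<Sum>i<k. f i) = (\<Sum>i<k. x (D (Suc i)) - x (D i))"
  proof (intro sum.cong refl)
    fix i assume "i \<in> {..<k}"
    then have "D (i + 1) \<le> t" using dyadic_mono[OF L, of "i + 1" k J] t by auto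
    from clamp_one[OF this] show "f i = x (D (Suc i)) - x (D i)" by (simp add: f_def)
  qed
  have 2: "f i = 0" if "i \<in> {..<2 ^ J} - {..<Suc k}" for i
  proof -
    have "t \<le> D i" using dyadic_mono[OF L, of "k + 1" i J] t that by auto
    from clamp_zero[OF this] show ?thesis by (simp add: f_def)
  qed
  have "(\<Sum>i<2 ^ J. f i) = (\<Sum>i<Suc k. f i)"
    by (rule sum.mono_neutral_right) (use 2 k in auto)
  also have "\<dots> = x (D k) - x (D 0) + f k" unfolding sum.lessThan_Suc 1 sum_lessThan_telescope[of "\<lambda>i. x (D i)"] by (rule refl)
  also have "f k = (x (D (k + 1)) - x (D k)) / h * (t - D k)"
  proof -
    have 0: "0 \<le> (t - D k) / h" using t h_pos by (intro divide_nonneg_pos) auto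
    have "(t - D k) / h \<le> 1" unfolding pos_divide_le_eq[OF h_pos] using t D_Suc[of k] by linarith
    then have "max 0 (min 1 ((t - D k) / h)) = (t - D k) / h" using 0 by (simp only: min_absorb2 max_absorb2)
    then show ?thesis by (simp only: f_def times_divide_eq_left times_divide_eq_right)
  qed
  finally show ?thesis unfolding interp_def f_def[symmetric] by (simp add: dyadic_0)
qed

lemma interp_cell_theta:
  assumes k: "k < 2 ^ J" and \<theta>: "0 \<le> \<theta>" "\<theta> \<le> 1"
  shows "interp L J x ((1 - \<theta>) * D k + \<theta> * D (k + 1)) = (1 - \<theta>) * x (D k) + \<theta> * x (D (k + 1))"
proof -
  have e: "(1 - \<theta>) * D k + \<theta> * D (k + 1) = D k + \<theta> * h" unfolding D_Suc by (simp add: algebra_simps)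
  have "\<theta> * h \<le> 1 * h" using \<theta> h_pos by (intro mult_right_mono) auto
  then have "\<theta> * h \<le> h" by (simp only: mult_1)
  then have "interp L J x (D k + \<theta> * h) = x (D k) + (x (D (k + 1)) - x (D k)) / h * (D k + \<theta> * h - D k)"
  proof (intro interp_cell k)
    have "0 \<le> \<theta> * h" using \<theta> h_pos by (intro mult_nonneg_nonneg) auto
    then show "D k \<le> D k + \<theta> * h" by simp
    show "D k + \<theta> * h \<le> D (k + 1)" using D_Suc[of k] \<open>\<theta> * h \<le> h\<close> by linarith
  qed
  moreover have g: "p + (q - p) / c * (d + \<theta> * c - d) = (1 - \<theta>) * p + \<theta> * q" if "c > 0" for p q c d :: real
    using that by (simp add: field_simps)
  ultimately show ?thesis unfolding e g[OF h_pos] by blast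
qed

lemma slope_cell:
  assumes k: "k < 2 ^ J" and t: "D k < t" "t < D (k + 1)"
  shows "interp_slope L J x t = (x (D (k + 1)) - x (D k)) / h"
proof -
  have z: "indicator {D i<..<D (i + 1)} t = (0 :: real)" if ne: "i \<noteq> k" for i
  proof -
    consider "i < k" | "k < i" by (rule linorder_neqE_nat[OF ne])
    then show ?thesis
    proof cases
      case 1
      then have "D (i + 1) \<le> D k" using dyadic_mono[OF L] by auto
      then show ?thesis using t by (auto simp: indicator_def)
    next
      case 2
      then have "D (k + 1) \<le> D i" using dyadic_mono[OF L] by auto
      then show ?thesis using t by (auto simp: indicator_def)
    qed
  qed
  have "interp_slope L J x t = (\<Sum>i<2 ^ J. if i = k then (x (D (k + 1)) - x (D k)) / h else 0)"
    unfolding interp_slope_def by (intro sum.cong refl) (use z t in auto)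
  also have "\<dots> = (x (D (k + 1)) - x (D k)) / h" using k by simp
  finally show ?thesis .
qed

lemma slope_outside: "t < - L \<or> L < t \<Longrightarrow> interp_slope L J x t = 0"
  unfolding interp_slope_def
proof (intro sum.neutral ballI)
  fix k assume t: "t < - L \<or> L < t" and k: "k \<in> {..<2 ^ J :: nat}"
  then have "- L \<le> D k" "D (k + 1) \<le> L" using dyadic_bounds[OF L, of k J] dyadic_bounds[OF L, of "k + 1" J] by auto
  then show "(x (D (k + 1)) - x (D k)) / h * indicator {D k<..<D (k + 1)} t = 0"
    using t by (auto simp: indicator_def)
qed

lemma find_cell:
  assumes "- L \<le> t" "t < L" shows "\<exists>k<2 ^ J. D k \<le> t \<and> t < D (k + 1)"
proof -
  have "\<exists>k<n. D k \<le> t \<and> t < D (k + 1)" if "t < D n" for n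
    using that
  proof (induction n)
    case 0
    then show ?case using assms by (simp add: dyadic_0)
  next
    case (Suc n)
    show ?case
    proof (cases "t < D n")
      case True
      then show ?thesis using Suc.IH less_SucI by blast
    next
      case False
      then show ?thesis using Suc.prems by (intro exI[of _ n]) auto
    qed
  qed
  from this[of "2 ^ J"] show ?thesis using assms by (simp add: dyadic_end)
qed

lemma interp_deriv:
  assumes t: "t \<notin> D ` {..2 ^ J}"
  shows "(interp L J x has_real_derivative interp_slope L J x t) (at t)"
proof -
  have "t \<noteq> - L" using t imageI[of 0 "{..2 ^ J :: nat}" D] by (auto simp: dyadic_0)
  moreover have "t \<noteq> L" using t imageI[of "2 ^ J" "{..2 ^ J :: nat}" D] by (auto simp: dyadic_end)
  ultimately consider "t < - L" | "L < t" | "- L \<le> t" "t < L" by linarith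
  then show ?thesis
  proof cases
    case 1
    have "((\<lambda>_. x (- L)) has_real_derivative 0) (at t)" by simp
    then have "(interp L J x has_real_derivative 0) (at t)"
      by (rule has_field_derivative_transform_within_open[of _ _ _ "{..<- L}"]) (use 1 interp_left in auto)
    then show ?thesis using slope_outside 1 by simp
  next
    case 2
    have "((\<lambda>_. x L) has_real_derivative 0) (at t)" by simp
    then have "(interp L J x has_real_derivative 0) (at t)"
      by (rule has_field_derivative_transform_within_open[of _ _ _ "{L<..}"]) (use 2 interp_right in auto)
    then show ?thesis using slope_outside 2 by simp
  next
    case 3
    then obtain k where k: "k < 2 ^ J" "D k \<le> t" "t < D (k + 1)" using find_cell by blast
    moreover have "t \<noteq> D k" using t k(1) by auto
    ultimately have k': "D k < t" by simp
    have "((\<lambda>t. p + c * (t - d)) has_real_derivative c) (at t)" for p c d :: real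
      by (auto intro!: derivative_eq_intros)
    from this[of "x (D k)" "(x (D (k + 1)) - x (D k)) / h" "D k"]
    have "(interp L J x has_real_derivative (x (D (k + 1)) - x (D k)) / h) (at t)"
      by (rule has_field_derivative_transform_within_open[of _ _ _ "{D k<..<D (k + 1)}"])
        (use k k' in \<open>auto simp: interp_cell[OF k(1)] simp del: times_divide_eq_right\<close>)
    then show ?thesis using slope_cell[OF k(1) k' k(3)] by simp
  qed
qed

lemma slope_sq_integral: "((\<lambda>t. (interp_slope L J x t)\<^sup>2) has_integral 2 * energy L J x) {-L..L}"
proof -
  have "((\<lambda>t. (interp_slope L J x t)\<^sup>2) has_integral (\<Sum>k<2 ^ J. ((x (D (k + 1)) - x (D k)) / h)\<^sup>2 * h)) {D 0..D (2 ^ J)} \<and> D 0 \<le> D (2 ^ J)"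
  proof (rule has_integral_cells)
    fix k assume k: "k < (2 :: nat) ^ J"
    have "((\<lambda>_. ((x (D (k + 1)) - x (D k)) / h)\<^sup>2) has_integral ((x (D (k + 1)) - x (D k)) / h)\<^sup>2 * h) {D k..D (k + 1)}"
      using has_integral_const_real[of "((x (D (k + 1)) - x (D k)) / h)\<^sup>2" "D k" "D (k + 1)"] D_Suc[of k] h_pos
      by (simp add: mult.commute)
    then show "((\<lambda>t. (interp_slope L J x t)\<^sup>2) has_integral ((x (D (k + 1)) - x (D k)) / h)\<^sup>2 * h) {D k..D (k + 1)}"
    proof (rule has_integral_spike_finite[of "{D k, D (k + 1)}", rotated -1])
      fix t assume "t \<in> {D k..D (k + 1)} - {D k, D (k + 1)}"
      then have "D k < t" "t < D (k + 1)" by auto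
      from slope_cell[OF k this] show "(interp_slope L J x t)\<^sup>2 = ((x (D (k + 1)) - x (D k)) / h)\<^sup>2" by simp
    qed simp
    show "D k \<le> D (k + 1)" using dyadic_mono[OF L] by simp
  qed
  moreover have "(\<Sum>k<2 ^ J. ((x (D (k + 1)) - x (D k)) / h)\<^sup>2 * h) = 2 * energy L J x"
  proof -
    have "(q / h)\<^sup>2 * h = 2 * (q\<^sup>2 * 2 ^ J / (4 * L))" for q
    proof -
      have "(q / c)\<^sup>2 * c = q\<^sup>2 / c" if "c > 0" for c :: real
        using that by (simp add: power2_eq_square)
      from this[OF h_pos] have "(q / h)\<^sup>2 * h = q\<^sup>2 / h" .
      also have "\<dots> = 2 * (q\<^sup>2 * 2 ^ J / (4 * L))" using L by (simp add: field_simps)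
      finally show ?thesis .
    qed
    then show ?thesis
      unfolding energy_def by (simp only: sum_distrib_left sum_distrib_right sum_divide_distrib)
  qed
  ultimately show ?thesis by (simp add: dyadic_0 dyadic_end)
qed

lemma interp_error_integral:
  assumes c: "continuous_on {-L..L} x"
  shows "((\<lambda>t. (x t - interp L J x t)\<^sup>2) has_integral interp_error L J x) {-L..L}"
proof -
  have "((\<lambda>t. (x t - interp L J x t)\<^sup>2) has_integral (\<Sum>k<2 ^ J. h * integral {0..1} (\<lambda>\<theta>.
     (x ((1 - \<theta>) * D k + \<theta> * D (k + 1)) - (1 - \<theta>) * x (D k) - \<theta> * x (D (k + 1)))\<^sup>2))) {D 0..D (2 ^ J)} \<and> D 0 \<le> D (2 ^ J)"
  proof (rule has_integral_cells)
    fix k assume k: "k < (2 :: nat) ^ J"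
    have sub: "{D k..D (k + 1)} \<subseteq> {-L..L}"
      using dyadic_bounds[OF L, of k J] dyadic_bounds[OF L, of "k + 1" J] k by auto
    have lt: "D k < D (k + 1)" using dyadic_strict_mono[OF L] by simp
    have "((\<lambda>t. (x t - interp L J x t)\<^sup>2) has_integral (D (k + 1) - D k) * integral {0..1} (\<lambda>\<theta>.
      (x ((1 - \<theta>) * D k + \<theta> * D (k + 1)) - interp L J x ((1 - \<theta>) * D k + \<theta> * D (k + 1)))\<^sup>2)) {D k..D (k + 1)}"
      by (rule has_integral_unit_interval[OF lt])
        (intro continuous_intros interp_cont continuous_on_subset[OF c sub])
    also have "integral {0..1} (\<lambda>\<theta>. (x ((1 - \<theta>) * D k + \<theta> * D (k + 1)) - interp L J x ((1 - \<theta>) * D k + \<theta> * D (k + 1)))\<^sup>2)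
      = integral {0..1} (\<lambda>\<theta>. (x ((1 - \<theta>) * D k + \<theta> * D (k + 1)) - (1 - \<theta>) * x (D k) - \<theta> * x (D (k + 1)))\<^sup>2)"
    proof (rule integral_cong)
      fix \<theta> :: real assume "\<theta> \<in> {0..1}"
      then have "interp L J x ((1 - \<theta>) * D k + \<theta> * D (k + 1)) = (1 - \<theta>) * x (D k) + \<theta> * x (D (k + 1))"
        by (intro interp_cell_theta[OF k]) auto
      then show "(x ((1 - \<theta>) * D k + \<theta> * D (k + 1)) - interp L J x ((1 - \<theta>) * D k + \<theta> * D (k + 1)))\<^sup>2
        = (x ((1 - \<theta>) * D k + \<theta> * D (k + 1)) - (1 - \<theta>) * x (D k) - \<theta> * x (D (k + 1)))\<^sup>2"
        by (simp only: diff_diff_eq)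
    qed
    also have "D (k + 1) - D k = h" by (simp only: D_Suc add_diff_cancel_left')
    finally show "((\<lambda>t. (x t - interp L J x t)\<^sup>2) has_integral h * integral {0..1} (\<lambda>\<theta>.
     (x ((1 - \<theta>) * D k + \<theta> * D (k + 1)) - (1 - \<theta>) * x (D k) - \<theta> * x (D (k + 1)))\<^sup>2)) {D k..D (k + 1)}" .
    show "D k \<le> D (k + 1)" using lt by simp
  qed
  then show ?thesis by (simp add: interp_error_def dyadic_0 dyadic_end)
qed

end

section \<open>Energy bounds for paths\<close>

lemma nn_integral_line_le:
  fixes f :: "real \<Rightarrow> real"
  assumes c: "continuous_on UNIV f" and nn: "\<And>x. 0 \<le> f x" and b: "\<And>p q. p \<le> q \<Longrightarrow> integral {p..q} f \<le> B"
  shows "(\<integral>\<^sup>+x. ennreal (f x) \<partial>lborel) \<le> ennreal B"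
proof -
  have [measurable]: "f \<in> borel_measurable borel" by (rule borel_measurable_continuous_onI[OF c])
  have "(\<integral>\<^sup>+x. ennreal (f x) \<partial>lborel) = (\<integral>\<^sup>+x. (SUP n. ennreal (f x) * indicator {- real n..real n} x) \<partial>lborel)"
  proof (rule nn_integral_cong)
    fix x
    obtain n where n: "\<bar>x\<bar> \<le> real n" using real_arch_simple by blast
    have "(SUP n. ennreal (f x) * indicator {- real n..real n} x) = ennreal (f x)"
    proof (rule antisym)
      show "(SUP n. ennreal (f x) * indicator {- real n..real n} x) \<le> ennreal (f x)"
        by (rule SUP_least) (auto simp: indicator_def)
      show "ennreal (f x) \<le> (SUP n. ennreal (f x) * indicator {- real n..real n} x)"
        by (rule SUP_upper2[of n]) (use n in \<open>auto simp: indicator_def abs_le_iff\<close>)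
    qed
    then show "ennreal (f x) = (SUP n. ennreal (f x) * indicator {- real n..real n} x)" by simp
  qed
  also have "\<dots> = (SUP n. \<integral>\<^sup>+x. ennreal (f x) * indicator {- real n..real n} x \<partial>lborel)"
    by (rule nn_integral_monotone_convergence_SUP) (auto simp: incseq_def le_fun_def indicator_def)
  also have "\<dots> \<le> ennreal B"
  proof (rule SUP_least)
    fix n
    have "(\<integral>\<^sup>+x. ennreal (f x) * indicator {- real n..real n} x \<partial>lborel) = ennreal (integral {- real n..real n} f)"
      by (rule nn_integral_has_integral_lebesgue')
        (use nn in \<open>auto intro!: integrable_integral integrable_continuous_interval continuous_on_subset[OF c]\<close>)
    also have "\<dots> \<le> ennreal B" by (intro ennreal_leI b) simp
    finally show "(\<integral>\<^sup>+x. ennreal (f x) * indicator {- real n..real n} x \<partial>lborel) \<le> ennreal B" .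
  qed
  finally show ?thesis .
qed

context drift
begin

text \<open>With v the interpolation and g its slope, the integral E of (g - b v)^2 equals twice the
  energy minus twice the surface tension plus B, the integral of (b v)^2. By
  \<open>landscape\<close>, E is at least 2 c \<delta>^2 when the path is far from all kinks, which
  bounds B from below, and F dominates b^2 / 2. Passing from v back to x costs the factor 1 -
  \<kappa> and the interpolation error; that same factor in front of the energy makes its
  exponential moment finite later.\<close>

lemma potential_lower:
  "\<exists>c>0. \<exists>d0>0. \<forall>L J x \<kappa> \<delta> \<eta>. L > 0 \<longrightarrow> continuous_on {-L..L} x \<longrightarrow> x (- L) = -1 \<longrightarrow> x L = 1 \<longrightarrow>
    0 < \<kappa> \<longrightarrow> \<kappa> < 1 \<longrightarrow> 0 < \<delta> \<longrightarrow> \<delta> \<le> d0 \<longrightarrow> \<eta> \<le> \<delta>\<^sup>2 / 4 \<longrightarrow> interp_error L J x \<le> \<eta> \<longrightarrow>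
    (\<forall>\<xi>. \<delta> \<le> L2norm UNIV (\<lambda>s. (if s < - L then -1 else if s > L then 1 else x s) - m (s - \<xi>))) \<longrightarrow>
    (1 - \<kappa>) * (surface_tension + c * \<delta>\<^sup>2 - energy L J x) - (K + k)\<^sup>2 * \<eta> / (2 * \<kappa>) \<le> integral {-L..L} (\<lambda>s. F (x s))"
proof -
  obtain e0 C where e0: "e0 > 0" "C > 0" and land0: "\<forall>v g X a. a \<ge> 0 \<longrightarrow> continuous_on UNIV v \<longrightarrow> finite X \<longrightarrow>
    (\<forall>s. s \<notin> X \<longrightarrow> (v has_real_derivative g s) (at s)) \<longrightarrow>
    (\<lambda>s. (g s - b (v s))\<^sup>2) integrable_on {-a..a} \<longrightarrow>
    (\<forall>s. s < -a \<longrightarrow> g s = 0) \<longrightarrow> (\<forall>s. s > a \<longrightarrow> g s = 0) \<longrightarrow>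
    (\<forall>s. s \<le> -a \<longrightarrow> v s = -1) \<longrightarrow> (\<forall>s. s \<ge> a \<longrightarrow> v s = 1) \<longrightarrow>
    integral {-a..a} (\<lambda>s. (g s - b (v s))\<^sup>2) \<le> e0 \<longrightarrow>
    (\<exists>\<xi>. \<forall>p q. p \<le> q \<longrightarrow>
      integral {p..q} (\<lambda>s. (v s - m (s - \<xi>))\<^sup>2) \<le> C * integral {-a..a} (\<lambda>s. (g s - b (v s))\<^sup>2))"
    using landscape by (elim exE conjE) (rule that; assumption)
  \<comment> \<open>If E were below 2 c \<delta>^2, then \<eta> \<le> \<delta>^2 / 4 and
    \<open>landscape\<close> would give \<delta>^2 \<le> 4 C E < 8 C c \<delta>^2 = \<delta>^2 / 2.
    The radius d0 keeps 2 c \<delta>^2 below e0, the range in which \<open>landscape\<close>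
    applies.\<close>
  define c where "c = 1 / (16 * C)"
  define d0 where "d0 = sqrt (e0 / (2 * c))"
  have c: "c > 0" using e0 by (simp add: c_def)
  have d0: "d0 > 0" using e0 c by (simp add: d0_def)
  have d0sq: "2 * c * d0\<^sup>2 = e0" using e0 c by (simp add: d0_def)
  have main: "(1 - \<kappa>) * (surface_tension + c * \<delta>\<^sup>2 - energy L J x) - (K + k)\<^sup>2 * \<eta> / (2 * \<kappa>) \<le> integral {-L..L} (\<lambda>s. F (x s))"
    if L: "L > 0" and cx: "continuous_on {-L..L} x" and xe: "x (- L) = -1" "x L = 1" and \<kappa>: "0 < \<kappa>" "\<kappa> < 1"
      and \<delta>: "0 < \<delta>" "\<delta> \<le> d0" and \<eta>: "\<eta> \<le> \<delta>\<^sup>2 / 4" and err: "interp_error L J x \<le> \<eta>"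
      and far: "\<forall>\<xi>. \<delta> \<le> L2norm UNIV (\<lambda>s. (if s < - L then -1 else if s > L then 1 else x s) - m (s - \<xi>))"
    for L J x \<kappa> \<delta> \<eta>
  proof -
    define v where "v = interp L J x"
    define g where "g = interp_slope L J x"
    define X where "X = dyadic L J ` {..2 ^ J}"
    define u where "u s = (if s < - L then -1 else if s > L then 1 else x s)" for s
    have X: "finite X" by (simp add: X_def)
    have cv: "continuous_on S v" for S unfolding v_def by (rule interp_cont[OF L])
    have vd: "(v has_real_derivative g s) (at s)" if "s \<notin> X" for s
      unfolding v_def g_def by (rule interp_deriv[OF L]) (use that in \<open>simp add: X_def\<close>)
    have vl: "v s = -1" if "s \<le> - L" for s unfolding v_def using interp_left[OF L that] xe by simp
    have vr: "v s = 1" if "L \<le> s" for s unfolding v_def using interp_right[OF L that] xe by simp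
    have g0: "g s = 0" if "s < - L \<or> L < s" for s unfolding g_def by (rule slope_outside[OF L that])
    have vd': "\<forall>s. s \<notin> X \<longrightarrow> (v has_real_derivative g s) (at s)" using vd by blast
    have g0': "\<forall>s. s < - L \<longrightarrow> g s = 0" "\<forall>s. s > L \<longrightarrow> g s = 0" using g0 by auto
    have vl': "\<forall>s. s \<le> - L \<longrightarrow> v s = -1" and vr': "\<forall>s. s \<ge> L \<longrightarrow> v s = 1" using vl vr by auto
    have Ig: "((\<lambda>s. (g s)\<^sup>2) has_integral 2 * energy L J x) {-L..L}"
      unfolding g_def by (rule slope_sq_integral[OF L])
    have Iw: "((\<lambda>s. (x s - v s)\<^sup>2) has_integral interp_error L J x) {-L..L}"
      unfolding v_def by (rule interp_error_integral[OF L cx])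
    \<comment> \<open>The cross term is the derivative of \<open>Phi\<close> along v, so its
      integral depends on the end values only and equals the surface tension for every v.\<close>
    have "((\<lambda>s. b (v s) * g s) has_integral (Phi (v L) - Phi (v (- L)))) {-L..L}"
    proof (rule fundamental_theorem_of_calculus_interior_strong[OF X])
      show "continuous_on {-L..L} (\<lambda>s. Phi (v s))"
        by (rule continuous_on_compose2[OF _ cv, of UNIV])
          (use Phi_deriv in \<open>auto intro!: continuous_at_imp_continuous_on DERIV_isCont\<close>)
      show "((\<lambda>s. Phi (v s)) has_vector_derivative b (v s) * g s) (at s)" if "s \<in> {-L<..<L} - X" for s
        using DERIV_chain2[OF Phi_deriv vd, of s] that by (simp add: has_real_derivative_iff_has_vector_derivative)
    qed (use L in simp)
    then have Ib: "((\<lambda>s. b (v s) * g s) has_integral surface_tension) {-L..L}"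
      using vl[of "-L"] vr[of L] by (simp add: surface_tension_def)
    define B where "B = integral {-L..L} (\<lambda>s. (b (v s))\<^sup>2)"
    have IB: "((\<lambda>s. (b (v s))\<^sup>2) has_integral B) {-L..L}"
      unfolding B_def by (intro integrable_integral integrable_continuous_interval continuous_intros
        continuous_on_compose2[OF b_cont[of UNIV] cv]) auto
    define E where "E = 2 * energy L J x - 2 * surface_tension + B"
    have IE: "((\<lambda>s. (g s - b (v s))\<^sup>2) has_integral E) {-L..L}"
    proof -
      have "((\<lambda>s. (g s)\<^sup>2 - 2 * (b (v s) * g s) + (b (v s))\<^sup>2) has_integral E) {-L..L}"
        unfolding E_def by (intro has_integral_add has_integral_diff has_integral_mult_right Ig Ib IB)
      then show ?thesis by (simp add: power2_eq_square algebra_simps)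
    qed
    have E_lower: "2 * c * \<delta>\<^sup>2 \<le> E"
    proof (rule ccontr)
      assume neg: "\<not> 2 * c * \<delta>\<^sup>2 \<le> E"
      have "2 * c * \<delta>\<^sup>2 \<le> 2 * c * d0\<^sup>2" using \<delta> c by (intro mult_left_mono power_mono) auto
      then have "integral {-L..L} (\<lambda>s. (g s - b (v s))\<^sup>2) \<le> e0"
        unfolding integral_unique[OF IE] using neg d0sq by simp
      then have "\<exists>\<xi>. \<forall>p q. p \<le> q \<longrightarrow> integral {p..q} (\<lambda>s. (v s - m (s - \<xi>))\<^sup>2)
          \<le> C * integral {-L..L} (\<lambda>s. (g s - b (v s))\<^sup>2)"
        using less_imp_le[OF L] cv[of UNIV] X vd' g0' vl' vr' has_integral_integrable[OF IE]
        by (intro land0[THEN spec, THEN spec, THEN spec, THEN spec, THEN mp, THEN mp, THEN mp, THEN mp, THEN mp, THEN mp, THEN mp, THEN mp, THEN mp, THEN mp]) (assumption | simp)+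
      then obtain \<xi> where \<xi>: "\<And>p q. p \<le> q \<Longrightarrow> integral {p..q} (\<lambda>s. (v s - m (s - \<xi>))\<^sup>2) \<le> C * E"
        unfolding integral_unique[OF IE] by blast
      have cm: "continuous_on S (\<lambda>s. m (s - \<xi>))" for S
        by (rule continuous_on_compose2[OF m_cont[of UNIV]]) (auto intro!: continuous_intros)
      have N2: "(\<integral>\<^sup>+s. ennreal ((v s - m (s - \<xi>))\<^sup>2) \<partial>lborel) \<le> ennreal (C * E)"
        by (rule nn_integral_line_le) (use \<xi> in \<open>auto intro!: continuous_intros cv cm\<close>)
      have N1: "(\<integral>\<^sup>+s. ennreal ((u s - v s)\<^sup>2) \<partial>lborel) \<le> ennreal \<eta>"
      proof -
        have "(\<integral>\<^sup>+s. ennreal ((u s - v s)\<^sup>2) \<partial>lborel) = (\<integral>\<^sup>+s. ennreal ((x s - v s)\<^sup>2) * indicator {-L..L} s \<partial>lborel)"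
          by (intro nn_integral_cong) (auto simp: indicator_def u_def vl vr)
        also have "\<dots> = ennreal (interp_error L J x)"
          by (rule nn_integral_has_integral_lebesgue'[OF _ Iw]) simp
        finally show ?thesis using err by (simp add: ennreal_leI)
      qed
      define U where "U s = (u s - m (s - \<xi>))\<^sup>2" for s
      have far\<xi>: "\<delta> \<le> sqrt (LINT s|lborel. U s)"
        using far[rule_format, of \<xi>] by (simp add: L2norm_def U_def u_def set_lebesgue_integral_def)
      then have "0 < sqrt (LINT s|lborel. U s)" using \<delta> by linarith
      then have pos: "0 < (LINT s|lborel. U s)" by simp
      \<comment> \<open>A function that is not integrable has Bochner integral 0, so a positive
        integral includes integrability.\<close>
      then have iU: "integrable lborel U" using not_integrable_integral_eq[of lborel U] by fastforce
      have "\<delta>\<^sup>2 \<le> (sqrt (LINT s|lborel. U s))\<^sup>2" using far\<xi> \<delta> by (intro power_mono) auto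
      then have "ennreal (\<delta>\<^sup>2) \<le> ennreal (LINT s|lborel. U s)" using pos by (simp add: ennreal_leI)
      also have "\<dots> = (\<integral>\<^sup>+s. ennreal (U s) \<partial>lborel)"
        by (rule nn_integral_eq_integral[symmetric, OF iU]) (simp add: U_def)
      also have "\<dots> \<le> (\<integral>\<^sup>+s. 2 * ennreal ((u s - v s)\<^sup>2) + 2 * ennreal ((v s - m (s - \<xi>))\<^sup>2) \<partial>lborel)"
      proof (rule nn_integral_mono)
        fix s
        have "(p + q)\<^sup>2 \<le> 2 * p\<^sup>2 + 2 * q\<^sup>2" for p q :: real
          using sum_squares_bound[of p q] by (simp add: power2_sum)
        from this[of "u s - v s" "v s - m (s - \<xi>)"]
        have "ennreal (U s) \<le> ennreal (2 * (u s - v s)\<^sup>2 + 2 * (v s - m (s - \<xi>))\<^sup>2)"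
          by (intro ennreal_leI) (simp add: U_def)
        then show "ennreal (U s) \<le> 2 * ennreal ((u s - v s)\<^sup>2) + 2 * ennreal ((v s - m (s - \<xi>))\<^sup>2)"
          by (simp add: ennreal_plus ennreal_mult)
      qed
      also have "\<dots> = 2 * (\<integral>\<^sup>+s. ennreal ((u s - v s)\<^sup>2) \<partial>lborel) + 2 * (\<integral>\<^sup>+s. ennreal ((v s - m (s - \<xi>))\<^sup>2) \<partial>lborel)"
      proof -
        have m1: "(\<lambda>s. (v s - m (s - \<xi>))\<^sup>2) \<in> borel_measurable borel"
          by (intro borel_measurable_continuous_onI continuous_intros cv cm)
        have "(\<lambda>s. indicator {-L..L} s *\<^sub>R (x s - v s)) \<in> borel_measurable borel"
          by (intro borel_measurable_continuous_on_indicator continuous_intros cx cv) auto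
        then have "(\<lambda>s. (indicator {-L..L} s *\<^sub>R (x s - v s))\<^sup>2) \<in> borel_measurable borel" by measurable
        moreover have "(\<lambda>s. (indicator {-L..L} s *\<^sub>R (x s - v s))\<^sup>2) = (\<lambda>s. (u s - v s)\<^sup>2)"
          by (auto simp: fun_eq_iff indicator_def u_def vl vr)
        ultimately show ?thesis using m1 by (subst nn_integral_add) (auto simp: nn_integral_cmult)
      qed
      also have "\<dots> \<le> 2 * ennreal \<eta> + 2 * ennreal (C * E)" by (intro add_mono mult_left_mono N1 N2) auto
      finally have le: "ennreal (\<delta>\<^sup>2) \<le> 2 * ennreal \<eta> + 2 * ennreal (C * E)" .
      have err0: "0 \<le> interp_error L J x" using has_integral_nonneg[OF Iw] by simp
      have E0: "0 \<le> E" using has_integral_nonneg[OF IE] by simp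
      have "2 * ennreal \<eta> + 2 * ennreal (C * E) = ennreal (2 * \<eta> + 2 * (C * E))"
        using err err0 E0 e0 by (simp add: ennreal_plus ennreal_mult)
      moreover have "0 \<le> 2 * \<eta> + 2 * (C * E)" using err err0 E0 e0 by simp
      ultimately have "\<delta>\<^sup>2 \<le> 2 * \<eta> + 2 * (C * E)" using le ennreal_le_iff by metis
      then have "\<delta>\<^sup>2 \<le> 4 * C * E" using \<eta> by (simp add: field_simps)
      moreover have "4 * C * E < 4 * C * (2 * c * \<delta>\<^sup>2)" using neg e0 by (intro mult_strict_left_mono) auto
      moreover have "4 * C * (2 * c * \<delta>\<^sup>2) = \<delta>\<^sup>2 / 2" using e0 by (simp add: c_def)
      ultimately show False using zero_less_power[OF \<delta>(1), of 2] by linarith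
    qed
    have "(1 - \<kappa>) / 2 * B - (K + k)\<^sup>2 / (2 * \<kappa>) * interp_error L J x \<le> integral {-L..L} (\<lambda>s. F (x s))"
    proof (rule has_integral_le)
      show "((\<lambda>s. (1 - \<kappa>) / 2 * (b (v s))\<^sup>2 - (K + k)\<^sup>2 / (2 * \<kappa>) * (x s - v s)\<^sup>2) has_integral
        (1 - \<kappa>) / 2 * B - (K + k)\<^sup>2 / (2 * \<kappa>) * interp_error L J x) {-L..L}"
        by (intro has_integral_diff has_integral_mult_right IB Iw)
      show "((\<lambda>s. F (x s)) has_integral integral {-L..L} (\<lambda>s. F (x s))) {-L..L}"
        by (intro integrable_integral integrable_continuous_interval continuous_on_compose2[OF F_cont[of UNIV] cx]) auto
      fix s
      define p q where "p = b (x s)" and "q = b (v s)"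
      have "\<bar>p - q\<bar> \<le> (K + k) * \<bar>x s - v s\<bar>" unfolding p_def q_def by (rule b_lip)
      then have "\<bar>p - q\<bar>\<^sup>2 \<le> ((K + k) * \<bar>x s - v s\<bar>)\<^sup>2" by (intro power_mono) auto
      then have pq: "(p - q)\<^sup>2 / \<kappa> \<le> (K + k)\<^sup>2 / \<kappa> * (x s - v s)\<^sup>2"
        using \<kappa> by (simp add: power_mult_distrib divide_right_mono)
      \<comment> \<open>This is the square of (p - q) + \<kappa> q: Young's inequality in the form
        (1 - \<kappa>) q^2 \<le> p^2 + (p - q)^2 / \<kappa>.\<close>
      have "0 \<le> (p - (1 - \<kappa>) * q)\<^sup>2 / \<kappa>" using \<kappa> by simp
      also have "\<dots> = (p - q)\<^sup>2 / \<kappa> + 2 * (p - q) * q + \<kappa> * q\<^sup>2"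
        using \<kappa> by (simp add: power2_eq_square field_simps)
      finally have "(1 - \<kappa>) * q\<^sup>2 \<le> (p - q)\<^sup>2 / \<kappa> + p\<^sup>2"
        using zero_le_power2[of "p - q"] by (simp add: power2_eq_square algebra_simps)
      then have "(1 - \<kappa>) * q\<^sup>2 \<le> (K + k)\<^sup>2 / \<kappa> * (x s - v s)\<^sup>2 + 2 * F (x s)"
        using pq b_sq_le[of "x s"] by (simp add: p_def)
      then show "(1 - \<kappa>) / 2 * (b (v s))\<^sup>2 - (K + k)\<^sup>2 / (2 * \<kappa>) * (x s - v s)\<^sup>2 \<le> F (x s)"
        by (simp add: q_def field_simps)
    qed
    moreover have "(K + k)\<^sup>2 / (2 * \<kappa>) * interp_error L J x \<le> (K + k)\<^sup>2 / (2 * \<kappa>) * \<eta>"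
      using \<kappa> err by (intro mult_left_mono) auto
    moreover have "(1 - \<kappa>) * (surface_tension + c * \<delta>\<^sup>2 - energy L J x) \<le> (1 - \<kappa>) * (B / 2)"
      using E_lower \<kappa> by (intro mult_left_mono) (auto simp: E_def)
    ultimately show ?thesis by simp
  qed
  show ?thesis
    by (rule exI[of _ c], rule conjI[OF c], rule exI[of _ d0], rule conjI[OF d0], intro allI impI, rule main; assumption)
qed

section \<open>The kink as trial profile\<close>

lemma Phi_mono: "-1 \<le> p \<Longrightarrow> p \<le> q \<Longrightarrow> q \<le> 1 \<Longrightarrow> Phi p \<le> Phi q"
proof (rule DERIV_nonneg_imp_nondecreasing[of p q Phi])
  fix u assume a: "-1 \<le> p" "q \<le> 1" "p \<le> u" "u \<le> q"
  have "0 \<le> b u" using b_inside[of u] bt_nonneg a by simp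
  then show "\<exists>y. (Phi has_real_derivative y) (at u) \<and> 0 \<le> y" using Phi_deriv by blast
qed

lemma Phi_m_le: "Phi (m p) - Phi (m q) \<le> surface_tension"
  unfolding surface_tension_def using Phi_mono[of "-1" "m q"] Phi_mono[of "m p" 1] m_bounds by (simp add: diff_mono)

lemma surface_tension_nonneg: "0 \<le> surface_tension"
  unfolding surface_tension_def using Phi_mono[of "-1" 1] by simp

lemma Phi_m_deriv: "((\<lambda>s. Phi (m s)) has_real_derivative (b (m s))\<^sup>2) (at s)"
  using DERIV_chain2[OF Phi_deriv m_deriv, of s] by (simp add: power2_eq_square)

text \<open>The Cauchy-Schwarz inequality for the integral of \<open>b (m s)\<close> over [p, q],
  obtained from the nonnegative derivative \<open>(b (m s) - c)\<^sup>2\<close> with c the mean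
  slope.\<close>

lemma m_increment_sq:
  assumes "p < q" shows "(m q - m p)\<^sup>2 \<le> (q - p) * (Phi (m q) - Phi (m p))"
proof -
  define c where "c = (m q - m p) / (q - p)"
  have "Phi (m p) - 2 * c * m p + c\<^sup>2 * p \<le> Phi (m q) - 2 * c * m q + c\<^sup>2 * q"
  proof (rule DERIV_nonneg_imp_nondecreasing[of p q "\<lambda>s. Phi (m s) - 2 * c * m s + c\<^sup>2 * s"])
    fix s
    have "((\<lambda>s. Phi (m s) - 2 * c * m s + c\<^sup>2 * s) has_real_derivative (b (m s))\<^sup>2 - 2 * c * b (m s) + c\<^sup>2 * 1) (at s)"
      by (intro DERIV_add DERIV_diff DERIV_cmult Phi_m_deriv m_deriv DERIV_ident)
    moreover have "(b (m s))\<^sup>2 - 2 * c * b (m s) + c\<^sup>2 * 1 = (b (m s) - c)\<^sup>2" by (simp add: power2_eq_square algebra_simps)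
    ultimately show "\<exists>y. ((\<lambda>s. Phi (m s) - 2 * c * m s + c\<^sup>2 * s) has_real_derivative y) (at s) \<and> 0 \<le> y" by force
  qed (use assms in simp)
  then have "2 * c * (m q - m p) - c\<^sup>2 * (q - p) \<le> Phi (m q) - Phi (m p)" by (simp add: algebra_simps)
  moreover have "2 * c * (m q - m p) - c\<^sup>2 * (q - p) = (m q - m p)\<^sup>2 / (q - p)"
  proof -
    have "2 * (n / d) * n - (n / d)\<^sup>2 * d = n\<^sup>2 / d" if "d > 0" for n d :: real
      using that by (simp add: power2_eq_square field_simps)
    from this[of "q - p" "m q - m p"] show ?thesis unfolding c_def using assms by (simp only: diff_gt_0_iff_gt)
  qed
  ultimately have "(m q - m p)\<^sup>2 / (q - p) \<le> Phi (m q) - Phi (m p)" by simp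
  moreover have "0 < q - p" using assms by simp
  ultimately show ?thesis by (simp only: pos_divide_le_eq mult.commute)
qed

text \<open>Equipartition: along a kink \<open>F (m s)\<close> is half the derivative of
  \<open>Phi (m s)\<close>, so the potential carries half of the transition cost.\<close>

lemma F_m_integral: "0 < L \<Longrightarrow> ((\<lambda>s. F (m s)) has_integral (Phi (m L) - Phi (m (- L))) / 2) {-L..L}"
proof -
  assume L: "0 < L"
  have "((\<lambda>s. (b (m s))\<^sup>2) has_integral (Phi (m L) - Phi (m (- L)))) {-L..L}"
    by (rule fundamental_theorem_of_calculus)
      (use L Phi_m_deriv in \<open>auto simp flip: has_real_derivative_iff_has_vector_derivative intro: has_field_derivative_at_within\<close>)
  from has_integral_divide[OF this, of 2] show ?thesis
    using b_inside m_bounds by (simp add: abs_le_iff bt_sq)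
qed

text \<open>The kink misses the boundary values at -L and L by at most q; an affine change of its
  values repairs both ends. The discrete energies of the result are nearly half the surface tension,
  uniformly in J, and the potential of every path in a tube about it is nearly the other
  half.\<close>

lemma recovery_profile:
  assumes L: "L > 0" and q: "q = exp (- k * L)" "q \<le> 1/4"
  shows "\<exists>h. continuous_on {-L..L} h \<and> h (- L) = -1 \<and> h L = 1 \<and>
    (\<forall>J. energy L J h \<le> (1 + 2 * q)\<^sup>2 * surface_tension / 2) \<and>
    (\<forall>x R \<kappa>. continuous_on {-L..L} x \<longrightarrow> (\<forall>t\<in>{-L..L}. \<bar>x t - h t\<bar> \<le> R) \<longrightarrow> R + 3 * q \<le> 1 \<longrightarrow> 0 < \<kappa> \<longrightarrow>
      integral {-L..L} (\<lambda>s. F (x s)) \<le> (1 + \<kappa>) * surface_tension / 2 + (1 + 1 / \<kappa>) * K\<^sup>2 * (R + 3 * q)\<^sup>2 * L)"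
proof -
  define p r where "p = m L" and "r = m (- L)"
  have pr: "1 - q \<le> p" "p \<le> 1" "-1 \<le> r" "r \<le> -1 + q"
    using m_decay[of L] m_decay'[of "-L"] m_bounds[of L] m_bounds[of "-L"] L by (auto simp: p_def r_def q(1))
  define d where "d = p - r"
  have d: "2 - 2 * q \<le> d" "d \<le> 2" using pr by (auto simp: d_def)
  have d1: "1 \<le> d" "0 < d" using d q by auto
  \<comment> \<open>The solution of \<alpha> p + \<beta> = 1 and \<alpha> r + \<beta> = -1. Since d
    is within 2 q of 2, \<alpha> is within 2 q of 1 and |\<beta>| \<le> q.\<close>
  define \<alpha> \<beta> where "\<alpha> = 2 / d" and "\<beta> = - (p + r) / d"
  define h where "h s = \<alpha> * m s + \<beta>" for s
  have "\<alpha> - 1 = (2 - d) / d" using d1 by (simp add: \<alpha>_def field_simps)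
  also have "\<dots> \<le> (2 - d) / 1" using d d1 by (intro divide_left_mono) auto
  finally have \<alpha>: "1 \<le> \<alpha>" "\<alpha> \<le> 1 + 2 * q" using d d1 by (auto simp: \<alpha>_def)
  have \<beta>: "\<bar>\<beta>\<bar> \<le> q"
  proof -
    have "\<bar>\<beta>\<bar> = \<bar>p + r\<bar> / d" unfolding \<beta>_def abs_divide abs_minus_cancel using d1 by simp
    also have "\<dots> \<le> \<bar>p + r\<bar> / 1" using d1 by (intro divide_left_mono) auto
    also have "\<dots> \<le> q" using pr by auto
    finally show ?thesis .
  qed
  have hm: "\<bar>h s - m s\<bar> \<le> 3 * q" for s
  proof -
    have "h s - m s = (\<alpha> - 1) * m s + \<beta>" by (simp add: h_def algebra_simps)
    moreover have "\<bar>(\<alpha> - 1) * m s\<bar> \<le> (2 * q) * 1"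
      unfolding abs_mult using \<alpha> m_bounds[of s] by (intro mult_mono) (auto simp: abs_le_iff)
    ultimately show ?thesis using \<beta> by linarith
  qed
  have ch: "continuous_on S h" for S unfolding h_def by (intro continuous_intros m_cont)
  have hl: "h (- L) = -1" and hr: "h L = 1"
  proof -
    have "\<alpha> * r + \<beta> = (r - p) / d" "\<alpha> * p + \<beta> = (p - r) / d"
      using d1 by (simp_all add: \<alpha>_def \<beta>_def field_simps)
    moreover have "(p - r) / d = 1" "(r - p) / d = - 1" using d1 by (simp_all add: d_def divide_eq_eq)
    ultimately show "h (- L) = -1" "h L = 1" by (simp_all add: h_def p_def r_def)
  qed
  have en: "energy L J h \<le> (1 + 2 * q)\<^sup>2 * surface_tension / 2" for J
  proof -
    let ?D = "dyadic L J"
    have "(\<Sum>i<2 ^ J. (h (?D (i + 1)) - h (?D i))\<^sup>2) \<le> (\<Sum>i<2 ^ J. \<alpha>\<^sup>2 * (2 * L / 2 ^ J) * (Phi (m (?D (Suc i))) - Phi (m (?D i))))"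
    proof (rule sum_mono)
      fix i
      have "(h (?D (i + 1)) - h (?D i))\<^sup>2 = \<alpha>\<^sup>2 * (m (?D (i + 1)) - m (?D i))\<^sup>2"
        by (simp add: h_def power_mult_distrib flip: right_diff_distrib)
      also have "\<dots> \<le> \<alpha>\<^sup>2 * ((?D (i + 1) - ?D i) * (Phi (m (?D (i + 1))) - Phi (m (?D i))))"
        by (intro mult_left_mono m_increment_sq dyadic_strict_mono[OF L]) auto
      also have "?D (i + 1) - ?D i = 2 * L / 2 ^ J" by (rule dyadic_step)
      finally show "(h (?D (i + 1)) - h (?D i))\<^sup>2 \<le> \<alpha>\<^sup>2 * (2 * L / 2 ^ J) * (Phi (m (?D (Suc i))) - Phi (m (?D i)))"
        by (simp add: mult.assoc)
    qed
    also have "\<dots> = \<alpha>\<^sup>2 * (2 * L / 2 ^ J) * (Phi (m L) - Phi (m (- L)))"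
      unfolding sum_distrib_left[symmetric] sum_lessThan_telescope[of "\<lambda>i. Phi (m (?D i))"] dyadic_0 dyadic_end ..
    finally have "energy L J h \<le> \<alpha>\<^sup>2 * (2 * L / 2 ^ J) * (Phi (m L) - Phi (m (- L))) * 2 ^ J / (4 * L)"
      unfolding energy_def using L by (intro divide_right_mono mult_right_mono) auto
    also have "\<dots> = \<alpha>\<^sup>2 * (Phi (m L) - Phi (m (- L))) / 2" using L by (simp add: field_simps)
    also have "\<dots> \<le> (1 + 2 * q)\<^sup>2 * surface_tension / 2"
    proof -
      have "0 \<le> Phi (m L) - Phi (m (- L))" using Phi_mono[of "m (-L)" "m L"] m_bounds m_mono[of "-L" L] L by simp
      moreover have "\<alpha>\<^sup>2 \<le> (1 + 2 * q)\<^sup>2" using \<alpha> by (intro power_mono) auto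
      ultimately show ?thesis using Phi_m_le by (intro divide_right_mono mult_mono) auto
    qed
    finally show ?thesis .
  qed
  have pot: "integral {-L..L} (\<lambda>s. F (x s)) \<le> (1 + \<kappa>) * surface_tension / 2 + (1 + 1 / \<kappa>) * K\<^sup>2 * (R + 3 * q)\<^sup>2 * L"
    if cx: "continuous_on {-L..L} x" and tube: "\<forall>t\<in>{-L..L}. \<bar>x t - h t\<bar> \<le> R" and R: "R + 3 * q \<le> 1" and \<kappa>: "0 < \<kappa>"
    for x :: "real \<Rightarrow> real" and R \<kappa>
  proof -
    define B where "B = (1 + 1 / \<kappa>) * K\<^sup>2 * (R + 3 * q)\<^sup>2 / 2"
    have "integral {-L..L} (\<lambda>s. F (x s)) \<le> (1 + \<kappa>) * ((Phi (m L) - Phi (m (- L))) / 2) + (L - - L) * B"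
    proof (rule has_integral_le)
      show "((\<lambda>s. F (x s)) has_integral integral {-L..L} (\<lambda>s. F (x s))) {-L..L}"
        by (intro integrable_integral integrable_continuous_interval continuous_on_compose2[OF F_cont[of UNIV] cx]) auto
      have "((\<lambda>s. B) has_integral (L - - L) * B) {-L..L}"
        using has_integral_const_real[of B "-L" L] L by simp
      then show "((\<lambda>s. (1 + \<kappa>) * F (m s) + B) has_integral (1 + \<kappa>) * ((Phi (m L) - Phi (m (- L))) / 2) + (L - - L) * B) {-L..L}"
        by (intro has_integral_add has_integral_mult_right F_m_integral L)
    next
      fix s assume s: "s \<in> {-L..L}"
      \<comment> \<open>The condition R + 3 q \<le> 1 keeps x within [-2, 2], where
        \<open>bt\<close> is Lipschitz. Here \<open>bt\<close> takes the place of b: an upper bound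
        on F is wanted, and \<open>b_sq_le\<close> bounds F from below.\<close>
      have xm: "\<bar>x s - m s\<bar> \<le> R + 3 * q" using tube s hm[of s] by (smt (verit))
      then have "x s \<in> {-2..2}" "m s \<in> {-2..2}" using m_bounds[of s] R by (auto simp: abs_le_iff)
      then have "\<bar>bt (x s) - bt (m s)\<bar> \<le> K * \<bar>x s - m s\<bar>" by (rule lip)
      also have "\<dots> \<le> K * (R + 3 * q)" using K xm by (intro mult_left_mono) auto
      finally have "\<bar>bt (x s) - bt (m s)\<bar>\<^sup>2 \<le> (K * (R + 3 * q))\<^sup>2" by (intro power_mono) auto
      then have sq: "(bt (x s) - bt (m s))\<^sup>2 \<le> K\<^sup>2 * (R + 3 * q)\<^sup>2" by (simp add: power_mult_distrib)
      have "0 \<le> (\<kappa> * bt (m s) - (bt (x s) - bt (m s)))\<^sup>2 / \<kappa>" using \<kappa> by simp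
      also have "\<dots> = \<kappa> * (bt (m s))\<^sup>2 - 2 * bt (m s) * (bt (x s) - bt (m s)) + (bt (x s) - bt (m s))\<^sup>2 / \<kappa>"
        using \<kappa> by (simp add: power2_eq_square field_simps)
      finally have "(bt (x s))\<^sup>2 \<le> (1 + \<kappa>) * (bt (m s))\<^sup>2 + (bt (x s) - bt (m s))\<^sup>2 + (bt (x s) - bt (m s))\<^sup>2 / \<kappa>"
        by (simp add: power2_eq_square algebra_simps)
      also have "(bt (x s) - bt (m s))\<^sup>2 / \<kappa> \<le> K\<^sup>2 * (R + 3 * q)\<^sup>2 / \<kappa>" using sq \<kappa> by (intro divide_right_mono) auto
      finally have "2 * F (x s) \<le> (1 + \<kappa>) * (2 * F (m s)) + K\<^sup>2 * (R + 3 * q)\<^sup>2 + K\<^sup>2 * (R + 3 * q)\<^sup>2 / \<kappa>"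
        using sq by (simp add: bt_sq)
      then show "F (x s) \<le> (1 + \<kappa>) * F (m s) + B" by (simp add: B_def field_simps)
    qed
    also have "\<dots> \<le> (1 + \<kappa>) * (surface_tension / 2) + (L - - L) * B"
      using Phi_m_le[of L "-L"] \<kappa> by (intro add_right_mono mult_left_mono divide_right_mono) auto
    also have "\<dots> = (1 + \<kappa>) * surface_tension / 2 + (1 + 1 / \<kappa>) * K\<^sup>2 * (R + 3 * q)\<^sup>2 * L"
      by (simp add: B_def)
    finally show ?thesis .
  qed
  show ?thesis
    by (rule exI[of _ h], intro conjI allI impI ch hl hr en, rule pot; assumption)
qed

end

section \<open>Gaussian families\<close>

lemma nn_integral_normal_density:
  "0 < \<sigma> \<Longrightarrow> (\<integral>\<^sup>+x. ennreal (normal_density \<mu> \<sigma> x) \<partial>lborel) = 1"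
  by (subst nn_integral_eq_integral) (auto simp: integral_normal_density integrable_normal_density)

lemma std_normal_mgf:
  "(\<integral>\<^sup>+x. ennreal (std_normal_density x * exp (s * x)) \<partial>lborel) = ennreal (exp (s\<^sup>2 / 2))"
proof -
  have "std_normal_density x * exp (s * x) = exp (s\<^sup>2 / 2) * normal_density s 1 x" for x
    by (simp add: normal_density_def power2_eq_square field_simps flip: exp_add)
  then show ?thesis
    by (simp add: ennreal_mult nn_integral_cmult nn_integral_normal_density)
qed

lemma std_normal_sq_mgf:
  assumes "a < 1"
  shows "(\<integral>\<^sup>+x. ennreal (std_normal_density x * exp (a / 2 * x\<^sup>2)) \<partial>lborel) = ennreal (1 / sqrt (1 - a))"
proof -
  have eq: "std_normal_density x * exp (a / 2 * x\<^sup>2) = 1 / sqrt (1 - a) * normal_density 0 (1 / sqrt (1 - a)) x" for x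
  proof -
    have e: "x\<^sup>2 * (1 - a) / 2 = x\<^sup>2 / 2 - a * x\<^sup>2 / 2" by (simp add: field_simps)
    show ?thesis using assms
      by (simp add: normal_density_def real_sqrt_mult real_sqrt_divide power_divide e flip: exp_add)
  qed
  show ?thesis unfolding eq using assms
    by (subst ennreal_mult) (auto simp: nn_integral_cmult nn_integral_normal_density)
qed

section \<open>Exponential moments, characteristic functions and independence of Gaussian
  variables\<close>

context prob_space
begin

lemma gaussian_centered_cases:
  assumes Y: "gaussian_rv M Y" and E: "expectation Y = 0"
  obtains (pos) \<sigma> where "0 < \<sigma>" "distributed M lborel Y (normal_density 0 \<sigma>)" "expectation (\<lambda>x. (Y x)\<^sup>2) = \<sigma>\<^sup>2"
    "integrable M Y" "integrable M (\<lambda>x. (Y x)\<^sup>2)"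
  | (zero) "AE x in M. Y x = 0"
proof -
  consider a \<sigma> where "0 < \<sigma>" "distributed M lborel Y (normal_density a \<sigma>)" | a where "AE x in M. Y x = a"
    using Y unfolding gaussian_rv_def by blast
  then show ?thesis
  proof cases
    case 1
    have a: "a = 0" using normal_distributed_expectation[OF 1] E by simp
    have D: "distributed M lborel Y (normal_density 0 \<sigma>)" using 1 a by simp
    have "expectation (\<lambda>x. (Y x)\<^sup>2) = \<sigma>\<^sup>2" using normal_distributed_variance[OF 1(1) D] E by simp
    moreover have "integrable M Y"
      using distributed_integrable[OF D, of "\<lambda>x. x"] integrable_normal_moment_nz_1[OF 1(1), of 0] by simp
    moreover have "integrable M (\<lambda>x. (Y x)\<^sup>2)"
      using distributed_integrable[OF D, of "\<lambda>x. x\<^sup>2"] integrable_normal_moment[OF 1(1), of 0 2] by simp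
    ultimately show ?thesis using pos 1(1) D by blast
  next
    case 2
    have "expectation Y = expectation (\<lambda>_. a)"
      by (rule integral_cong_AE) (use 2 Y in \<open>auto simp: gaussian_rv_def\<close>)
    then have "a = 0" using E by (simp add: prob_space)
    then show ?thesis using 2 zero by simp
  qed
qed

lemma gaussian_integrable:
  assumes "gaussian_rv M Y"
  shows "integrable M Y" "integrable M (\<lambda>x. (Y x)\<^sup>2)"
proof -
  consider a \<sigma> where "0 < \<sigma>" "distributed M lborel Y (normal_density a \<sigma>)" | a where "AE x in M. Y x = a"
    using assms unfolding gaussian_rv_def by blast
  then have "integrable M Y \<and> integrable M (\<lambda>x. (Y x)\<^sup>2)"
  proof cases
    case 1
    have Ym: "Y \<in> borel_measurable M" using assms by (simp add: gaussian_rv_def)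
    have i2: "integrable lborel (\<lambda>x. normal_density a \<sigma> x * (x - a) ^ 2)"
      using integrable_normal_moment[OF 1(1), of a 2] by simp
    have d2: "integrable M (\<lambda>x. (Y x - a) ^ 2)"
      using distributed_integrable[OF 1(2), of "\<lambda>x. (x - a)^2"] i2 by simp
    have d1: "integrable M Y"
      using distributed_integrable[OF 1(2), of "\<lambda>x. x"] integrable_normal_moment_nz_1[OF 1(1), of a] by simp
    have "integrable M (\<lambda>x. (Y x - a)^2 + 2 * a * Y x - a^2)" using d1 d2 by simp
    moreover have "(\<lambda>x. (Y x - a)^2 + 2 * a * Y x - a^2) = (\<lambda>x. (Y x)\<^sup>2)"
      by (simp add: fun_eq_iff power2_eq_square algebra_simps)
    ultimately show ?thesis using d1 by simp
  next
    case 2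
    have Ym: "Y \<in> borel_measurable M" using assms by (simp add: gaussian_rv_def)
    have "integrable M Y \<longleftrightarrow> integrable M (\<lambda>_. a)" by (rule integrable_cong_AE) (use 2 Ym in auto)
    moreover have "integrable M (\<lambda>x. (Y x)\<^sup>2) \<longleftrightarrow> integrable M (\<lambda>_. a\<^sup>2)" by (rule integrable_cong_AE) (use 2 Ym in auto)
    ultimately show ?thesis by simp
  qed
  then show "integrable M Y" "integrable M (\<lambda>x. (Y x)\<^sup>2)" by auto
qed

lemma gaussian_mgf:
  assumes Y: "gaussian_rv M Y" and E: "expectation Y = 0"
  shows "(\<integral>\<^sup>+x. ennreal (exp (Y x)) \<partial>M) = ennreal (exp (expectation (\<lambda>x. (Y x)\<^sup>2) / 2))"
  using Y E
proof (cases rule: gaussian_centered_cases)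
  case (pos \<sigma>)
  have "distributed M lborel (\<lambda>x. (Y x - 0) / \<sigma>) std_normal_density"
    using pos normal_standard_normal_convert[of \<sigma> Y 0] by simp
  from distributed_nn_integral[OF this, of "\<lambda>x. ennreal (exp (\<sigma> * x))"]
  have "(\<integral>\<^sup>+x. ennreal (exp (\<sigma> * ((Y x - 0) / \<sigma>))) \<partial>M) = (\<integral>\<^sup>+x. ennreal (std_normal_density x) * ennreal (exp (\<sigma> * x)) \<partial>lborel)"
    by simp
  also have "\<dots> = (\<integral>\<^sup>+x. ennreal (std_normal_density x * exp (\<sigma> * x)) \<partial>lborel)"
    by (simp add: ennreal_mult)
  finally show ?thesis using pos std_normal_mgf[of \<sigma>] by simp
next
  case zero
  have "(\<integral>\<^sup>+x. ennreal (exp (Y x)) \<partial>M) = (\<integral>\<^sup>+x. 1 \<partial>M)"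
    by (rule nn_integral_cong_AE) (use zero in auto)
  moreover have "expectation (\<lambda>x. (Y x)\<^sup>2) = 0"
    using zero Y integral_cong_AE[of "\<lambda>x. (Y x)\<^sup>2" M "\<lambda>_. 0"] by (auto simp: gaussian_rv_def)
  ultimately show ?thesis by (simp add: emeasure_space_1)
qed

lemma gaussian_char:
  assumes Y: "gaussian_rv M Y" and E: "expectation Y = 0"
  shows "(CLINT x|M. iexp (Y x)) = complex_of_real (exp (- expectation (\<lambda>x. (Y x)\<^sup>2) / 2))"
  using Y E
proof (cases rule: gaussian_centered_cases)
  case (pos \<sigma>)
  define X where "X x = Y x / \<sigma>" for x
  have D: "distributed M lborel X std_normal_density"
    using pos normal_standard_normal_convert[of \<sigma> Y 0] by (simp add: X_def[abs_def])
  have Xm: "X \<in> borel_measurable M" using D by (auto simp: distributed_def)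
  have distr: "distr M borel X = std_normal_distribution"
    using distributed_distr_eq_density[OF D] by (simp cong: distr_cong)
  have "(CLINT x|M. iexp (Y x)) = (CLINT x|M. iexp (\<sigma> * X x))" using pos by (simp add: X_def)
  also have "\<dots> = char (distr M borel X) \<sigma>"
    unfolding char_def by (subst integral_distr) (use Xm in auto)
  also have "\<dots> = complex_of_real (exp (- (\<sigma>^2) / 2))"
    by (simp add: distr char_std_normal_distribution)
  finally show ?thesis using pos by simp
next
  case zero
  have Ym: "Y \<in> borel_measurable M" using Y by (simp add: gaussian_rv_def)
  have "(CLINT x|M. iexp (Y x)) = (CLINT x|M. 1)"
    by (rule integral_cong_AE) (use zero Ym in auto)
  moreover have "expectation (\<lambda>x. (Y x)\<^sup>2) = 0"
    using zero Ym integral_cong_AE[of "\<lambda>x. (Y x)\<^sup>2" M "\<lambda>_. 0"] by auto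
  ultimately show ?thesis by (simp add: prob_space)
qed

text \<open>The factor \<open>exp (a Y\<^sup>2 / 2)\<close> is the mean of \<open>exp (sqrt a z Y)\<close> over a standard normal \<open>z\<close>
  (Hubbard--Stratonovich), which reduces square exponential moments to linear ones.\<close>

lemma square_exponential_moment:
  fixes Y :: "'i \<Rightarrow> 'a \<Rightarrow> real"
  assumes K: "finite K" and Ym: "\<And>k. k \<in> K \<Longrightarrow> Y k \<in> borel_measurable M"
    and mgf: "\<And>c. (\<integral>\<^sup>+x. ennreal (exp (\<Sum>k\<in>K. c k * Y k x)) \<partial>M) \<le> ennreal (exp ((\<Sum>k\<in>K. (c k)\<^sup>2) / 2))"
    and a: "0 \<le> a" "a < 1"
  shows "(\<integral>\<^sup>+x. ennreal (exp (a / 2 * (\<Sum>k\<in>K. (Y k x)\<^sup>2))) \<partial>M) \<le> ennreal ((1 / sqrt (1 - a)) ^ card K)"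
proof -
  have "(\<integral>\<^sup>+x. ennreal (exp (a / 2 * (\<Sum>k\<in>A. (Y k x)\<^sup>2) + (\<Sum>k\<in>K - A. c k * Y k x))) \<partial>M)
      \<le> ennreal ((1 / sqrt (1 - a)) ^ card A * exp ((\<Sum>k\<in>K - A. (c k)\<^sup>2) / 2))" if "A \<subseteq> K" for A c
    using finite_subset[OF that K] that
  proof (induction A arbitrary: c rule: finite_induct)
    case empty
    then show ?case using mgf[of c] by simp
  next
    case (insert k A)
    define R where "R = K - insert k A"
    have KA: "K - A = insert k R" "k \<notin> R" "finite R" "R \<subseteq> K" using insert K by (auto simp: R_def)
    have kK: "k \<in> K" "A \<subseteq> K" using insert by auto
    have [measurable]: "Y i \<in> borel_measurable M" if "i \<in> K" for i using Ym that by simp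
    have m1: "(\<lambda>x. \<Sum>i\<in>A. (Y i x)\<^sup>2) \<in> borel_measurable M" "(\<lambda>x. \<Sum>i\<in>R. c i * Y i x) \<in> borel_measurable M"
      "Y k \<in> borel_measurable M"
      using kK KA Ym by (auto intro!: borel_measurable_sum borel_measurable_power borel_measurable_times)
    note [measurable] = m1
    define H where "H x = a / 2 * (\<Sum>i\<in>A. (Y i x)\<^sup>2) + (\<Sum>i\<in>R. c i * Y i x)" for x
    have [measurable]: "H \<in> borel_measurable M" unfolding H_def by measurable
    have "(\<integral>\<^sup>+x. ennreal (exp (a / 2 * (\<Sum>i\<in>insert k A. (Y i x)\<^sup>2) + (\<Sum>i\<in>R. c i * Y i x))) \<partial>M)
       = (\<integral>\<^sup>+x. ennreal (exp (H x)) * ennreal (exp ((sqrt a * Y k x)\<^sup>2 / 2)) \<partial>M)"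
      using insert a by (intro nn_integral_cong)
        (simp add: H_def power_mult_distrib algebra_simps add_divide_distrib flip: exp_add ennreal_mult)
    also have "\<dots> = (\<integral>\<^sup>+x. ennreal (exp (H x)) * (\<integral>\<^sup>+z. ennreal (std_normal_density z * exp (sqrt a * Y k x * z)) \<partial>lborel) \<partial>M)"
      by (simp only: std_normal_mgf)
    also have "\<dots> = (\<integral>\<^sup>+x. (\<integral>\<^sup>+z. ennreal (std_normal_density z) * ennreal (exp (H x + sqrt a * z * Y k x)) \<partial>lborel) \<partial>M)"
      by (subst nn_integral_cmult[symmetric]) (auto intro!: nn_integral_cong simp: exp_add mult_ac simp flip: ennreal_mult)
    also have "\<dots> = (\<integral>\<^sup>+z. (\<integral>\<^sup>+x. ennreal (std_normal_density z) * ennreal (exp (H x + sqrt a * z * Y k x)) \<partial>M) \<partial>lborel)"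
      by (rule pair_sigma_finite.Fubini'[symmetric])
        (auto intro!: pair_sigma_finite.intro sigma_finite_measure_axioms sigma_finite_lborel)
    also have "\<dots> = (\<integral>\<^sup>+z. ennreal (std_normal_density z) * (\<integral>\<^sup>+x. ennreal (exp (H x + sqrt a * z * Y k x)) \<partial>M) \<partial>lborel)"
      by (intro nn_integral_cong nn_integral_cmult) measurable
    also have "\<dots> \<le> (\<integral>\<^sup>+z. ennreal (std_normal_density z) *
        ennreal ((1 / sqrt (1 - a)) ^ card A * exp ((\<Sum>i\<in>R. (c i)\<^sup>2) / 2) * exp (a / 2 * z\<^sup>2)) \<partial>lborel)"
    proof (intro nn_integral_mono mult_left_mono)
      fix z :: real
      \<comment> \<open>For fixed z the auxiliary normal variable acts as the linear coefficient of
        \<open>Y k\<close>, so the induction hypothesis applies and contributes exp (a z^2 /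
        2).\<close>
      define c' where "c' = c(k := sqrt a * z)"
      have s: "(\<Sum>i\<in>K - A. c' i * Y i x) = sqrt a * z * Y k x + (\<Sum>i\<in>R. c i * Y i x)" for x
        unfolding KA(1) using KA by (simp add: c'_def) (intro sum.cong; auto)
      have s2: "(\<Sum>i\<in>K - A. (c' i)\<^sup>2) = a * z\<^sup>2 + (\<Sum>i\<in>R. (c i)\<^sup>2)"
      proof -
        have "(\<Sum>i\<in>R. (c' i)\<^sup>2) = (\<Sum>i\<in>R. (c i)\<^sup>2)" using KA by (intro sum.cong) (auto simp: c'_def)
        then show ?thesis unfolding KA(1) using KA a by (simp add: c'_def power_mult_distrib)
      qed
      have "(\<integral>\<^sup>+x. ennreal (exp (a / 2 * (\<Sum>k\<in>A. (Y k x)\<^sup>2) + (\<Sum>k\<in>K - A. c' k * Y k x))) \<partial>M)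
        \<le> ennreal ((1 / sqrt (1 - a)) ^ card A * exp ((\<Sum>k\<in>K - A. (c' k)\<^sup>2) / 2))"
        by (rule insert.IH) (use kK in auto)
      then show "(\<integral>\<^sup>+x. ennreal (exp (H x + sqrt a * z * Y k x)) \<partial>M)
        \<le> ennreal ((1 / sqrt (1 - a)) ^ card A * exp ((\<Sum>i\<in>R. (c i)\<^sup>2) / 2) * exp (a / 2 * z\<^sup>2))"
        unfolding s s2 H_def by (simp add: add_divide_distrib exp_add mult_ac add_ac)
    qed simp
    also have "\<dots> = (\<integral>\<^sup>+z. ennreal ((1 / sqrt (1 - a)) ^ card A * exp ((\<Sum>i\<in>R. (c i)\<^sup>2) / 2)) *
        ennreal (std_normal_density z * exp (a / 2 * z\<^sup>2)) \<partial>lborel)"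
      using a by (intro nn_integral_cong) (simp add: mult_ac flip: ennreal_mult)
    also have "\<dots> = ennreal ((1 / sqrt (1 - a)) ^ card A * exp ((\<Sum>i\<in>R. (c i)\<^sup>2) / 2)) * ennreal (1 / sqrt (1 - a))"
      by (subst nn_integral_cmult, measurable) (subst std_normal_sq_mgf[OF a(2)], rule refl)
    also have "\<dots> = ennreal ((1 / sqrt (1 - a)) ^ card (insert k A) * exp ((\<Sum>i\<in>R. (c i)\<^sup>2) / 2))"
      using a insert by (simp add: mult_ac flip: ennreal_mult)
    finally show ?case unfolding R_def .
  qed
  from this[of K undefined] show ?thesis by simp
qed

text \<open>The density w / E w defines a second probability measure. By \<open>ch\<close> the
  characteristic function of X is the same under both, and Levy's uniqueness theorem identifies the
  two laws of X.\<close>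

lemma weighted_law_eq:
  fixes X w :: "'a \<Rightarrow> real"
  assumes X[measurable]: "X \<in> borel_measurable M" and w[measurable]: "w \<in> borel_measurable M"
    and wb: "\<And>x. 0 \<le> w x" "\<And>x. w x \<le> B"
    and ch: "\<And>t. (CLINT x|M. iexp (t * X x) * of_real (w x)) = (CLINT x|M. iexp (t * X x)) * of_real (expectation w)"
    and A: "A \<in> sets borel"
  shows "expectation (\<lambda>x. indicator A (X x) * w x) = prob (X -` A \<inter> space M) * expectation w"
proof -
  have iw: "integrable M w"
    by (rule integrable_const_bound[of _ B]) (use wb in auto)
  have A'[measurable]: "X -` A \<inter> space M \<in> sets M" by (rule measurable_sets[OF X A])
  show ?thesis
  proof (cases "expectation w = 0")
    case True
    have "AE x in M. w x = 0" using integral_nonneg_eq_0_iff_AE[OF iw] wb True by auto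
    then have "expectation (\<lambda>x. indicator A (X x) * w x) = expectation (\<lambda>_. 0)"
      by (intro integral_cong_AE) (use A in auto)
    then show ?thesis using True by simp
  next
    case False
    have Epos: "expectation w > 0" using False wb Bochner_Integration.integral_nonneg[of M w] by (simp add: less_le)
    define N where "N = density M (\<lambda>x. ennreal (w x / expectation w))"
    have m[measurable]: "(\<lambda>x. w x / expectation w) \<in> borel_measurable M" by measurable
    have "(\<integral>\<^sup>+x. ennreal (w x / expectation w) \<partial>M) = ennreal (expectation (\<lambda>x. w x / expectation w))"
      using iw wb Epos by (intro nn_integral_eq_integral) auto
    also have "\<dots> = 1" using Epos by simp
    finally have "prob_space N" unfolding N_def by (intro prob_spaceI) (simp add: emeasure_density)
    then interpret N: prob_space N .
    have XN[measurable]: "X \<in> borel_measurable N" unfolding N_def by simp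
    have "real_distribution (distr N borel X)"
      by (rule N.real_distribution_distr) (rule XN)
    moreover have "real_distribution (distr M borel X)" by (rule real_distribution_distr) (rule X)
    moreover have "char (distr N borel X) = char (distr M borel X)"
    proof
      fix t
      have "char (distr N borel X) t = (CLINT x|N. iexp (t * X x))"
        unfolding char_def by (subst integral_distr) auto
      also have "\<dots> = (CLINT x|M. (w x / expectation w) *\<^sub>R iexp (t * X x))"
        unfolding N_def by (subst integral_density) (use wb Epos in auto)
      also have "\<dots> = (CLINT x|M. (iexp (t * X x) * of_real (w x)) / of_real (expectation w))"
        by (intro Bochner_Integration.integral_cong) (auto simp: scaleR_conv_of_real)
      also have "\<dots> = (CLINT x|M. iexp (t * X x))"
        unfolding integral_divide_zero ch using Epos by simp
      also have "\<dots> = char (distr M borel X) t"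
        unfolding char_def by (subst integral_distr) auto
      finally show "char (distr N borel X) t = char (distr M borel X) t" .
    qed
    ultimately have "distr N borel X = distr M borel X" by (rule Levy_uniqueness)
    then have "measure (distr N borel X) A = measure (distr M borel X) A" by simp
    moreover have "measure (distr M borel X) A = prob (X -` A \<inter> space M)"
      using A by (subst measure_distr) auto
    moreover have "measure (distr N borel X) A = N.prob (X -` A \<inter> space M)"
      using A by (subst measure_distr) (auto simp: N_def)
    moreover have "N.prob (X -` A \<inter> space M) = N.expectation (indicator (X -` A \<inter> space M))"
      by (simp add: N_def)
    moreover have "\<dots> = expectation (\<lambda>x. (w x / expectation w) *\<^sub>R indicator (X -` A \<inter> space M) x)"
      unfolding N_def by (subst integral_density) (use wb Epos in auto)
    moreover have "\<dots> = expectation (\<lambda>x. (indicator A (X x) * w x) / expectation w)"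
      by (intro Bochner_Integration.integral_cong) (auto simp: indicator_def)
    moreover have "\<dots> = expectation (\<lambda>x. indicator A (X x) * w x) / expectation w"
      by simp
    ultimately show ?thesis using Epos by (simp add: field_simps)
  qed
qed

text \<open>The weight 1 + Re Z is nonnegative and at most 2, so \<open>weighted_law_eq\<close>
  applies to it. Its factorisation follows from those for Z and \<open>cnj (Z x)\<close>, the latter
  being the conjugate of the one for Z at - t.\<close>

lemma indicator_times_char_Re:
  fixes X :: "'a \<Rightarrow> real" and Z :: "'a \<Rightarrow> complex"
  assumes X[measurable]: "X \<in> borel_measurable M" and Z[measurable]: "Z \<in> borel_measurable M"
    and Zb: "\<And>x. norm (Z x) \<le> 1"
    and ch: "\<And>t. (CLINT x|M. iexp (t * X x) * Z x) = (CLINT x|M. iexp (t * X x)) * (CLINT x|M. Z x)"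
    and A: "A \<in> sets borel"
  shows "expectation (\<lambda>x. indicator A (X x) * Re (Z x)) = prob (X -` A \<inter> space M) * expectation (\<lambda>x. Re (Z x))"
proof -
  have Amp[measurable]: "Measurable.pred borel (\<lambda>x. x \<in> A)" using A by (simp add: pred_def)
  have cZ[measurable]: "(\<lambda>x. cnj (Z x)) \<in> borel_measurable M"
    by (rule measurable_compose[OF Z]) (intro borel_measurable_continuous_onI continuous_intros)
  have iZ: "integrable M Z" by (rule integrable_const_bound[of _ 1]) (use Zb in auto)
  have Reb: "-1 \<le> Re (Z x)" "Re (Z x) \<le> 1" for x
    using Zb[of x] abs_Re_le_cmod[of "Z x"] by linarith+
  have iR: "integrable M (\<lambda>x. Re (Z x))" using iZ by auto
  have re: "expectation (\<lambda>x. indicator A (X x) * (1 + Re (Z x))) = prob (X -` A \<inter> space M) * expectation (\<lambda>x. 1 + Re (Z x))"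
  proof (rule weighted_law_eq[where B = 2])
    fix t
    define e where "e s x = iexp (s * X x)" for s x
    have em[measurable]: "e s \<in> borel_measurable M" for s unfolding e_def by measurable
    have en: "norm (e s x) = 1" for s x by (simp add: e_def)
    have cn: "e s x = cnj (e (- s) x)" for s x
    proof -
      have "cnj (iexp y) = iexp (- y)" for y :: real using cis_cnj[of y] by (simp only: cis_conv_exp)
      from this[of "- s * X x"] show ?thesis unfolding e_def by (simp only: mult_minus_left minus_minus)
    qed
    have i: "integrable M (e s)" "integrable M (\<lambda>x. e s x * Z x)" "integrable M (\<lambda>x. e s x * cnj (Z x))" for s
      by (rule integrable_const_bound[of _ 1]; use Zb in \<open>auto simp: norm_mult en\<close>)+
    have ch1: "(CLINT x|M. e s x * Z x) = (CLINT x|M. e s x) * (CLINT x|M. Z x)" for s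
      using ch[of s] by (simp add: e_def)
    have ch2: "(CLINT x|M. e t x * cnj (Z x)) = (CLINT x|M. e t x) * cnj (CLINT x|M. Z x)"
    proof -
      have "(CLINT x|M. e t x * cnj (Z x)) = (CLINT x|M. cnj (e (- t) x * Z x))"
        by (subst cn) simp
      also have "\<dots> = cnj (CLINT x|M. e (- t) x * Z x)" by (rule Bochner_Integration.integral_cnj)
      also have "\<dots> = cnj (CLINT x|M. e (- t) x) * cnj (CLINT x|M. Z x)"
        unfolding ch1 by simp
      also have "cnj (CLINT x|M. e (- t) x) = (CLINT x|M. cnj (e (- t) x))" by (rule Bochner_Integration.integral_cnj[symmetric])
      also have "\<dots> = (CLINT x|M. e t x)" using cn[of t] by simp
      finally show ?thesis .
    qed
    have "(CLINT x|M. e t x * of_real (1 + Re (Z x))) =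
      (CLINT x|M. e t x + (e t x * Z x + e t x * cnj (Z x)) / 2)"
    proof (intro Bochner_Integration.integral_cong refl)
      fix x
      have "complex_of_real (1 + Re (Z x)) = 1 + (Z x + cnj (Z x)) / 2" by (simp add: complex_eq_iff)
      then show "e t x * of_real (1 + Re (Z x)) = e t x + (e t x * Z x + e t x * cnj (Z x)) / 2"
        by (simp only: ring_distribs add_divide_distrib times_divide_eq_right mult_1_right)
    qed
    also have "\<dots> = (CLINT x|M. e t x) + ((CLINT x|M. e t x * Z x) + (CLINT x|M. e t x * cnj (Z x))) / 2"
      using i by simp
    also have "\<dots> = (CLINT x|M. e t x) * (1 + ((CLINT x|M. Z x) + cnj (CLINT x|M. Z x)) / 2)"
      unfolding ch1 ch2 by (simp only: ring_distribs add_divide_distrib times_divide_eq_right mult_1_right)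
    also have "1 + ((CLINT x|M. Z x) + cnj (CLINT x|M. Z x)) / 2 = of_real (1 + Re (CLINT x|M. Z x))"
      by (simp add: complex_eq_iff)
    also have "Re (CLINT x|M. Z x) = expectation (\<lambda>x. Re (Z x))" using iZ by simp
    also have "1 + expectation (\<lambda>x. Re (Z x)) = expectation (\<lambda>x. 1 + Re (Z x))" using iR by (simp add: prob_space)
    finally show "(CLINT x|M. iexp (t * X x) * of_real (1 + Re (Z x))) =
      (CLINT x|M. iexp (t * X x)) * of_real (expectation (\<lambda>x. 1 + Re (Z x)))"
      by (simp only: e_def)
    show "0 \<le> 1 + Re (Z x)" "1 + Re (Z x) \<le> 2" for x using Reb[of x] by auto
  qed (use A in auto)
  have iI: "integrable M (\<lambda>x. indicator A (X x) :: real)"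
    by (rule integrable_const_bound[of _ 1]) (auto simp: indicator_def)
  have iIR: "integrable M (\<lambda>x. indicator A (X x) * Re (Z x))"
  proof (rule integrable_const_bound[of _ 1])
    have "norm (indicat_real A (X x) * Re (Z x)) \<le> 1" for x
      using Reb[of x] by (auto simp: indicator_def)
    then show "AE x in M. norm (indicat_real A (X x) * Re (Z x)) \<le> 1" by simp
  qed measurable
  have one: "expectation (\<lambda>x. indicator A (X x)) = prob (X -` A \<inter> space M)"
  proof -
    have "expectation (\<lambda>x. indicator A (X x)) = expectation (indicator (X -` A \<inter> space M))"
      by (intro Bochner_Integration.integral_cong) (auto simp: indicator_def)
    also have "\<dots> = prob (X -` A \<inter> space M \<inter> space M)" by (rule Bochner_Integration.integral_indicator)
    finally show ?thesis by (simp add: Int_assoc)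
  qed
  have "expectation (\<lambda>x. indicator A (X x) * (1 + Re (Z x))) = expectation (\<lambda>x. indicator A (X x)) + expectation (\<lambda>x. indicator A (X x) * Re (Z x))"
    using iI iIR by (simp add: ring_distribs)
  moreover have "expectation (\<lambda>x. 1 + Re (Z x)) = 1 + expectation (\<lambda>x. Re (Z x))"
    using iR by (simp add: prob_space)
  ultimately show ?thesis using re one by (simp add: ring_distribs)
qed

lemma indicator_times_char:
  fixes X :: "'a \<Rightarrow> real" and Z :: "'a \<Rightarrow> complex"
  assumes X[measurable]: "X \<in> borel_measurable M" and Z[measurable]: "Z \<in> borel_measurable M"
    and Zb: "\<And>x. norm (Z x) \<le> 1"
    and ch: "\<And>t. (CLINT x|M. iexp (t * X x) * Z x) = (CLINT x|M. iexp (t * X x)) * (CLINT x|M. Z x)"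
    and A: "A \<in> sets borel"
  shows "(CLINT x|M. indicator A (X x) * Z x) = of_real (prob (X -` A \<inter> space M)) * (CLINT x|M. Z x)"
proof -
  have Amp[measurable]: "Measurable.pred borel (\<lambda>x. x \<in> A)" using A by (simp add: pred_def)
  have iZ: "integrable M Z" by (rule integrable_const_bound[of _ 1]) (use Zb in auto)
  have iIZ: "integrable M (\<lambda>x. indicator A (X x) * Z x)"
    by (rule integrable_const_bound[of _ 1]) (use Zb in \<open>auto simp: indicator_def\<close>)
  have "expectation (\<lambda>x. indicator A (X x) * Re (Z x)) = prob (X -` A \<inter> space M) * expectation (\<lambda>x. Re (Z x))"
    by (rule indicator_times_char_Re[OF X Z Zb ch A])
  moreover have "expectation (\<lambda>x. indicator A (X x) * Im (Z x)) = prob (X -` A \<inter> space M) * expectation (\<lambda>x. Im (Z x))"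
  proof -
    \<comment> \<open>The imaginary part of Z is the real part of - i Z, which satisfies the same
      hypotheses.\<close>
    have "(CLINT x|M. iexp (t * X x) * (- \<i> * Z x)) = (CLINT x|M. iexp (t * X x)) * (CLINT x|M. - \<i> * Z x)" for t
    proof -
      have "(CLINT x|M. iexp (t * X x) * (- \<i> * Z x)) = (CLINT x|M. - \<i> * (iexp (t * X x) * Z x))"
        by (intro Bochner_Integration.integral_cong) (simp_all only: mult.left_commute)
      then show ?thesis by (simp only: integral_mult_right_zero ch mult.left_commute)
    qed
    from indicator_times_char_Re[OF X _ _ this A] show ?thesis using Zb by (simp add: norm_mult)
  qed
  moreover have "Re (indicator A (X x) * Z x) = indicator A (X x) * Re (Z x)"
    "Im (indicator A (X x) * Z x) = indicator A (X x) * Im (Z x)" for x by (auto simp: indicator_def)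
  ultimately show ?thesis using iIZ iZ
    by (simp add: complex_eq_iff flip: integral_Re integral_Im)
qed

text \<open>Exponentials are exchanged for indicators one variable at a time: with the other factors
  collected in a bounded complex Z, the product of \<open>iexp (s * Y k x)\<close> and Z factorises
  by the induction hypothesis, and \<open>indicator_times_char\<close> replaces the exponential.
  One-dimensional uniqueness thus yields joint independence.\<close>

lemma standard_gaussian_family_independent:
  fixes Y :: "'i \<Rightarrow> 'a \<Rightarrow> real"
  assumes K: "finite K" and Ym: "\<And>k. k \<in> K \<Longrightarrow> Y k \<in> borel_measurable M"
    and ch: "\<And>t. (CLINT x|M. iexp (\<Sum>k\<in>K. t k * Y k x)) = of_real (exp (- (\<Sum>k\<in>K. (t k)\<^sup>2) / 2))"
    and B: "\<And>k. k \<in> K \<Longrightarrow> B k \<in> sets borel"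
  shows "prob {x \<in> space M. \<forall>k\<in>K. Y k x \<in> B k} = (\<Prod>k\<in>K. prob (Y k -` B k \<inter> space M))"
proof -
  have chk: "(CLINT x|M. iexp (s * Y k x)) = of_real (exp (- s\<^sup>2 / 2))" if "k \<in> K" for k s
    using ch[of "\<lambda>j. if j = k then s else 0"] K that by (simp add: if_distrib if_distribR sum.delta cong: if_cong)
  have "(CLINT x|M. (\<Prod>k\<in>A. indicator (B k) (Y k x)) * iexp (\<Sum>k\<in>K - A. t k * Y k x))
      = of_real ((\<Prod>k\<in>A. prob (Y k -` B k \<inter> space M)) * exp (- (\<Sum>k\<in>K - A. (t k)\<^sup>2) / 2))" if "A \<subseteq> K" for A t
    using finite_subset[OF that K] that
  proof (induction A arbitrary: t rule: finite_induct)
    case empty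
    then show ?case using ch[of t] by simp
  next
    case (insert k A)
    define R where "R = K - insert k A"
    have KA: "K - A = insert k R" "k \<notin> R" "finite R" "R \<subseteq> K" using insert K by (auto simp: R_def)
    have kK: "k \<in> K" "A \<subseteq> K" using insert by auto
    define Z where "Z x = (\<Prod>i\<in>A. indicator (B i) (Y i x)) * iexp (\<Sum>i\<in>R. t i * Y i x)" for x
    define c where "c = (\<Prod>i\<in>A. prob (Y i -` B i \<inter> space M)) * exp (- (\<Sum>i\<in>R. (t i)\<^sup>2) / 2)"
    have IH: "(CLINT x|M. iexp (s * Y k x) * Z x) = of_real (c * exp (- s\<^sup>2 / 2))" for s
    proof -
      define t' where "t' = t(k := s)"
      have "(\<Sum>i\<in>R. t' i * Y i x) = (\<Sum>i\<in>R. t i * Y i x)" for x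
        using KA by (intro sum.cong) (auto simp: t'_def)
      then have s: "(\<Sum>i\<in>K - A. t' i * Y i x) = s * Y k x + (\<Sum>i\<in>R. t i * Y i x)" for x
        unfolding KA(1) using KA by (simp add: t'_def)
      have "(\<Sum>i\<in>R. (t' i)\<^sup>2) = (\<Sum>i\<in>R. (t i)\<^sup>2)"
        using KA by (intro sum.cong) (auto simp: t'_def)
      then have s2: "(\<Sum>i\<in>K - A. (t' i)\<^sup>2) = s\<^sup>2 + (\<Sum>i\<in>R. (t i)\<^sup>2)"
        unfolding KA(1) using KA by (simp add: t'_def)
      have "(CLINT x|M. (\<Prod>k\<in>A. indicator (B k) (Y k x)) * iexp (\<Sum>k\<in>K - A. t' k * Y k x))
       = of_real ((\<Prod>k\<in>A. prob (Y k -` B k \<inter> space M)) * exp (- (\<Sum>k\<in>K - A. (t' k)\<^sup>2) / 2))"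
        by (rule insert.IH) (use kK in auto)
      moreover have "iexp (p + q) = iexp p * iexp q" for p q :: real by (simp add: exp_add ring_distribs)
      moreover have "exp (- (p + q) / 2) = exp (- q / 2) * exp (- p / 2)" for p q :: real
        by (simp add: add_divide_distrib flip: exp_add)
      ultimately show ?thesis unfolding s s2 Z_def c_def by (simp only: mult_ac)
    qed
    have Zm: "Z \<in> borel_measurable M"
    proof -
      have "(\<lambda>x. indicator (B i) (Y i x) :: complex) \<in> borel_measurable M" if "i \<in> A" for i
        by (rule measurable_compose[OF Ym borel_measurable_indicator[OF B]]) (use that kK in auto)
      moreover have "(\<lambda>x. iexp (\<Sum>i\<in>R. t i * Y i x)) \<in> borel_measurable M"
      proof -
        define S where "S x = (\<Sum>i\<in>R. t i * Y i x)" for x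
        have [measurable]: "S \<in> borel_measurable M"
          unfolding S_def using KA Ym by (intro borel_measurable_sum borel_measurable_times) auto
        show ?thesis unfolding S_def[symmetric] by measurable
      qed
      ultimately show ?thesis unfolding Z_def
        by (intro borel_measurable_times borel_measurable_prod) auto
    qed
    have Zb: "norm (Z x) \<le> 1" for x
    proof -
      have "(\<Prod>i\<in>A. norm (indicator (B i) (Y i x) :: complex)) \<le> (\<Prod>i\<in>A. 1)"
        by (intro prod_mono) (auto simp: indicator_def)
      then show ?thesis unfolding Z_def by (simp add: norm_mult flip: prod_norm)
    qed
    have EZ: "(CLINT x|M. Z x) = of_real c" using IH[of 0] by simp
    have "(CLINT x|M. indicator (B k) (Y k x) * Z x) = of_real (prob (Y k -` B k \<inter> space M)) * (CLINT x|M. Z x)"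
    proof (rule indicator_times_char[OF Ym[OF kK(1)] Zm Zb _ B[OF kK(1)]])
      fix s show "(CLINT x|M. iexp (s * Y k x) * Z x) = (CLINT x|M. iexp (s * Y k x)) * (CLINT x|M. Z x)"
        unfolding IH EZ chk[OF kK(1)] by simp
    qed
    then show ?case unfolding EZ using insert.hyps by (simp add: Z_def c_def R_def mult_ac)
  qed
  from this[of K "\<lambda>_. 0"] have 1: "(CLINT x|M. (\<Prod>k\<in>K. indicator (B k) (Y k x))) = of_real (\<Prod>k\<in>K. prob (Y k -` B k \<inter> space M))"
    by simp
  have "(\<Prod>k\<in>K. indicator (B k) (Y k x) :: complex) = of_real (indicator {x \<in> space M. \<forall>k\<in>K. Y k x \<in> B k} x)"
    if "x \<in> space M" for x
    using K that by (auto simp: indicator_def prod_zero_iff)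
  then have "(CLINT x|M. (\<Prod>k\<in>K. indicator (B k) (Y k x))) = (CLINT x|M. of_real (indicator {x \<in> space M. \<forall>k\<in>K. Y k x \<in> B k} x))"
    by (intro Bochner_Integration.integral_cong) auto
  also have "\<dots> = of_real (expectation (indicator {x \<in> space M. \<forall>k\<in>K. Y k x \<in> B k}))"
    by simp
  also have "expectation (indicator {x \<in> space M. \<forall>k\<in>K. Y k x \<in> B k}) = prob {x \<in> space M. \<forall>k\<in>K. Y k x \<in> B k}"
    by (simp add: Int_def conj_commute cong: conj_cong)
  finally show ?thesis unfolding 1 of_real_eq_iff by (rule sym)
qed

end

section \<open>Intervals under the standard normal law\<close>

lemma std_normal_interval:
  "measure std_normal_distribution {a..b} = integral {a..b} std_normal_density"
proof -
  have c: "continuous_on {a..b} std_normal_density"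
    unfolding normal_density_def[abs_def] by (intro continuous_intros) auto
  have i: "set_integrable lborel {a..b} std_normal_density" by (rule borel_integrable_atLeastAtMost') (rule c)
  have "emeasure std_normal_distribution {a..b} = (\<integral>\<^sup>+x. ennreal (std_normal_density x) * indicator {a..b} x \<partial>lborel)"
    by (simp add: emeasure_density)
  also have "\<dots> = (\<integral>\<^sup>+x. ennreal (indicator {a..b} x *\<^sub>R std_normal_density x) \<partial>lborel)"
    by (intro nn_integral_cong) (auto simp: indicator_def)
  also have "\<dots> = ennreal (LINT x:{a..b}|lborel. std_normal_density x)"
    unfolding set_lebesgue_integral_def
    by (rule nn_integral_eq_integral) (use i in \<open>auto simp: set_integrable_def\<close>)
  also have "(LINT x:{a..b}|lborel. std_normal_density x) = integral {a..b} std_normal_density"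
    by (rule set_borel_integral_eq_integral(2)[OF i])
  finally show ?thesis
    by (simp add: measure_def integral_nonneg integrable_continuous_interval[OF c])
qed

lemma std_normal_continuous: "continuous_on S std_normal_density"
  unfolding normal_density_def[abs_def] by (intro continuous_intros) auto

text \<open>The Cameron-Martin shift in one dimension: the density at x + c is exp (- c^2 / 2) exp
  (- c x) times the density at x, and exp (- c x) \<ge> 1 - c x, whose linear part is odd and
  integrates to 0 over [-u, u].\<close>

lemma std_normal_shifted_interval:
  assumes u: "u > 0"
  shows "exp (- c\<^sup>2 / 2) * measure std_normal_distribution {-u..u} \<le> measure std_normal_distribution {c - u..c + u}"
proof -
  let ?\<phi> = std_normal_density
  have d: "((\<lambda>x. - ?\<phi> x) has_vector_derivative x * ?\<phi> x) (at x within S)" for x S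
  proof -
    have "((\<lambda>x. - (k * exp (- x\<^sup>2 / 2))) has_real_derivative x * (k * exp (- x\<^sup>2 / 2))) (at x within S)" for k
      by (auto intro!: derivative_eq_intros)
    then have "((\<lambda>x. - ?\<phi> x) has_real_derivative x * ?\<phi> x) (at x within S)"
      unfolding std_normal_density_def .
    then show ?thesis by (simp add: has_real_derivative_iff_has_vector_derivative)
  qed
  have "((\<lambda>x. x * ?\<phi> x) has_integral (- ?\<phi> u - - ?\<phi> (-u))) {-u..u}"
    by (rule fundamental_theorem_of_calculus) (use u d in auto)
  then have odd: "((\<lambda>x. x * ?\<phi> x) has_integral 0) {-u..u}" by (simp add: std_normal_density_def)
  have int: "(?\<phi> has_integral integral {-u..u} ?\<phi>) {-u..u}"
    by (intro integrable_integral integrable_continuous_interval std_normal_continuous)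
  have lower: "((\<lambda>x. exp (- c\<^sup>2 / 2) * (?\<phi> x - c * (x * ?\<phi> x))) has_integral (exp (- c\<^sup>2 / 2) * (integral {-u..u} ?\<phi> - c * 0))) {-u..u}"
    by (intro has_integral_mult_right has_integral_diff int odd)
  have shift: "integral {-u..u} (?\<phi> \<circ> (\<lambda>x. x + c)) = integral {c-u..c+u} ?\<phi>"
    using integral_shift[of "-u" c u ?\<phi>] std_normal_continuous by (simp add: add.commute)
  have "((?\<phi> \<circ> (\<lambda>x. x + c)) has_integral integral {c-u..c+u} ?\<phi>) {-u..u}"
    unfolding shift[symmetric] comp_def
    by (intro integrable_integral integrable_continuous_interval continuous_on_compose2[OF std_normal_continuous[of UNIV]] continuous_intros) auto
  from has_integral_le[OF lower this] have "exp (- c\<^sup>2 / 2) * integral {-u..u} ?\<phi> \<le> integral {c-u..c+u} ?\<phi>"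
  proof (simp, elim meta_mp)
    fix x
    have "?\<phi> (x + c) = exp (- c\<^sup>2 / 2) * (?\<phi> x * exp (- c * x))"
      unfolding std_normal_density_def by (simp add: power2_eq_square field_simps flip: exp_add)
    moreover have "?\<phi> x * (1 + - c * x) \<le> ?\<phi> x * exp (- c * x)"
      by (intro mult_left_mono exp_ge_add_one_self) auto
    moreover have "?\<phi> x - c * (x * ?\<phi> x) = ?\<phi> x * (1 + - c * x)" by (simp add: algebra_simps)
    ultimately show "exp (- (c\<^sup>2 / 2)) * (?\<phi> x - c * (x * ?\<phi> x)) \<le> ?\<phi> (x + c)" by simp
  qed
  then show ?thesis by (simp add: std_normal_interval)
qed

text \<open>The exponent \<open>u\<^sup>-\<^sup>4\<close> is far from sharp at both ends, but it makes the small-ball cost of the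
  dyadic coefficients summable with a single geometric choice of tolerances.\<close>

lemma std_normal_small_ball:
  "\<exists>C>0. \<forall>u>0. exp (- C / u ^ 4) \<le> measure std_normal_distribution {-u..u}"
proof -
  let ?\<phi> = std_normal_density
  define q where "q = ?\<phi> 2"
  have q: "q > 0" by (simp add: q_def normal_density_pos)
  define C where "C = 6 + 16 / q"
  have C: "C > 0" using q by (simp add: C_def add_pos_pos)
  interpret N: real_distribution std_normal_distribution by (rule real_dist_normal_dist)
  have main: "exp (- C / u ^ 4) \<le> measure std_normal_distribution {-u..u}" if u: "u > 0" for u
  proof (cases "u \<le> 2")
    case True
    have "integral {-u..u} (\<lambda>_. q) \<le> integral {-u..u} ?\<phi>"
    proof (rule integral_le)
      show "q \<le> ?\<phi> x" if "x \<in> {-u..u}" for x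
      proof -
        have "x\<^sup>2 \<le> 2\<^sup>2" using that True by (intro abs_le_square_iff[THEN iffD1]) auto
        then show ?thesis by (simp add: q_def std_normal_density_def divide_right_mono)
      qed
    qed (auto intro: integrable_continuous_interval std_normal_continuous)
    then have "2 * u * q \<le> measure std_normal_distribution {-u..u}" using u by (simp add: std_normal_interval)
    moreover have "exp (- C / u ^ 4) \<le> 2 * u * q"
    proof -
      have "1 / (2 * u * q) \<le> exp (1 / (2 * u * q))" using exp_ge_add_one_self[of "1 / (2 * u * q)"] by linarith
      then have "inverse (exp (1 / (2 * u * q))) \<le> inverse (1 / (2 * u * q))" using u q by (intro le_imp_inverse_le) auto
      then have 1: "exp (- (1 / (2 * u * q))) \<le> 2 * u * q" by (simp add: exp_minus)
      have "u ^ 3 \<le> 2 ^ 3" using u True by (intro power_mono) auto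
      then have "u ^ 4 \<le> 8 * u" using u by (simp add: power_numeral_reduce)
      then have "1 / (2 * u * q) \<le> (4 / q) / u ^ 4" using u q by (simp add: field_simps)
      also have "\<dots> \<le> C / u ^ 4" using u q by (intro divide_right_mono) (auto simp: C_def field_simps)
      finally have "exp (- C / u ^ 4) \<le> exp (- (1 / (2 * u * q)))" by simp
      then show ?thesis using 1 by linarith
    qed
    ultimately show ?thesis by linarith
  next
    case False
    \<comment> \<open>For large u the fourth moment 3 and Markov's inequality bound the tail by y =
      3 / u^4 \<le> 1/2, and then 1 - y \<ge> exp (- 2 y).\<close>
    have m: "has_bochner_integral lborel (\<lambda>x. ?\<phi> x * x ^ 4) 3"
      using std_normal_moment_even[of 2] by (simp add: fact_numeral)
    have "integrable std_normal_distribution (\<lambda>x. x ^ 4)"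
      using m by (subst integrable_density) (auto simp: has_bochner_integral_iff)
    then have "measure std_normal_distribution {x \<in> space std_normal_distribution. u ^ 4 \<le> x ^ 4}
       \<le> (LINT x|std_normal_distribution. x ^ 4) / u ^ 4"
      by (intro integral_Markov_inequality_measure[where A = "{}"]) (use u in auto)
    also have "(LINT x|std_normal_distribution. x ^ 4) = 3"
      using m by (subst integral_density) (auto simp: has_bochner_integral_iff)
    finally have t: "measure std_normal_distribution {x. u ^ 4 \<le> x ^ 4} \<le> 3 / u ^ 4" by simp
    have "measure std_normal_distribution (UNIV - {-u..u}) \<le> measure std_normal_distribution {x. u ^ 4 \<le> x ^ 4}"
    proof (rule N.finite_measure_mono)
      show "UNIV - {-u..u} \<subseteq> {x. u ^ 4 \<le> x ^ 4}"
      proof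
        fix x assume "x \<in> UNIV - {-u..u}"
        then have "u \<le> \<bar>x\<bar>" by auto
        then have "u ^ 4 \<le> \<bar>x\<bar> ^ 4" using u by (intro power_mono) auto
        then show "x \<in> {x. u ^ 4 \<le> x ^ 4}" by simp
      qed
    qed auto
    moreover have "measure std_normal_distribution (UNIV - {-u..u}) = 1 - measure std_normal_distribution {-u..u}"
      using N.prob_compl[of "{-u..u}"] by simp
    ultimately have 1: "1 - 3 / u ^ 4 \<le> measure std_normal_distribution {-u..u}" using t by linarith
    define y where "y = 3 / u ^ 4"
    have "2 ^ 4 \<le> u ^ 4" using False by (intro power_mono) auto
    then have y: "0 \<le> y" "y \<le> 1/2" using u by (auto simp: y_def field_simps)
    have "exp (- (2 * y)) \<le> 1 - y"
    proof -
      have "0 \<le> y * (1 - 2 * y)" using y by (intro mult_nonneg_nonneg) auto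
      then have "1 \<le> (1 + 2 * y) * (1 - y)" by (simp add: algebra_simps)
      also have "\<dots> \<le> exp (2 * y) * (1 - y)"
        using y by (intro mult_right_mono exp_ge_add_one_self) auto
      finally have "1 / exp (2 * y) \<le> 1 - y" by (simp add: pos_divide_le_eq mult.commute)
      then show ?thesis by (simp add: exp_minus divide_inverse)
    qed
    moreover have "exp (- C / u ^ 4) \<le> exp (- (2 * y))"
    proof -
      have "6 / u ^ 4 \<le> C / u ^ 4" using u q by (intro divide_right_mono) (auto simp: C_def)
      then show ?thesis by (simp add: y_def)
    qed
    ultimately show ?thesis using 1 unfolding y_def by linarith
  qed
  then show ?thesis using C by blast
qed

text \<open>The process is the limit of its left-endpoint step processes.\<close>

lemma continuous_paths_jointly_measurable:
  fixes X :: "'w \<Rightarrow> real \<Rightarrow> real"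
  assumes ab: "a \<le> b" and meas: "\<And>t. t \<in> {a..b} \<Longrightarrow> (\<lambda>\<omega>. X \<omega> t) \<in> borel_measurable M"
    and cont: "\<And>\<omega>. \<omega> \<in> space M \<Longrightarrow> continuous_on {a..b} (X \<omega>)"
  shows "(\<lambda>(\<omega>, t). X \<omega> (max a (min b t))) \<in> borel_measurable (M \<Otimes>\<^sub>M lborel)"
proof -
  \<comment> \<open>Times are clamped to [a, b] because the product is taken with Lebesgue measure
    on the whole line.\<close>
  define c where "c t = max a (min b t)" for t
  have c: "c t \<in> {a..b}" for t using ab by (auto simp: c_def)
  define f where "f n = (\<lambda>(\<omega>, t). X \<omega> (c (of_int \<lfloor>t * real (Suc n)\<rfloor> / real (Suc n))))" for n
  have fm: "f n \<in> borel_measurable (M \<Otimes>\<^sub>M lborel)" for n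
  proof -
    have "(\<lambda>p. (\<lambda>i p. X (fst p) (c (of_int i / real (Suc n)))) \<lfloor>snd p * real (Suc n)\<rfloor> p) \<in> borel_measurable (M \<Otimes>\<^sub>M lborel)"
    proof (rule measurable_compose_countable[where f = "\<lambda>(i :: int) p. X (fst p) (c (of_int i / real (Suc n)))"])
      show "(\<lambda>p. X (fst p) (c (of_int i / real (Suc n)))) \<in> borel_measurable (M \<Otimes>\<^sub>M lborel)" for i :: int
        by (rule measurable_compose[OF measurable_fst meas[OF c]])
      show "(\<lambda>p. \<lfloor>snd p * real (Suc n)\<rfloor>) \<in> M \<Otimes>\<^sub>M lborel \<rightarrow>\<^sub>M count_space UNIV" by measurable
    qed
    then show ?thesis by (simp add: f_def case_prod_unfold)
  qed
  have "(\<lambda>n. f n p) \<longlonglongrightarrow> (case p of (\<omega>, t) \<Rightarrow> X \<omega> (c t))" if "p \<in> space (M \<Otimes>\<^sub>M lborel)" for p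
  proof -
    obtain \<omega> t where p: "p = (\<omega>, t)" by (cases p)
    have \<omega>: "\<omega> \<in> space M" using that p by (simp add: space_pair_measure)
    have "(\<lambda>n. of_int \<lfloor>t * real (Suc n)\<rfloor> / real (Suc n) - t) \<longlonglongrightarrow> 0"
    proof (rule Lim_null_comparison)
      show "(\<lambda>n. inverse (real (Suc n))) \<longlonglongrightarrow> 0" by (rule LIMSEQ_inverse_real_of_nat)
      have "\<bar>of_int \<lfloor>t * N\<rfloor> / N - t\<bar> \<le> inverse N" if "N > 0" for N :: real
      proof -
        have "of_int \<lfloor>t * N\<rfloor> / N - t = (of_int \<lfloor>t * N\<rfloor> - t * N) / N" using that by (simp add: field_simps)
        moreover have "\<bar>of_int \<lfloor>t * N\<rfloor> - t * N\<bar> \<le> 1" using floor_correct[of "t * N"] by linarith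
        ultimately show ?thesis using that by (simp add: abs_div_pos inverse_eq_divide divide_right_mono)
      qed
      then show "\<forall>\<^sub>F n in sequentially. norm (of_int \<lfloor>t * real (Suc n)\<rfloor> / real (Suc n) - t) \<le> inverse (real (Suc n))"
        by (intro always_eventually allI) (simp only: real_norm_def of_nat_0_less_iff zero_less_Suc)
    qed
    then have lim: "(\<lambda>n. of_int \<lfloor>t * real (Suc n)\<rfloor> / real (Suc n)) \<longlonglongrightarrow> t" by (rule LIM_zero_cancel)
    have cl: "(\<lambda>n. c (of_int \<lfloor>t * real (Suc n)\<rfloor> / real (Suc n))) \<longlonglongrightarrow> c t"
      unfolding c_def by (intro tendsto_max tendsto_min tendsto_const lim)
    have "(\<lambda>n. X \<omega> (c (of_int \<lfloor>t * real (Suc n)\<rfloor> / real (Suc n)))) \<longlonglongrightarrow> X \<omega> (c t)"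
      by (rule continuous_on_tendsto_compose[OF cont[OF \<omega>] cl c]) (simp only: c always_eventually simp_thms)
    then show ?thesis by (simp only: p f_def case_prod_conv)
  qed
  then have "(\<lambda>p. case p of (\<omega>, t) \<Rightarrow> X \<omega> (c t)) \<in> borel_measurable (M \<Otimes>\<^sub>M lborel)"
    by (rule borel_measurable_LIMSEQ_real[OF _ fm])
  then show ?thesis by (simp add: c_def)
qed

section \<open>The bridge\<close>

text \<open>The bridge in the rescaled variable, used with L = \<epsilon>^(-\<gamma>): the
  covariance prefactor becomes \<epsilon>, so that \<gamma> enters through the length of the
  interval alone.\<close>

locale scaled_bridge = prob_space M for M :: "'w measure" +
  fixes W :: "'w \<Rightarrow> real \<Rightarrow> real" and \<epsilon> L :: real
  assumes eps: "\<epsilon> > 0" and L: "L > 0"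
    and paths: "\<And>\<omega>. \<omega> \<in> space M \<Longrightarrow> continuous_on {-L..L} (W \<omega>)"
    and gauss: "gaussian_process M {-L..L} W"
    and mean: "\<And>t. t \<in> {-L..L} \<Longrightarrow> expectation (\<lambda>\<omega>. W \<omega> t) = t / L"
    and cov: "\<And>s t. s \<in> {-L..L} \<Longrightarrow> t \<in> {-L..L} \<Longrightarrow>
      covariance M (\<lambda>\<omega>. W \<omega> s) (\<lambda>\<omega>. W \<omega> t) = \<epsilon> * (min s t + L - (s + L) * (t + L) / (2 * L))"
begin

text \<open>The linear span of the values of the process. All its members are Gaussian, which is
  joint Gaussianity; deviations, coefficients and their combinations are handled through
  membership.\<close>

definition lin :: "('w \<Rightarrow> real) set" where
  "lin = {X. \<exists>J c. finite J \<and> J \<subseteq> {-L..L} \<and> X = (\<lambda>\<omega>. \<Sum>s\<in>J. c s * W \<omega> s)}"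

lemma lin_W: "t \<in> {-L..L} \<Longrightarrow> (\<lambda>\<omega>. W \<omega> t) \<in> lin"
  unfolding lin_def by (rule CollectI, rule exI[of _ "{t}"], rule exI[of _ "\<lambda>_. 1"]) auto

lemma lin_add:
  assumes "X \<in> lin" "Y \<in> lin" shows "(\<lambda>\<omega>. X \<omega> + Y \<omega>) \<in> lin"
proof -
  obtain J c where J: "finite J" "J \<subseteq> {-L..L}" "X = (\<lambda>\<omega>. \<Sum>s\<in>J. c s * W \<omega> s)" using assms(1) unfolding lin_def by blast
  obtain I d where I: "finite I" "I \<subseteq> {-L..L}" "Y = (\<lambda>\<omega>. \<Sum>s\<in>I. d s * W \<omega> s)" using assms(2) unfolding lin_def by blast
  define e where "e s = (if s \<in> J then c s else 0) + (if s \<in> I then d s else 0)" for s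
  have "X \<omega> + Y \<omega> = (\<Sum>s\<in>J \<union> I. e s * W \<omega> s)" for \<omega>
  proof -
    have "X \<omega> = (\<Sum>s\<in>J \<union> I. (if s \<in> J then c s else 0) * W \<omega> s)"
      unfolding J(3) using J I by (intro sum.mono_neutral_cong_left) auto
    moreover have "Y \<omega> = (\<Sum>s\<in>J \<union> I. (if s \<in> I then d s else 0) * W \<omega> s)"
      unfolding I(3) using J I by (intro sum.mono_neutral_cong_left) auto
    ultimately show ?thesis by (simp add: e_def distrib_right sum.distrib)
  qed
  then show ?thesis unfolding lin_def using J I by (intro CollectI exI[of _ "J \<union> I"] exI[of _ e]) auto
qed

lemma lin_scale:
  assumes "X \<in> lin" shows "(\<lambda>\<omega>. a * X \<omega>) \<in> lin"
proof -
  obtain J c where J: "finite J" "J \<subseteq> {-L..L}" "X = (\<lambda>\<omega>. \<Sum>s\<in>J. c s * W \<omega> s)" using assms(1) unfolding lin_def by blast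
  then show ?thesis unfolding lin_def
    by (intro CollectI exI[of _ J] exI[of _ "\<lambda>s. a * c s"]) (auto simp: sum_distrib_left mult.assoc)
qed

lemma lin_zero: "(\<lambda>\<omega>. 0) \<in> lin"
  unfolding lin_def by (rule CollectI, rule exI[of _ "{}"], rule exI[of _ "\<lambda>_. 0"]) auto

lemma lin_sum: "finite K \<Longrightarrow> (\<And>k. k \<in> K \<Longrightarrow> X k \<in> lin) \<Longrightarrow> (\<lambda>\<omega>. \<Sum>k\<in>K. X k \<omega>) \<in> lin"
  by (induction K rule: finite_induct) (auto intro: lin_add lin_zero)

lemma lin_gaussian: "X \<in> lin \<Longrightarrow> gaussian_rv M X"
  using gauss unfolding lin_def gaussian_process_def by blast

lemma lin_measurable: "X \<in> lin \<Longrightarrow> X \<in> borel_measurable M"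
  using lin_gaussian unfolding gaussian_rv_def by blast

lemma lin_integrable:
  assumes "X \<in> lin" shows "integrable M X" "integrable M (\<lambda>\<omega>. (X \<omega>)\<^sup>2)"
  using gaussian_integrable[OF lin_gaussian[OF assms]] by auto

lemma square_integrable_mult:
  fixes X Y :: "'w \<Rightarrow> real"
  assumes [measurable]: "X \<in> borel_measurable M" "Y \<in> borel_measurable M"
    and i: "integrable M (\<lambda>\<omega>. (X \<omega>)\<^sup>2)" "integrable M (\<lambda>\<omega>. (Y \<omega>)\<^sup>2)"
  shows "integrable M (\<lambda>\<omega>. X \<omega> * Y \<omega>)"
proof (rule Bochner_Integration.integrable_bound[OF Bochner_Integration.integrable_add[OF i]])
  have "\<bar>x * y\<bar> \<le> x\<^sup>2 + y\<^sup>2" for x y :: real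
  proof -
    have "2 * (\<bar>x\<bar> * \<bar>y\<bar>) \<le> x\<^sup>2 + y\<^sup>2" using sum_squares_bound[of "\<bar>x\<bar>" "\<bar>y\<bar>"] by simp
    moreover have "0 \<le> \<bar>x\<bar> * \<bar>y\<bar>" by simp
    ultimately show ?thesis unfolding abs_mult by linarith
  qed
  then show "AE \<omega> in M. norm (X \<omega> * Y \<omega>) \<le> norm ((X \<omega>)\<^sup>2 + (Y \<omega>)\<^sup>2)" by simp
qed measurable

definition W0 :: "'w \<Rightarrow> real \<Rightarrow> real" where "W0 \<omega> t = W \<omega> t - t / L"

definition kern :: "real \<Rightarrow> real \<Rightarrow> real" where
  "kern s t = \<epsilon> * (min s t + L - (s + L) * (t + L) / (2 * L))"

lemma W0_measurable: "t \<in> {-L..L} \<Longrightarrow> (\<lambda>\<omega>. W0 \<omega> t) \<in> borel_measurable M"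
  unfolding W0_def using lin_measurable[OF lin_W] by auto

lemma W0_square_integrable: "t \<in> {-L..L} \<Longrightarrow> integrable M (\<lambda>\<omega>. (W0 \<omega> t)\<^sup>2)"
proof -
  assume "t \<in> {-L..L}"
  note i = lin_integrable[OF lin_W[OF this]]
  have "integrable M (\<lambda>\<omega>. (W \<omega> t)\<^sup>2 - 2 * (t / L) * W \<omega> t + (t / L)\<^sup>2)" using i by auto
  moreover have "(\<lambda>\<omega>. (W \<omega> t)\<^sup>2 - 2 * (t / L) * W \<omega> t + (t / L)\<^sup>2) = (\<lambda>\<omega>. (W0 \<omega> t)\<^sup>2)"
    by (simp add: fun_eq_iff W0_def power2_eq_square algebra_simps)
  ultimately show ?thesis by simp
qed

lemma W0_prod_integrable:
  "s \<in> {-L..L} \<Longrightarrow> t \<in> {-L..L} \<Longrightarrow> integrable M (\<lambda>\<omega>. W0 \<omega> s * W0 \<omega> t)"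
  by (intro square_integrable_mult W0_measurable W0_square_integrable)

lemma W0_prod:
  "s \<in> {-L..L} \<Longrightarrow> t \<in> {-L..L} \<Longrightarrow> expectation (\<lambda>\<omega>. W0 \<omega> s * W0 \<omega> t) = kern s t"
  using cov[of s t] by (simp add: covariance_def mean W0_def kern_def)

text \<open>The covariance kernel vanishes on the diagonal at -L and L, which pins the boundary
  values, but only almost surely.\<close>

lemma endpoints: "AE \<omega> in M. W \<omega> (- L) = -1" "AE \<omega> in M. W \<omega> L = 1"
proof -
  have *: "AE \<omega> in M. W0 \<omega> t = 0" if "t \<in> {-L..L}" "kern t t = 0" for t
  proof -
    have "expectation (\<lambda>\<omega>. (W0 \<omega> t)\<^sup>2) = 0" using W0_prod[OF that(1) that(1)] that(2) by (simp add: power2_eq_square)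
    then have "AE \<omega> in M. (W0 \<omega> t)\<^sup>2 = 0"
      using integral_nonneg_eq_0_iff_AE[OF W0_square_integrable[OF that(1)]] by simp
    then show ?thesis by simp
  qed
  have "kern (-L) (-L) = 0" "kern L L = 0" using L by (auto simp: kern_def field_simps)
  then show "AE \<omega> in M. W \<omega> (- L) = -1" "AE \<omega> in M. W \<omega> L = 1"
    using *[of "-L"] *[of L] L by (auto simp: W0_def)
qed

text \<open>The deviation from the chord at the point dividing the cell in proportion \<theta>; as
  \<theta> varies this is itself a Brownian bridge, pinned to 0 at the ends of the cell. The value
  \<theta> = 1/2 gives the Schauder coefficient.\<close>

definition bump :: "real \<Rightarrow> real \<Rightarrow> real \<Rightarrow> 'w \<Rightarrow> real" where
  "bump l r \<theta> \<omega> = W \<omega> ((1 - \<theta>) * l + \<theta> * r) - (1 - \<theta>) * W \<omega> l - \<theta> * W \<omega> r"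

lemma mid_in: "-L \<le> l \<Longrightarrow> l \<le> r \<Longrightarrow> r \<le> L \<Longrightarrow> 0 \<le> \<theta> \<Longrightarrow> \<theta> \<le> 1 \<Longrightarrow> (1 - \<theta>) * l + \<theta> * r \<in> {l..r}" for l r \<theta> :: real
proof -
  assume a: "-L \<le> l" "l \<le> r" "r \<le> L" "0 \<le> \<theta>" "\<theta> \<le> 1"
  have "0 \<le> \<theta> * (r - l)" "0 \<le> (1 - \<theta>) * (r - l)" using a by auto
  then show ?thesis by (auto simp: algebra_simps)
qed

context
  fixes l r \<theta> :: real
  assumes lr: "-L \<le> l" "l \<le> r" "r \<le> L" and th: "0 \<le> \<theta>" "\<theta> \<le> 1"
begin

lemma bump_points: "l \<in> {-L..L}" "r \<in> {-L..L}" "(1 - \<theta>) * l + \<theta> * r \<in> {-L..L}"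
  using lr mid_in[OF lr th] by auto

lemma bump_lin: "bump l r \<theta> \<in> lin"
proof -
  have "(\<lambda>\<omega>. (W \<omega> ((1 - \<theta>) * l + \<theta> * r) + (- (1 - \<theta>)) * W \<omega> l) + (- \<theta>) * W \<omega> r) \<in> lin"
    by (intro lin_add lin_scale lin_W bump_points)
  moreover have "(\<lambda>\<omega>. (W \<omega> ((1 - \<theta>) * l + \<theta> * r) + (- (1 - \<theta>)) * W \<omega> l) + (- \<theta>) * W \<omega> r) = bump l r \<theta>"
    by (simp add: fun_eq_iff bump_def algebra_simps)
  ultimately show ?thesis by simp
qed

lemma bump_W0: "bump l r \<theta> \<omega> = W0 \<omega> ((1 - \<theta>) * l + \<theta> * r) - (1 - \<theta>) * W0 \<omega> l - \<theta> * W0 \<omega> r"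
  using L by (simp add: bump_def W0_def field_simps)

lemma bump_mean: "expectation (bump l r \<theta>) = 0"
  unfolding bump_def[abs_def] using lin_integrable(1)[OF lin_W] bump_points L
  by (simp add: mean field_simps)

text \<open>Apart from the minimum, the covariance is affine in each argument, and an affine
  function does not deviate from its chord.\<close>

lemma bump_W0_prod:
  assumes t: "t \<in> {-L..L}"
  shows "expectation (\<lambda>\<omega>. bump l r \<theta> \<omega> * W0 \<omega> t) =
    \<epsilon> * (min ((1 - \<theta>) * l + \<theta> * r) t - (1 - \<theta>) * min l t - \<theta> * min r t)"
proof -
  define p where "p = (1 - \<theta>) * l + \<theta> * r"
  have "expectation (\<lambda>\<omega>. bump l r \<theta> \<omega> * W0 \<omega> t) =
    expectation (\<lambda>\<omega>. W0 \<omega> p * W0 \<omega> t - (1 - \<theta>) * (W0 \<omega> l * W0 \<omega> t) - \<theta> * (W0 \<omega> r * W0 \<omega> t))"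
    by (intro Bochner_Integration.integral_cong) (auto simp: bump_W0 p_def algebra_simps)
  also have "\<dots> = kern p t - (1 - \<theta>) * kern l t - \<theta> * kern r t"
    using W0_prod_integrable[OF _ t] bump_points t by (simp add: W0_prod p_def)
  also have "\<dots> = \<epsilon> * (min p t - (1 - \<theta>) * min l t - \<theta> * min r t)"
    unfolding kern_def p_def using L by (simp add: field_simps)
  finally show ?thesis by (simp add: p_def)
qed

text \<open>For t outside the open cell, the minimum with t is affine on [l, r] and agrees with its
  chord.\<close>

lemma bump_W0_orthogonal:
  assumes t: "t \<in> {-L..L}" "off l r t"
  shows "expectation (\<lambda>\<omega>. bump l r \<theta> \<omega> * W0 \<omega> t) = 0"
proof -
  have p: "(1 - \<theta>) * l + \<theta> * r \<in> {l..r}" by (rule mid_in[OF lr th])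
  from t(2) have "t \<le> l \<or> r \<le> t" by (simp add: off_def)
  then show ?thesis
  proof
    assume "t \<le> l"
    then have "min ((1 - \<theta>) * l + \<theta> * r) t = t" "min l t = t" "min r t = t" using p lr by auto
    then show ?thesis unfolding bump_W0_prod[OF t(1)] by (simp add: algebra_simps)
  next
    assume "r \<le> t"
    then have "min ((1 - \<theta>) * l + \<theta> * r) t = (1 - \<theta>) * l + \<theta> * r" "min l t = l" "min r t = r" using p lr by auto
    then show ?thesis unfolding bump_W0_prod[OF t(1)] by (simp add: algebra_simps)
  qed
qed

lemma bump_W0_integrable: "t \<in> {-L..L} \<Longrightarrow> integrable M (\<lambda>\<omega>. bump l r \<theta> \<omega> * W0 \<omega> t)"
  by (rule square_integrable_mult[OF lin_measurable[OF bump_lin] W0_measurable lin_integrable(2)[OF bump_lin] W0_square_integrable])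

lemma bump_variance: "expectation (\<lambda>\<omega>. (bump l r \<theta> \<omega>)\<^sup>2) = \<epsilon> * \<theta> * (1 - \<theta>) * (r - l)"
proof -
  define p where "p = (1 - \<theta>) * l + \<theta> * r"
  have p: "p \<in> {l..r}" "p \<in> {-L..L}" using mid_in[OF lr th] bump_points by (auto simp: p_def)
  have "expectation (\<lambda>\<omega>. (bump l r \<theta> \<omega>)\<^sup>2) = expectation (\<lambda>\<omega>. bump l r \<theta> \<omega> * W0 \<omega> p
      - (1 - \<theta>) * (bump l r \<theta> \<omega> * W0 \<omega> l) - \<theta> * (bump l r \<theta> \<omega> * W0 \<omega> r))"
  proof (intro Bochner_Integration.integral_cong refl)
    fix \<omega>
    have "(bump l r \<theta> \<omega>)\<^sup>2 = bump l r \<theta> \<omega> * (W0 \<omega> p - (1 - \<theta>) * W0 \<omega> l - \<theta> * W0 \<omega> r)"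
      by (simp only: power2_eq_square p_def flip: bump_W0)
    then show "(bump l r \<theta> \<omega>)\<^sup>2 = bump l r \<theta> \<omega> * W0 \<omega> p
      - (1 - \<theta>) * (bump l r \<theta> \<omega> * W0 \<omega> l) - \<theta> * (bump l r \<theta> \<omega> * W0 \<omega> r)"
      by (simp add: algebra_simps)
  qed
  also have "\<dots> = expectation (\<lambda>\<omega>. bump l r \<theta> \<omega> * W0 \<omega> p) - (1 - \<theta>) * 0 - \<theta> * 0"
    using bump_W0_integrable p(2) bump_points(1,2) bump_W0_orthogonal[of l] bump_W0_orthogonal[of r]
    by (simp add: off_def)
  also have "expectation (\<lambda>\<omega>. bump l r \<theta> \<omega> * W0 \<omega> p) = \<epsilon> * (p - (1 - \<theta>) * l - \<theta> * p)"
    using bump_W0_prod[OF p(2)] p(1) by (simp add: p_def[symmetric] min_absorb1 min_absorb2)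
  also have "p - (1 - \<theta>) * l - \<theta> * p = \<theta> * (1 - \<theta>) * (r - l)" by (simp add: p_def algebra_simps)
  finally show ?thesis by simp
qed

end

lemma bump_orthogonal:
  assumes lr: "-L \<le> l" "l \<le> r" "r \<le> L" and th: "0 \<le> \<theta>" "\<theta> \<le> 1"
    and lr': "-L \<le> l'" "l' \<le> r'" "r' \<le> L" and th': "0 \<le> \<theta>'" "\<theta>' \<le> 1"
    and o: "off l r l'" "off l r ((1 - \<theta>') * l' + \<theta>' * r')" "off l r r'"
  shows "expectation (\<lambda>\<omega>. bump l r \<theta> \<omega> * bump l' r' \<theta>' \<omega>) = 0"
proof -
  define p where "p = (1 - \<theta>') * l' + \<theta>' * r'"
  note pts = bump_points[OF lr' th', folded p_def]
  have "expectation (\<lambda>\<omega>. bump l r \<theta> \<omega> * bump l' r' \<theta>' \<omega>) = expectation (\<lambda>\<omega>. bump l r \<theta> \<omega> * W0 \<omega> p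
      - (1 - \<theta>') * (bump l r \<theta> \<omega> * W0 \<omega> l') - \<theta>' * (bump l r \<theta> \<omega> * W0 \<omega> r'))"
    by (intro Bochner_Integration.integral_cong refl) (simp add: bump_W0[OF lr' th'] p_def algebra_simps)
  also have "\<dots> = 0"
    using bump_W0_integrable[OF lr th] pts bump_W0_orthogonal[OF lr th] o by (simp add: p_def[symmetric])
  finally show ?thesis .
qed

lemma orthogonal_family:
  fixes X :: "'i \<Rightarrow> 'w \<Rightarrow> real"
  assumes K: "finite K" and X: "\<And>i. i \<in> K \<Longrightarrow> X i \<in> lin" and mX: "\<And>i. i \<in> K \<Longrightarrow> expectation (X i) = 0"
    and orth: "\<And>i j. i \<in> K \<Longrightarrow> j \<in> K \<Longrightarrow> i \<noteq> j \<Longrightarrow> expectation (\<lambda>\<omega>. X i \<omega> * X j \<omega>) = 0"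
  shows "(\<lambda>\<omega>. \<Sum>i\<in>K. c i * X i \<omega>) \<in> lin" "expectation (\<lambda>\<omega>. \<Sum>i\<in>K. c i * X i \<omega>) = 0"
    "expectation (\<lambda>\<omega>. (\<Sum>i\<in>K. c i * X i \<omega>)\<^sup>2) = (\<Sum>i\<in>K. (c i)\<^sup>2 * expectation (\<lambda>\<omega>. (X i \<omega>)\<^sup>2))"
proof -
  show "(\<lambda>\<omega>. \<Sum>i\<in>K. c i * X i \<omega>) \<in> lin" by (intro lin_sum lin_scale K X)
  show "expectation (\<lambda>\<omega>. \<Sum>i\<in>K. c i * X i \<omega>) = 0"
    using lin_integrable(1)[OF X] mX by (subst Bochner_Integration.integral_sum) auto
  have ip: "integrable M (\<lambda>\<omega>. X i \<omega> * X j \<omega>)" if "i \<in> K" "j \<in> K" for i j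
    using that by (intro square_integrable_mult lin_measurable lin_integrable X)
  have "expectation (\<lambda>\<omega>. (\<Sum>i\<in>K. c i * X i \<omega>)\<^sup>2) = expectation (\<lambda>\<omega>. \<Sum>i\<in>K. \<Sum>j\<in>K. c i * c j * (X i \<omega> * X j \<omega>))"
    by (intro Bochner_Integration.integral_cong refl) (simp add: power2_eq_square sum_product mult_ac)
  also have "\<dots> = (\<Sum>i\<in>K. \<Sum>j\<in>K. c i * c j * expectation (\<lambda>\<omega>. X i \<omega> * X j \<omega>))"
    using ip by (simp add: Bochner_Integration.integral_sum)
  also have "\<dots> = (\<Sum>i\<in>K. \<Sum>j\<in>K. if i = j then (c i)\<^sup>2 * expectation (\<lambda>\<omega>. (X i \<omega>)\<^sup>2) else 0)"
    using orth by (intro sum.cong refl) (auto simp: power2_eq_square)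
  also have "\<dots> = (\<Sum>i\<in>K. (c i)\<^sup>2 * expectation (\<lambda>\<omega>. (X i \<omega>)\<^sup>2))"
    using K by (simp add: sum.delta)
  finally show "expectation (\<lambda>\<omega>. (\<Sum>i\<in>K. c i * X i \<omega>)\<^sup>2) = (\<Sum>i\<in>K. (c i)\<^sup>2 * expectation (\<lambda>\<omega>. (X i \<omega>)\<^sup>2))" .
qed

section \<open>Schauder coefficients of the bridge\<close>

abbreviation dyads :: "nat \<Rightarrow> (nat \<times> nat) set" where "dyads J \<equiv> Sigma {..<J} (\<lambda>j. {..<2 ^ j})"

definition coef :: "nat \<times> nat \<Rightarrow> 'w \<Rightarrow> real" where
  "coef i \<omega> = second_diff L (W \<omega>) (fst i) (snd i)"

text \<open>The root of \<open>bump_variance\<close> at \<theta> = 1/2 on a cell of length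
  \<open>2 * L / 2 ^ j\<close>.\<close>

definition sd :: "nat \<Rightarrow> real" where "sd j = sqrt (\<epsilon> * L / (2 * 2 ^ j))"

lemma sd_pos: "sd j > 0" using eps L by (simp add: sd_def)

lemma sd_sq: "(sd j)\<^sup>2 = \<epsilon> * L / (2 * 2 ^ j)" using eps L by (simp add: sd_def)

lemma cell_bounds:
  assumes "k < 2 ^ j"
  shows "- L \<le> dyadic L j k" "dyadic L j k \<le> dyadic L j (k + 1)" "dyadic L j (k + 1) \<le> L"
  using dyadic_bounds[OF L, of k j] dyadic_bounds[OF L, of "k + 1" j] dyadic_mono[OF L, of k "k + 1" j] assms by auto

lemma coef_bump: "coef (j, k) = bump (dyadic L j k) (dyadic L j (k + 1)) (1/2)"
proof
  fix \<omega>
  have "dyadic L (Suc j) (2 * k + 1) = (1 - 1/2) * dyadic L j k + 1/2 * dyadic L j (k + 1)"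
    unfolding dyadic_mid by simp
  then show "coef (j, k) \<omega> = bump (dyadic L j k) (dyadic L j (k + 1)) (1/2) \<omega>"
    by (simp only: coef_def second_diff_def bump_def fst_conv snd_conv) (simp add: add_divide_distrib)
qed

text \<open>The finer coefficient, written first in the product, is tested against the three nodes
  of the coarser one, all of which lie outside the open finer cell.\<close>

lemma dyad_off:
  assumes "i \<noteq> i'" "fst i \<le> fst i'" and that: "snd i < 2 ^ fst i" "snd i' < 2 ^ fst i'"
  shows "expectation (\<lambda>\<omega>. coef i' \<omega> * coef i \<omega>) = 0"
proof -
  obtain j k j' k' where i: "i = (j, k)" "i' = (j', k')" by (cases i, cases i')
  have mid: "(1 - 1/2) * dyadic L j k + 1/2 * dyadic L j (k + 1) = dyadic L (Suc j) (2 * k + 1)"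
    unfolding dyadic_mid by simp
  show ?thesis unfolding i coef_bump
    by (rule bump_orthogonal; (unfold mid)?; (rule cell_bounds dyadic_cells_separated[OF L])?)
      (use assms that in \<open>auto simp: i\<close>)
qed

lemma coef_orthogonal:
  assumes "i \<in> dyads J" "i' \<in> dyads J" "i \<noteq> i'"
  shows "expectation (\<lambda>\<omega>. coef i \<omega> * coef i' \<omega>) = 0"
  using dyad_off[of i i'] dyad_off[of i' i] assms
  by (cases "fst i \<le> fst i'") (auto simp: mult.commute)

lemma coef_facts:
  assumes "i \<in> dyads J"
  shows "coef i \<in> lin" "expectation (coef i) = 0" "expectation (\<lambda>\<omega>. (coef i \<omega>)\<^sup>2) = (sd (fst i))\<^sup>2"
proof -
  obtain j k where i: "i = (j, k)" and k: "k < 2 ^ j" using assms by (cases i) auto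
  show "coef i \<in> lin" unfolding i coef_bump by (intro bump_lin cell_bounds k) auto
  show "expectation (coef i) = 0" unfolding i coef_bump by (intro bump_mean cell_bounds k) auto
  show "expectation (\<lambda>\<omega>. (coef i \<omega>)\<^sup>2) = (sd (fst i))\<^sup>2"
    unfolding i coef_bump
    by (subst bump_variance) (use cell_bounds[OF k] in \<open>auto simp: sd_sq dyadic_step[simplified] field_simps\<close>)
qed

definition ncoef :: "nat \<times> nat \<Rightarrow> 'w \<Rightarrow> real" where "ncoef i \<omega> = coef i \<omega> / sd (fst i)"

lemma ncoef_facts:
  assumes "i \<in> dyads J"
  shows "ncoef i \<in> lin" "expectation (ncoef i) = 0" "expectation (\<lambda>\<omega>. (ncoef i \<omega>)\<^sup>2) = 1"
proof -
  show "ncoef i \<in> lin" using lin_scale[OF coef_facts(1)[OF assms], of "1 / sd (fst i)"] by (simp add: ncoef_def[abs_def])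
  show "expectation (ncoef i) = 0" using coef_facts(2)[OF assms] by (simp add: ncoef_def[abs_def])
  show "expectation (\<lambda>\<omega>. (ncoef i \<omega>)\<^sup>2) = 1"
    using coef_facts(3)[OF assms] sd_pos[of "fst i"] by (simp add: ncoef_def[abs_def] power_divide)
qed

lemma ncoef_orthogonal:
  assumes "i \<in> dyads J" "i' \<in> dyads J" "i \<noteq> i'"
  shows "expectation (\<lambda>\<omega>. ncoef i \<omega> * ncoef i' \<omega>) = 0"
  using coef_orthogonal[OF assms] by (simp add: ncoef_def)

lemma finite_dyads: "finite (dyads J)" by simp

lemma card_dyads: "card (dyads J) \<le> 2 ^ J"
proof -
  have "card (dyads J) = (\<Sum>j<J. 2 ^ j)" by (simp add: card_SigmaI)
  also have "\<dots> = 2 ^ J - 1" by (induction J) auto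
  finally show ?thesis by simp
qed

lemma ncoef_comb:
  "(\<lambda>\<omega>. \<Sum>i\<in>dyads J. c i * ncoef i \<omega>) \<in> lin" "expectation (\<lambda>\<omega>. \<Sum>i\<in>dyads J. c i * ncoef i \<omega>) = 0"
  "expectation (\<lambda>\<omega>. (\<Sum>i\<in>dyads J. c i * ncoef i \<omega>)\<^sup>2) = (\<Sum>i\<in>dyads J. (c i)\<^sup>2)"
  using orthogonal_family[OF finite_dyads, of J ncoef c] ncoef_facts ncoef_orthogonal
  by (auto simp del: mem_Sigma_iff)

text \<open>Division by \<open>sd\<close> gives all squares the same weight 1/2. For the bridge they
  are squares of standard normals, and the chord term is the constant 1 / (L \<epsilon>).\<close>

lemma energy_coef:
  "energy L J x / \<epsilon> = (x L - x (- L))\<^sup>2 / (4 * L * \<epsilon>)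
     + (\<Sum>i\<in>dyads J. (second_diff L x (fst i) (snd i) / sd (fst i))\<^sup>2) / 2"
proof -
  have "(\<Sum>i\<in>dyads J. (second_diff L x (fst i) (snd i) / sd (fst i))\<^sup>2) = (\<Sum>j<J. \<Sum>k<2 ^ j. (second_diff L x j k / sd j)\<^sup>2)"
    by (subst sum.Sigma) (auto simp: case_prod_unfold)
  also have "\<dots> / 2 = (\<Sum>j<J. \<Sum>k<2 ^ j. (second_diff L x j k)\<^sup>2 * 2 ^ j / L) / \<epsilon>"
    unfolding sum_divide_distrib
    by (intro sum.cong refl) (simp add: power_divide sd_sq)
  finally show ?thesis unfolding energy_eq[OF L] by (simp add: add_divide_distrib)
qed

lemma energy_exponential_moment:
  assumes a: "0 \<le> a" "a < 1"
  shows "(\<integral>\<^sup>+\<omega>. ennreal (exp (a * energy L J (W \<omega>) / \<epsilon>)) \<partial>M)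
    \<le> ennreal (exp (1 / (L * \<epsilon>)) * (1 / sqrt (1 - a)) ^ (2 ^ J))"
proof -
  have "(\<integral>\<^sup>+\<omega>. ennreal (exp (a * energy L J (W \<omega>) / \<epsilon>)) \<partial>M)
    = (\<integral>\<^sup>+\<omega>. ennreal (exp (a / (L * \<epsilon>))) * ennreal (exp (a / 2 * (\<Sum>i\<in>dyads J. (ncoef i \<omega>)\<^sup>2))) \<partial>M)"
  proof (rule nn_integral_cong_AE)
    show "AE \<omega> in M. ennreal (exp (a * energy L J (W \<omega>) / \<epsilon>)) =
      ennreal (exp (a / (L * \<epsilon>))) * ennreal (exp (a / 2 * (\<Sum>i\<in>dyads J. (ncoef i \<omega>)\<^sup>2)))"
      using endpoints
    proof eventually_elim
      case (elim \<omega>)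
      have "a * energy L J (W \<omega>) / \<epsilon> = a * (energy L J (W \<omega>) / \<epsilon>)" by simp
      also have "\<dots> = a / (L * \<epsilon>) + a / 2 * (\<Sum>i\<in>dyads J. (ncoef i \<omega>)\<^sup>2)"
        unfolding energy_coef elim by (simp add: algebra_simps ncoef_def coef_def)
      finally show ?case by (simp add: exp_add ennreal_mult)
    qed
  qed
  also have "\<dots> = ennreal (exp (a / (L * \<epsilon>))) * (\<integral>\<^sup>+\<omega>. ennreal (exp (a / 2 * (\<Sum>i\<in>dyads J. (ncoef i \<omega>)\<^sup>2))) \<partial>M)"
    using lin_measurable[OF ncoef_facts(1)] by (intro nn_integral_cmult) (auto simp del: mem_Sigma_iff)
  also have "\<dots> \<le> ennreal (exp (1 / (L * \<epsilon>))) * ennreal ((1 / sqrt (1 - a)) ^ (2 ^ J))"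
  proof (rule mult_mono)
    show "ennreal (exp (a / (L * \<epsilon>))) \<le> ennreal (exp (1 / (L * \<epsilon>)))"
      using a L eps by (intro ennreal_leI) (simp add: divide_right_mono)
    have "(\<integral>\<^sup>+\<omega>. ennreal (exp (a / 2 * (\<Sum>i\<in>dyads J. (ncoef i \<omega>)\<^sup>2))) \<partial>M) \<le> ennreal ((1 / sqrt (1 - a)) ^ card (dyads J))"
    proof (rule square_exponential_moment[OF finite_dyads _ _ a])
      show "ncoef i \<in> borel_measurable M" if "i \<in> dyads J" for i by (rule lin_measurable[OF ncoef_facts(1)[OF that]])
      show "(\<integral>\<^sup>+\<omega>. ennreal (exp (\<Sum>i\<in>dyads J. c i * ncoef i \<omega>)) \<partial>M) \<le> ennreal (exp ((\<Sum>i\<in>dyads J. (c i)\<^sup>2) / 2))" for c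
        using gaussian_mgf[OF lin_gaussian[OF ncoef_comb(1)] ncoef_comb(2), of c J] by (simp add: ncoef_comb(3))
    qed
    also have "\<dots> \<le> ennreal ((1 / sqrt (1 - a)) ^ (2 ^ J))"
      using a by (intro ennreal_leI power_increasing card_dyads) (auto simp: field_simps)
    finally show "(\<integral>\<^sup>+\<omega>. ennreal (exp (a / 2 * (\<Sum>i\<in>dyads J. (ncoef i \<omega>)\<^sup>2))) \<partial>M) \<le> ennreal ((1 / sqrt (1 - a)) ^ (2 ^ J))" .
  qed auto
  also have "\<dots> = ennreal (exp (1 / (L * \<epsilon>)) * (1 / sqrt (1 - a)) ^ (2 ^ J))"
    using a by (simp add: ennreal_mult)
  finally show ?thesis .
qed

lemma ncoef_prob:
  assumes i: "i \<in> dyads J" and B: "B \<in> sets borel"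
  shows "prob (ncoef i -` B \<inter> space M) = measure std_normal_distribution B"
  using lin_gaussian[OF ncoef_facts(1)[OF i]] ncoef_facts(2)[OF i]
proof (cases rule: gaussian_centered_cases)
  case (pos \<sigma>)
  have "\<sigma> = 1" using pos(1,3) ncoef_facts(3)[OF i] by (metis abs_of_pos one_power2 power2_abs power2_eq_iff_nonneg less_imp_le zero_le_one)
  then have D: "distributed M lborel (ncoef i) std_normal_density" using pos by simp
  have "distr M borel (ncoef i) = std_normal_distribution"
    using distributed_distr_eq_density[OF D] by (simp cong: distr_cong)
  then have "measure (distr M borel (ncoef i)) B = measure std_normal_distribution B" by simp
  then show ?thesis using lin_measurable[OF ncoef_facts(1)[OF i]] B by (simp add: measure_distr)
next
  case zero
  have "expectation (\<lambda>\<omega>. (ncoef i \<omega>)\<^sup>2) = expectation (\<lambda>_. 0)"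
    by (rule integral_cong_AE) (use zero lin_measurable[OF ncoef_facts(1)[OF i]] in auto)
  then show ?thesis using ncoef_facts(3)[OF i] by simp
qed

lemma ncoef_independent:
  assumes B: "\<And>i. i \<in> dyads J \<Longrightarrow> B i \<in> sets borel"
  shows "prob {\<omega> \<in> space M. \<forall>i\<in>dyads J. ncoef i \<omega> \<in> B i} = (\<Prod>i\<in>dyads J. measure std_normal_distribution (B i))"
proof -
  have "prob {\<omega> \<in> space M. \<forall>i\<in>dyads J. ncoef i \<omega> \<in> B i} = (\<Prod>i\<in>dyads J. prob (ncoef i -` B i \<inter> space M))"
  proof (rule standard_gaussian_family_independent[OF finite_dyads _ _ B])
    show "ncoef i \<in> borel_measurable M" if "i \<in> dyads J" for i by (rule lin_measurable[OF ncoef_facts(1)[OF that]])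
    show "(CLINT x|M. iexp (\<Sum>i\<in>dyads J. t i * ncoef i x)) = of_real (exp (- (\<Sum>i\<in>dyads J. (t i)\<^sup>2) / 2))" for t
      using gaussian_char[OF lin_gaussian[OF ncoef_comb(1)] ncoef_comb(2), of t J] by (simp only: ncoef_comb(3))
  qed
  also have "\<dots> = (\<Prod>i\<in>dyads J. measure std_normal_distribution (B i))"
    by (intro prod.cong refl ncoef_prob B)
  finally show ?thesis .
qed

section \<open>Probability of a tube around a profile\<close>

definition coef_tube :: "(real \<Rightarrow> real) \<Rightarrow> (nat \<Rightarrow> real) \<Rightarrow> nat \<Rightarrow> 'w set" where
  "coef_tube h A J = {\<omega> \<in> space M. \<forall>i\<in>dyads J. \<bar>coef i \<omega> - second_diff L h (fst i) (snd i)\<bar> \<le> A (fst i)}"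

lemma coef_tube_measurable: "coef_tube h A J \<in> sets M"
proof -
  have "{\<omega> \<in> space M. \<bar>coef i \<omega> - second_diff L h (fst i) (snd i)\<bar> \<le> A (fst i)} \<in> sets M" if "i \<in> dyads J" for i
  proof -
    have [measurable]: "coef i \<in> borel_measurable M" by (rule lin_measurable[OF coef_facts(1)[OF that]])
    show ?thesis by measurable
  qed
  then have "{\<omega> \<in> space M. \<forall>i\<in>dyads J. \<bar>coef i \<omega> - second_diff L h (fst i) (snd i)\<bar> \<le> A (fst i)} \<in> sets M"
    by (intro sets.sets_Collect_finite_All finite_dyads)
  then show ?thesis by (simp only: coef_tube_def)
qed

text \<open>Shifting the interval of a coefficient by d costs exp (- d^2 / 2); over all cells these
  factors multiply to at least exp (- energy / \<epsilon>), the Cameron-Martin weight of h. What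
  remains are centred small balls of radius A / sd, with 2^j cells at level j.\<close>

lemma coef_tube_prob:
  assumes A: "\<And>j. A j > 0"
    and C: "\<And>u. u > 0 \<Longrightarrow> exp (- C / u ^ 4) \<le> measure std_normal_distribution {-u..u}"
  shows "exp (- energy L J h / \<epsilon> - C * (\<Sum>j<J. 2 ^ j * (sd j / A j) ^ 4)) \<le> prob (coef_tube h A J)"
proof -
  define d where "d i = second_diff L h (fst i) (snd i) / sd (fst i)" for i
  define u where "u i = A (fst i) / sd (fst i)" for i :: "nat \<times> nat"
  have u: "u i > 0" for i using A sd_pos by (simp add: u_def)
  have eq: "coef_tube h A J = {\<omega> \<in> space M. \<forall>i\<in>dyads J. ncoef i \<omega> \<in> {d i - u i..d i + u i}}"
  proof -
    have "\<bar>c - e\<bar> \<le> a \<longleftrightarrow> c / s \<in> {e / s - a / s..e / s + a / s}" if "s > 0" for c e a s :: real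
    proof -
      have "\<bar>c - e\<bar> \<le> a \<longleftrightarrow> e - a \<le> c \<and> c \<le> e + a" by auto
      also have "\<dots> \<longleftrightarrow> (e - a) / s \<le> c / s \<and> c / s \<le> (e + a) / s" using that by (simp add: divide_le_cancel)
      finally show ?thesis by (simp add: diff_divide_distrib add_divide_distrib)
    qed
    then show ?thesis unfolding coef_tube_def ncoef_def d_def u_def using sd_pos by blast
  qed
  have "(\<Sum>i\<in>dyads J. (d i)\<^sup>2) / 2 \<le> energy L J h / \<epsilon>"
    unfolding energy_coef d_def using L eps by simp
  have "(\<Sum>i\<in>dyads J. C / u i ^ 4) = C * (\<Sum>j<J. 2 ^ j * (sd j / A j) ^ 4)"
  proof -
    have "(\<Sum>i\<in>dyads J. C / u i ^ 4) = (\<Sum>j<J. \<Sum>k<(2 :: nat) ^ j. C * (sd j / A j) ^ 4)"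
      by (subst sum.Sigma) (auto simp: case_prod_unfold u_def power_divide)
    then show ?thesis by (simp add: sum_distrib_left mult_ac)
  qed
  have "exp (- energy L J h / \<epsilon> - C * (\<Sum>j<J. 2 ^ j * (sd j / A j) ^ 4)) \<le> exp (\<Sum>i\<in>dyads J. - (d i)\<^sup>2 / 2 + - C / u i ^ 4)"
  proof -
    have "(\<Sum>i\<in>dyads J. - (d i)\<^sup>2 / 2 + - C / u i ^ 4) = - ((\<Sum>i\<in>dyads J. (d i)\<^sup>2) / 2) - (\<Sum>i\<in>dyads J. C / u i ^ 4)"
      by (simp only: sum.distrib sum_negf sum_divide_distrib minus_divide_left[symmetric] diff_conv_add_uminus)
    then show ?thesis
      using \<open>(\<Sum>i\<in>dyads J. (d i)\<^sup>2) / 2 \<le> energy L J h / \<epsilon>\<close>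
        \<open>(\<Sum>i\<in>dyads J. C / u i ^ 4) = C * (\<Sum>j<J. 2 ^ j * (sd j / A j) ^ 4)\<close>
      by simp
  qed
  also have "\<dots> = (\<Prod>i\<in>dyads J. exp (- (d i)\<^sup>2 / 2) * exp (- C / u i ^ 4))"
    by (simp only: exp_sum[OF finite_dyads] exp_add)
  also have "\<dots> \<le> (\<Prod>i\<in>dyads J. measure std_normal_distribution {d i - u i..d i + u i})"
  proof (rule prod_mono, intro conjI)
    fix i
    have "exp (- (d i)\<^sup>2 / 2) * exp (- C / u i ^ 4) \<le> exp (- (d i)\<^sup>2 / 2) * measure std_normal_distribution {- u i..u i}"
      by (intro mult_left_mono C u) simp
    also have "\<dots> \<le> measure std_normal_distribution {d i - u i..d i + u i}" by (rule std_normal_shifted_interval[OF u])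
    finally show "exp (- (d i)\<^sup>2 / 2) * exp (- C / u i ^ 4) \<le> measure std_normal_distribution {d i - u i..d i + u i}" .
  qed simp
  also have "\<dots> = prob (coef_tube h A J)" unfolding eq by (rule ncoef_independent[symmetric]) simp
  finally show ?thesis .
qed

lemma tube_prob:
  assumes C: "\<And>u. u > 0 \<Longrightarrow> exp (- C / u ^ 4) \<le> measure std_normal_distribution {-u..u}" and C0: "C > 0"
    and r: "r > 0" and ch: "continuous_on {-L..L} h" and he: "h (- L) = -1" "h L = 1"
    and H: "\<And>J. energy L J h \<le> H"
  shows "\<exists>T\<in>sets M. (\<forall>\<omega>\<in>T. \<forall>t\<in>{-L..L}. \<bar>W \<omega> t - h t\<bar> \<le> 10 * r) \<and>
    exp (- H / \<epsilon> - 2 * C * (\<epsilon> * L)\<^sup>2 / r ^ 4) \<le> prob T"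
proof -
  \<comment> \<open>The ratio 9/10 has to serve two sums. The tolerances add up to at most 10 r, and
    since sd decays like 2^(-j/2), the small-ball cost of level j is proportional to q^j with q =
    (10/9)^4 / 2 = 5000/6561 < 1.\<close>
  define A where "A j = r * (9/10) ^ j" for j :: nat
  have A: "A j > 0" for j using r by (simp add: A_def)
  define T where "T = (\<Inter>J. coef_tube h A J)"
  have Tm: "T \<in> sets M" unfolding T_def using coef_tube_measurable by (intro sets.countable_INT) auto
  have cost: "(\<Sum>j<J. 2 ^ j * (sd j / A j) ^ 4) \<le> 2 * (\<epsilon> * L)\<^sup>2 / r ^ 4" for J
  proof -
    define q where "q = (5000 / 6561 :: real)"
    have "2 ^ j * (sd j / A j) ^ 4 = (\<epsilon> * L)\<^sup>2 / (4 * r ^ 4) * q ^ j" for j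
    proof -
      have "(sd j) ^ 4 = ((sd j)\<^sup>2)\<^sup>2" by simp
      also have "\<dots> = (\<epsilon> * L)\<^sup>2 / (4 * (2 ^ j)\<^sup>2)" unfolding sd_sq by (simp add: power_divide power_mult_distrib)
      finally have 1: "(sd j) ^ 4 = (\<epsilon> * L)\<^sup>2 / (4 * (2 ^ j)\<^sup>2)" .
      have 2: "(A j) ^ 4 = r ^ 4 * (6561 / 10000) ^ j"
        by (simp add: A_def power_mult_distrib power_divide flip: power_mult) (simp add: mult.commute[of j] power_mult)
      have 3: "q ^ j = 1 / (2 ^ j * (6561 / 10000) ^ j)"
        by (simp add: q_def flip: power_mult_distrib power_one_over)
      show ?thesis unfolding power_divide 1 2 3 by (simp add: field_simps power2_eq_square)
    qed
    then have eq: "(\<Sum>j<J. 2 ^ j * (sd j / A j) ^ 4) = (\<epsilon> * L)\<^sup>2 / (4 * r ^ 4) * (\<Sum>j<J. q ^ j)"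
      by (simp only: sum_distrib_left)
    have gp: "(\<Sum>j<J. q ^ j) = (1 - q ^ J) / (1 - q)" by (rule sum_gp_strict[THEN trans]) (simp add: q_def)
    have "(1 - q ^ J) / (1 - q) \<le> 8"
    proof -
      have "1 - q ^ J \<le> 1" by (simp add: q_def)
      then have "(1 - q ^ J) / (1 - q) \<le> 1 / (1 - q)" by (intro divide_right_mono) (simp_all add: q_def)
      also have "\<dots> \<le> 8" by (simp add: q_def)
      finally show ?thesis .
    qed
    then have "(\<Sum>j<J. q ^ j) \<le> 8" by (simp only: gp)
    then have "(\<epsilon> * L)\<^sup>2 / (4 * r ^ 4) * (\<Sum>j<J. q ^ j) \<le> (\<epsilon> * L)\<^sup>2 / (4 * r ^ 4) * 8"
      by (intro mult_left_mono) auto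
    then show ?thesis using eq by simp
  qed
  have "exp (- H / \<epsilon> - 2 * C * (\<epsilon> * L)\<^sup>2 / r ^ 4) \<le> prob (coef_tube h A J)" for J
  proof -
    have "- H / \<epsilon> - 2 * C * (\<epsilon> * L)\<^sup>2 / r ^ 4 \<le> - energy L J h / \<epsilon> - C * (\<Sum>j<J. 2 ^ j * (sd j / A j) ^ 4)"
    proof -
      have "C * (\<Sum>j<J. 2 ^ j * (sd j / A j) ^ 4) \<le> C * (2 * (\<epsilon> * L)\<^sup>2 / r ^ 4)"
        using C0 by (intro mult_left_mono cost) auto
      also have "\<dots> = 2 * C * (\<epsilon> * L)\<^sup>2 / r ^ 4" by simp
      finally have "C * (\<Sum>j<J. 2 ^ j * (sd j / A j) ^ 4) \<le> 2 * C * (\<epsilon> * L)\<^sup>2 / r ^ 4" .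
      moreover have "energy L J h / \<epsilon> \<le> H / \<epsilon>" using H eps by (intro divide_right_mono) auto
      ultimately show ?thesis unfolding minus_divide_left[symmetric] by linarith
    qed
    then show ?thesis using coef_tube_prob[OF A C, of J h] by (meson exp_le_cancel_iff order_trans)
  qed
  moreover have "(\<lambda>J. prob (coef_tube h A J)) \<longlonglongrightarrow> prob T"
    unfolding T_def
  proof (rule finite_Lim_measure_decseq)
    show "range (coef_tube h A) \<subseteq> sets M" using coef_tube_measurable by auto
    show "decseq (coef_tube h A)" unfolding decseq_def coef_tube_def by fastforce
  qed
  ultimately have pT: "exp (- H / \<epsilon> - 2 * C * (\<epsilon> * L)\<^sup>2 / r ^ 4) \<le> prob T"
    by (intro LIMSEQ_le_const) auto
  \<comment> \<open>\<open>dyadic_sup_bound\<close> needs the path to agree with h at both ends,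
    which holds off a null set.\<close>
  obtain N where N: "N \<in> sets M" "prob N = 1" "\<And>\<omega>. \<omega> \<in> N \<Longrightarrow> W \<omega> (- L) = -1 \<and> W \<omega> L = 1"
  proof -
    have [measurable]: "(\<lambda>\<omega>. W \<omega> (- L)) \<in> borel_measurable M" "(\<lambda>\<omega>. W \<omega> L) \<in> borel_measurable M"
      using L by (auto intro!: lin_measurable lin_W)
    define N where "N = {\<omega> \<in> space M. W \<omega> (- L) = -1 \<and> W \<omega> L = 1}"
    have "N \<in> sets M" unfolding N_def by measurable
    moreover have "AE \<omega> in M. W \<omega> (- L) = -1 \<and> W \<omega> L = 1" using endpoints by eventually_elim auto
    then have "prob N = 1" using \<open>N \<in> sets M\<close> unfolding N_def by (simp only: prob_Collect_eq_1)
    moreover have "\<And>\<omega>. \<omega> \<in> N \<Longrightarrow> W \<omega> (- L) = -1 \<and> W \<omega> L = 1" by (simp add: N_def)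
    ultimately show thesis by (rule that)
  qed
  have "prob (T \<inter> N) = prob T"
    using N(1,2) Tm by (simp add: measure_space_inter prob_space)
  moreover have "\<bar>W \<omega> t - h t\<bar> \<le> 10 * r" if \<omega>: "\<omega> \<in> T \<inter> N" and t: "t \<in> {-L..L}" for \<omega> t
  proof (rule dyadic_sup_bound[where L = L and e = "\<lambda>t. W \<omega> t - h t" and A = A])
    have sp: "\<omega> \<in> space M" using \<omega> Tm sets.sets_into_space by blast
    show "continuous_on {-L..L} (\<lambda>t. W \<omega> t - h t)" by (intro continuous_intros paths sp ch)
    show "W \<omega> (- L) - h (- L) = 0" "W \<omega> L - h L = 0" using N(3) \<omega> he by auto
    show "\<bar>second_diff L (\<lambda>t. W \<omega> t - h t) j k\<bar> \<le> A j" if "k < 2 ^ j" for j k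
    proof -
      have "\<omega> \<in> coef_tube h A (Suc j)" using \<omega> by (auto simp: T_def)
      then have "\<bar>coef (j, k) \<omega> - second_diff L h j k\<bar> \<le> A j"
        unfolding coef_tube_def using that by fastforce
      moreover have "second_diff L (\<lambda>t. W \<omega> t - h t) j k = coef (j, k) \<omega> - second_diff L h j k"
        by (simp add: coef_def second_diff_def field_simps)
      ultimately show ?thesis by simp
    qed
    show "(\<Sum>j<J. A j) \<le> 10 * r" for J
    proof -
      have "(\<Sum>j<J. A j) = r * (\<Sum>j<J. (9/10) ^ j)" by (simp add: A_def sum_distrib_left)
      also have "(\<Sum>j<J. (9/10 :: real) ^ j) = (1 - (9/10) ^ J) / (1 - 9/10)" by (rule sum_gp_strict[THEN trans]) simp
      also have "\<dots> \<le> 10" by simp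
      finally show ?thesis using r by simp
    qed
  qed (use L t A in \<open>auto intro: less_imp_le\<close>)
  ultimately show ?thesis using N(1) Tm pT by (intro bexI[of _ "T \<inter> N"]) auto
qed

end

text \<open>Jensen's inequality, from the tangent to the exponential at the mean a.\<close>

lemma exp_integral_le:
  fixes g :: "real \<Rightarrow> real"
  assumes c: "continuous_on {0..1} g"
  shows "ennreal (exp (integral {0..1} g)) \<le> (\<integral>\<^sup>+\<theta>. ennreal (exp (g \<theta>)) * indicator {0..1} \<theta> \<partial>lborel)"
proof -
  define a where "a = integral {0..1} g"
  have ie: "((\<lambda>\<theta>. exp (g \<theta>)) has_integral integral {0..1} (\<lambda>\<theta>. exp (g \<theta>))) {0..1}"
    by (intro integrable_integral integrable_continuous_interval continuous_intros c)
  have ig: "(g has_integral a) {0..1}"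
    unfolding a_def by (intro integrable_integral integrable_continuous_interval c)
  have i1: "((\<lambda>\<theta> :: real. 1 - a) has_integral (1 - a)) {0..1}"
    using has_integral_const_real[of "1 - a" "0 :: real" "1 :: real"] by simp
  have "((\<lambda>\<theta>. exp a * (g \<theta> + (1 - a))) has_integral exp a * (a + (1 - a))) {0..1}"
    by (intro has_integral_mult_right has_integral_add ig i1)
  from has_integral_le[OF this ie] have "exp a \<le> integral {0..1} (\<lambda>\<theta>. exp (g \<theta>))"
  proof -
    have "exp a * (g \<theta> + (1 - a)) \<le> exp (g \<theta>)" for \<theta>
    proof -
      have "exp a * (1 + (g \<theta> - a)) \<le> exp a * exp (g \<theta> - a)" by (intro mult_left_mono exp_ge_add_one_self) auto
      then show ?thesis by (simp add: algebra_simps flip: exp_add)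
    qed
    then show ?thesis using has_integral_le[OF \<open>((\<lambda>\<theta>. exp a * (g \<theta> + (1 - a))) has_integral exp a * (a + (1 - a))) {0..1}\<close> ie] by simp
  qed
  then show ?thesis
    using nn_integral_has_integral_lebesgue'[OF _ ie] by (simp add: a_def ennreal_leI)
qed

section \<open>Tail of the interpolation error\<close>

context scaled_bridge
begin

lemma W_jointly_measurable: "(\<lambda>(\<omega>, t). W \<omega> (max (- L) (min L t))) \<in> borel_measurable (M \<Otimes>\<^sub>M lborel)"
  by (rule continuous_paths_jointly_measurable) (use L paths lin_measurable[OF lin_W] in auto)

lemma cell_bump_moment:
  fixes J :: nat
  assumes \<theta>: "0 \<le> \<theta>" "\<theta> \<le> 1"
  defines "h \<equiv> 2 * L / 2 ^ J"
  shows "(\<integral>\<^sup>+\<omega>. ennreal (exp (\<Sum>k<2 ^ J. (bump (dyadic L J k) (dyadic L J (k + 1)) \<theta> \<omega>)\<^sup>2 / (\<epsilon> * h))) \<partial>M)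
    \<le> ennreal (sqrt 2 ^ 2 ^ J)"
proof -
  define X where "X k = bump (dyadic L J k) (dyadic L J (k + 1)) \<theta>" for k
  \<comment> \<open>Since 4 \<theta> (1 - \<theta>) \<le> 1, the variables s * X k have variance at
    most 1. Taking a = 1/2 in \<open>square_exponential_moment\<close> then gives the exponent s^2 /
    4 = 1 / (\<epsilon> h) and a factor sqrt 2 per cell.\<close>
  define s where "s = 2 / sqrt (\<epsilon> * h)"
  have h: "h > 0" using L by (simp add: h_def)
  have eh: "\<epsilon> * h > 0" using eps h by simp
  have s2: "s\<^sup>2 = 4 / (\<epsilon> * h)" using eh by (simp add: s_def power_divide)
  have Xl: "X k \<in> lin" and X0: "expectation (X k) = 0" and XV: "expectation (\<lambda>\<omega>. (X k \<omega>)\<^sup>2) = \<epsilon> * \<theta> * (1 - \<theta>) * h"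
    if "k \<in> {..<2 ^ J}" for k
  proof -
    have k: "k < 2 ^ J" using that by simp
    show "X k \<in> lin" "expectation (X k) = 0"
      unfolding X_def by (intro bump_lin bump_mean cell_bounds k \<theta>)+
    show "expectation (\<lambda>\<omega>. (X k \<omega>)\<^sup>2) = \<epsilon> * \<theta> * (1 - \<theta>) * h"
      unfolding X_def by (subst bump_variance[OF cell_bounds[OF k] \<theta>]) (simp only: dyadic_step h_def)
  qed
  have orth: "expectation (\<lambda>\<omega>. X i \<omega> * X j \<omega>) = 0" if "i \<in> {..<2 ^ J}" "j \<in> {..<2 ^ J}" "i \<noteq> j" for i j
  proof -
    have ij: "i < 2 ^ J" "j < 2 ^ J" using that by auto
    have pt: "(1 - \<theta>) * dyadic L J j + \<theta> * dyadic L J (j + 1) \<in> {dyadic L J j..dyadic L J (j + 1)}"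
      by (rule mid_in[OF cell_bounds[OF ij(2)] \<theta>])
    have "off (dyadic L J i) (dyadic L J (i + 1)) t" if t: "t \<in> {dyadic L J j..dyadic L J (j + 1)}" for t
    proof (rule linorder_neqE_nat[OF \<open>i \<noteq> j\<close>])
      assume "i < j"
      then show ?thesis using t dyadic_mono[OF L, of "i + 1" j J] by (auto simp: off_def)
    next
      assume "j < i"
      then show ?thesis using t dyadic_mono[OF L, of "j + 1" i J] by (auto simp: off_def)
    qed
    then show ?thesis unfolding X_def
      using pt cell_bounds[OF ij(2)] by (intro bump_orthogonal cell_bounds ij \<theta>) auto
  qed
  have "(\<integral>\<^sup>+\<omega>. ennreal (exp ((1/2) / 2 * (\<Sum>k\<in>{..<2 ^ J}. (s * X k \<omega>)\<^sup>2))) \<partial>M) \<le> ennreal ((1 / sqrt (1 - 1/2)) ^ card {..<2 ^ J :: nat})"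
  proof (rule square_exponential_moment)
    show "(\<lambda>\<omega>. s * X k \<omega>) \<in> borel_measurable M" if "k \<in> {..<2 ^ J}" for k
      by (rule lin_measurable[OF lin_scale[OF Xl[OF that]]])
    fix c :: "nat \<Rightarrow> real"
    have fam1: "(\<lambda>\<omega>. \<Sum>k<2 ^ J. c k * s * X k \<omega>) \<in> lin" "expectation (\<lambda>\<omega>. \<Sum>k<2 ^ J. c k * s * X k \<omega>) = 0"
      "expectation (\<lambda>\<omega>. (\<Sum>k<2 ^ J. c k * s * X k \<omega>)\<^sup>2) = (\<Sum>k<2 ^ J. (c k * s)\<^sup>2 * expectation (\<lambda>\<omega>. (X k \<omega>)\<^sup>2))"
      by (rule orthogonal_family[OF finite_lessThan Xl X0 orth]; assumption)+
    have "expectation (\<lambda>\<omega>. (\<Sum>k<2 ^ J. c k * s * X k \<omega>)\<^sup>2) \<le> (\<Sum>k<2 ^ J. (c k)\<^sup>2)"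
      unfolding fam1(3)
    proof (rule sum_mono)
      fix k assume k: "k \<in> {..<2 ^ J :: nat}"
      have "(c k * s)\<^sup>2 * expectation (\<lambda>\<omega>. (X k \<omega>)\<^sup>2) = (c k)\<^sup>2 * (4 * \<theta> * (1 - \<theta>))"
        unfolding XV[OF k] power_mult_distrib s2 using eps h by (simp add: field_simps)
      also have "4 * \<theta> * (1 - \<theta>) \<le> 1" using zero_le_power2[of "2 * \<theta> - 1"] by (simp add: power2_eq_square algebra_simps)
      then have "(c k)\<^sup>2 * (4 * \<theta> * (1 - \<theta>)) \<le> (c k)\<^sup>2 * 1" by (intro mult_left_mono) auto
      finally show "(c k * s)\<^sup>2 * expectation (\<lambda>\<omega>. (X k \<omega>)\<^sup>2) \<le> (c k)\<^sup>2" by simp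
    qed
    moreover have "(\<integral>\<^sup>+\<omega>. ennreal (exp (\<Sum>k<2 ^ J. c k * s * X k \<omega>)) \<partial>M) = ennreal (exp (expectation (\<lambda>\<omega>. (\<Sum>k<2 ^ J. c k * s * X k \<omega>)\<^sup>2) / 2))"
      by (rule gaussian_mgf[OF lin_gaussian[OF fam1(1)] fam1(2)])
    ultimately show "(\<integral>\<^sup>+\<omega>. ennreal (exp (\<Sum>k<2 ^ J. c k * (s * X k \<omega>))) \<partial>M) \<le> ennreal (exp ((\<Sum>k<2 ^ J. (c k)\<^sup>2) / 2))"
      by (simp add: mult.assoc ennreal_leI)
  qed auto
  moreover have "(1/2) / 2 * (\<Sum>k\<in>{..<2 ^ J}. (s * X k \<omega>)\<^sup>2) = (\<Sum>k<2 ^ J. (X k \<omega>)\<^sup>2 / (\<epsilon> * h))" for \<omega>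
    unfolding sum_distrib_left by (intro sum.cong refl) (simp add: power_mult_distrib s2)
  moreover have "1 / sqrt (1 - 1/2) = sqrt 2" by (simp add: real_sqrt_divide)
  ultimately show ?thesis by (simp add: X_def)
qed

text \<open>The error divided by \<epsilon> h^2 is an average over \<theta> of normalised sums of
  squared deviations. Deviations at different \<theta> are correlated, but Jensen's inequality moves
  the exponential inside the average, where \<open>cell_bump_moment\<close> applies to each \<theta>
  separately; Markov's inequality concludes.\<close>

lemma interp_error_tail:
  fixes J :: nat
  defines "h \<equiv> 2 * L / 2 ^ J"
  shows "\<exists>B\<in>sets M. (\<forall>\<omega>\<in>space M - B. interp_error L J (W \<omega>) < \<eta>) \<and>
    emeasure M B \<le> ennreal (sqrt 2 ^ 2 ^ J * exp (- \<eta> / (\<epsilon> * h\<^sup>2)))"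
proof -
  \<comment> \<open>Clamping makes the integrand jointly measurable in \<omega> and all real
    \<theta>; it is inactive for \<theta> in [0, 1].\<close>
  define cl where "cl t = max (- L) (min L t)" for t
  define G where "G \<omega> \<theta> = (\<Sum>k<2 ^ J. (W \<omega> (cl ((1 - \<theta>) * dyadic L J k + \<theta> * dyadic L J (k + 1)))
     - (1 - \<theta>) * W \<omega> (dyadic L J k) - \<theta> * W \<omega> (dyadic L J (k + 1)))\<^sup>2 / (\<epsilon> * h))" for \<omega> \<theta>
  have h: "h > 0" using L by (simp add: h_def)
  have clp: "cl ((1 - \<theta>) * dyadic L J k + \<theta> * dyadic L J (k + 1)) = (1 - \<theta>) * dyadic L J k + \<theta> * dyadic L J (k + 1)"
    if "k < 2 ^ J" "0 \<le> \<theta>" "\<theta> \<le> 1" for k \<theta>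
    using bump_points(3)[OF cell_bounds[OF that(1)] that(2,3)] by (auto simp: cl_def)
  have Gb: "G \<omega> \<theta> = (\<Sum>k<2 ^ J. (bump (dyadic L J k) (dyadic L J (k + 1)) \<theta> \<omega>)\<^sup>2 / (\<epsilon> * h))" if "0 \<le> \<theta>" "\<theta> \<le> 1" for \<omega> \<theta>
    unfolding G_def bump_def by (intro sum.cong refl) (use clp[OF _ that] in auto)
  have Gm[measurable]: "(\<lambda>(\<omega>, \<theta>). G \<omega> \<theta>) \<in> borel_measurable (M \<Otimes>\<^sub>M lborel)"
  proof -
    have 1: "(\<lambda>p. W (fst p) (cl ((1 - snd p) * d + snd p * e))) \<in> borel_measurable (M \<Otimes>\<^sub>M lborel)" for d e
    proof -
      have "(\<lambda>p. (fst p, (1 - snd p) * d + snd p * e)) \<in> M \<Otimes>\<^sub>M lborel \<rightarrow>\<^sub>M M \<Otimes>\<^sub>M lborel" by measurable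
      from measurable_compose[OF this W_jointly_measurable] show ?thesis by (simp add: cl_def)
    qed
    have 2: "(\<lambda>p. W (fst p) (dyadic L J k)) \<in> borel_measurable (M \<Otimes>\<^sub>M lborel)" if "k \<le> 2 ^ J" for k
      by (rule measurable_compose[OF measurable_fst lin_measurable[OF lin_W]]) (use dyadic_bounds[OF L that] in auto)
    show ?thesis unfolding G_def case_prod_unfold
      by (intro borel_measurable_sum borel_measurable_divide borel_measurable_power borel_measurable_diff
          borel_measurable_times borel_measurable_const 1 2) auto
  qed
  have Gc: "continuous_on {0..1} (G \<omega>)" if \<omega>: "\<omega> \<in> space M" for \<omega>
  proof -
    have "continuous_on {0..1} (\<lambda>\<theta>. W \<omega> (cl ((1 - \<theta>) * d + \<theta> * e)))" for d e
      by (rule continuous_on_compose2[OF paths[OF \<omega>]]) (use L in \<open>auto simp: cl_def intro!: continuous_intros\<close>)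
    then show ?thesis unfolding G_def by (intro continuous_intros) (use eps h in auto)
  qed
  have GI: "integral {0..1} (G \<omega>) = interp_error L J (W \<omega>) / (\<epsilon> * h\<^sup>2)" if \<omega>: "\<omega> \<in> space M" for \<omega>
  proof -
    define f where "f k \<theta> = (W \<omega> ((1 - \<theta>) * dyadic L J k + \<theta> * dyadic L J (k + 1))
     - (1 - \<theta>) * W \<omega> (dyadic L J k) - \<theta> * W \<omega> (dyadic L J (k + 1)))\<^sup>2" for k \<theta>
    have fi: "f k integrable_on {0..1}" if k: "k < 2 ^ J" for k
    proof -
      have "continuous_on {0..1} (\<lambda>\<theta>. W \<omega> ((1 - \<theta>) * dyadic L J k + \<theta> * dyadic L J (k + 1)))"
        by (rule continuous_on_compose2[OF paths[OF \<omega>]])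
          (use bump_points(3)[OF cell_bounds[OF k]] in \<open>auto intro!: continuous_intros\<close>)
      then show ?thesis unfolding f_def by (intro integrable_continuous_interval continuous_intros)
    qed
    have "integral {0..1} (G \<omega>) = integral {0..1} (\<lambda>\<theta>. \<Sum>k<2 ^ J. f k \<theta> * (1 / (\<epsilon> * h)))"
    proof (rule integral_cong)
      fix \<theta> :: real assume "\<theta> \<in> {0..1}"
      then have "0 \<le> \<theta>" "\<theta> \<le> 1" by auto
      then show "G \<omega> \<theta> = (\<Sum>k<2 ^ J. f k \<theta> * (1 / (\<epsilon> * h)))"
        unfolding G_def f_def by (intro sum.cong refl) (use clp in auto)
    qed
    also have "\<dots> = (\<Sum>k<2 ^ J. integral {0..1} (\<lambda>\<theta>. f k \<theta> * (1 / (\<epsilon> * h))))"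
    proof (rule integral_sum)
      show "(\<lambda>\<theta>. f k \<theta> * (1 / (\<epsilon> * h))) integrable_on {0..1}" if "k \<in> {..<2 ^ J}" for k
        by (rule integrable_on_mult_left[OF fi]) (use that in simp)
    qed simp
    also have "\<dots> = (\<Sum>k<2 ^ J. h * integral {0..1} (f k) * (1 / (\<epsilon> * h\<^sup>2)))"
      using h by (intro sum.cong refl) (simp add: power2_eq_square)
    also have "\<dots> = interp_error L J (W \<omega>) * (1 / (\<epsilon> * h\<^sup>2))"
      unfolding interp_error_def sum_distrib_right by (simp add: f_def[abs_def] h_def)
    finally show ?thesis by simp
  qed
  define Q where "Q \<omega> = (\<integral>\<^sup>+\<theta>. ennreal (exp (G \<omega> \<theta>)) * indicator {0..1} \<theta> \<partial>lborel)" for \<omega>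
  have Qm[measurable]: "Q \<in> borel_measurable M"
    unfolding Q_def by (rule lborel.borel_measurable_nn_integral) measurable
  have "(\<integral>\<^sup>+\<omega>. Q \<omega> \<partial>M) = (\<integral>\<^sup>+\<theta>. (\<integral>\<^sup>+\<omega>. ennreal (exp (G \<omega> \<theta>)) * indicator {0..1} \<theta> \<partial>M) \<partial>lborel)"
    unfolding Q_def
    by (rule pair_sigma_finite.Fubini'[symmetric])
      (auto intro!: pair_sigma_finite.intro sigma_finite_measure_axioms sigma_finite_lborel)
  also have "\<dots> \<le> (\<integral>\<^sup>+\<theta>. ennreal (sqrt 2 ^ 2 ^ J) * indicator {0..1 :: real} \<theta> \<partial>lborel)"
  proof (rule nn_integral_mono)
    fix \<theta> :: real
    show "(\<integral>\<^sup>+\<omega>. ennreal (exp (G \<omega> \<theta>)) * indicator {0..1} \<theta> \<partial>M) \<le> ennreal (sqrt 2 ^ 2 ^ J) * indicator {0..1} \<theta>"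
    proof (cases "\<theta> \<in> {0..1}")
      case True
      then show ?thesis using cell_bump_moment[of \<theta> J] Gb[of \<theta>] by (simp add: h_def)
    qed simp
  qed
  also have "\<dots> = ennreal (sqrt 2 ^ 2 ^ J)" by (simp add: nn_integral_cmult)
  finally have EQ: "(\<integral>\<^sup>+\<omega>. Q \<omega> \<partial>M) \<le> ennreal (sqrt 2 ^ 2 ^ J)" .
  define c where "c = exp (- \<eta> / (\<epsilon> * h\<^sup>2))"
  \<comment> \<open>The bad set is cut out by Q, which is measurable as a partial integral; by
    Jensen's inequality it contains every path with error at least \<eta>.\<close>
  define B where "B = {\<omega> \<in> space M. 1 \<le> ennreal c * Q \<omega>}"
  have Bm: "B \<in> sets M" unfolding B_def by measurable
  have "emeasure M B \<le> ennreal c * (\<integral>\<^sup>+\<omega>. Q \<omega> * indicator (space M) \<omega> \<partial>M)"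
    using nn_integral_Markov_inequality[of Q "space M" M "ennreal c"] by (simp add: B_def)
  also have "(\<integral>\<^sup>+\<omega>. Q \<omega> * indicator (space M) \<omega> \<partial>M) = (\<integral>\<^sup>+\<omega>. Q \<omega> \<partial>M)"
    by (intro nn_integral_cong) simp
  also have "ennreal c * \<dots> \<le> ennreal c * ennreal (sqrt 2 ^ 2 ^ J)" by (intro mult_left_mono EQ) auto
  also have "\<dots> = ennreal (sqrt 2 ^ 2 ^ J * c)" by (simp add: c_def mult.commute flip: ennreal_mult)
  finally have EB: "emeasure M B \<le> ennreal (sqrt 2 ^ 2 ^ J * c)" .
  have "interp_error L J (W \<omega>) < \<eta>" if \<omega>: "\<omega> \<in> space M - B" for \<omega>
  proof (rule ccontr)
    assume "\<not> interp_error L J (W \<omega>) < \<eta>"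
    then have "\<eta> / (\<epsilon> * h\<^sup>2) \<le> integral {0..1} (G \<omega>)"
      using GI[of \<omega>] \<omega> eps h by (simp add: divide_right_mono)
    then have "ennreal (exp (\<eta> / (\<epsilon> * h\<^sup>2))) \<le> ennreal (exp (integral {0..1} (G \<omega>)))" by (simp add: ennreal_leI)
    also have "\<dots> \<le> Q \<omega>" unfolding Q_def using \<omega> by (intro exp_integral_le Gc) auto
    finally have "ennreal c * ennreal (exp (\<eta> / (\<epsilon> * h\<^sup>2))) \<le> ennreal c * Q \<omega>" by (intro mult_left_mono) auto
    moreover have "ennreal c * ennreal (exp (\<eta> / (\<epsilon> * h\<^sup>2))) = 1"
      by (simp add: c_def flip: ennreal_mult exp_add)
    ultimately show False using \<omega> by (simp add: B_def)
  qed
  then show ?thesis using Bm EB by (auto simp: c_def)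
qed

end

section \<open>Partition function and unnormalised weight of the event\<close>

context drift
begin

text \<open>The kinetic half of the surface tension comes from the probability of a tube about the
  recovery profile, the potential half from the weight of the paths in that tube.\<close>

lemma partition_lower:
  assumes sb: "scaled_bridge M W \<epsilon> L" and q: "q = exp (- k * L)" "q \<le> 1/4"
    and C: "\<And>u. u > 0 \<Longrightarrow> exp (- C / u ^ 4) \<le> measure std_normal_distribution {-u..u}" and C0: "C > 0"
    and r: "r > 0" "10 * r + 3 * q \<le> 1" and \<kappa>: "0 < \<kappa>"
  shows "ennreal (exp (- ((1 + 2 * q)\<^sup>2 * surface_tension / 2
      + ((1 + \<kappa>) * surface_tension / 2 + (1 + 1 / \<kappa>) * K\<^sup>2 * (10 * r + 3 * q)\<^sup>2 * L)) / \<epsilon>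
      - 2 * C * (\<epsilon> * L)\<^sup>2 / r ^ 4))
    \<le> (\<integral>\<^sup>+\<omega>. ennreal (exp (- integral {-L..L} (\<lambda>t. F (W \<omega> t)) / \<epsilon>)) \<partial>M)"
proof -
  interpret sb: scaled_bridge M W \<epsilon> L by (rule sb)
  define H where "H = (1 + 2 * q)\<^sup>2 * surface_tension / 2"
  define V where "V = (1 + \<kappa>) * surface_tension / 2 + (1 + 1 / \<kappa>) * K\<^sup>2 * (10 * r + 3 * q)\<^sup>2 * L"
  define D where "D = 2 * C * (\<epsilon> * L)\<^sup>2 / r ^ 4"
  obtain h where h: "continuous_on {-L..L} h" "h (- L) = -1" "h L = 1" and hH: "\<forall>J. energy L J h \<le> H"
    and pot: "\<forall>x R \<kappa>. continuous_on {-L..L} x \<longrightarrow> (\<forall>t\<in>{-L..L}. \<bar>x t - h t\<bar> \<le> R) \<longrightarrow> R + 3 * q \<le> 1 \<longrightarrow> 0 < \<kappa> \<longrightarrow>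
      integral {-L..L} (\<lambda>s. F (x s)) \<le> (1 + \<kappa>) * surface_tension / 2 + (1 + 1 / \<kappa>) * K\<^sup>2 * (R + 3 * q)\<^sup>2 * L"
    using recovery_profile[OF sb.L q, folded H_def] by (elim exE conjE) (rule that; assumption)
  obtain T where T: "T \<in> sets M" "\<And>\<omega>. \<omega> \<in> T \<Longrightarrow> \<forall>t\<in>{-L..L}. \<bar>W \<omega> t - h t\<bar> \<le> 10 * r"
    and pT: "exp (- H / \<epsilon> - D) \<le> sb.prob T"
    using sb.tube_prob[OF C C0 r(1) h hH[rule_format]] unfolding D_def by blast
  have "ennreal (exp (- (H + V) / \<epsilon> - D)) = ennreal (exp (- V / \<epsilon>)) * ennreal (exp (- H / \<epsilon> - D))"
    by (simp add: add_divide_distrib diff_divide_distrib flip: ennreal_mult exp_add)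
  also have "\<dots> \<le> ennreal (exp (- V / \<epsilon>)) * emeasure M T"
    using pT by (intro mult_left_mono) (auto simp: sb.emeasure_eq_measure ennreal_leI)
  also have "\<dots> = (\<integral>\<^sup>+\<omega>. ennreal (exp (- V / \<epsilon>)) * indicator T \<omega> \<partial>M)"
    using T(1) by (simp add: nn_integral_cmult_indicator)
  also have "\<dots> \<le> (\<integral>\<^sup>+\<omega>. ennreal (exp (- integral {-L..L} (\<lambda>t. F (W \<omega> t)) / \<epsilon>)) \<partial>M)"
  proof (rule nn_integral_mono)
    fix \<omega> assume \<omega>: "\<omega> \<in> space M"
    show "ennreal (exp (- V / \<epsilon>)) * indicator T \<omega> \<le> ennreal (exp (- integral {-L..L} (\<lambda>t. F (W \<omega> t)) / \<epsilon>))"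
    proof (cases "\<omega> \<in> T")
      case True
      have "integral {-L..L} (\<lambda>t. F (W \<omega> t)) \<le> V"
        unfolding V_def using pot sb.paths[OF \<omega>] T(2)[OF True] r(2) \<kappa> by blast
      then have "- V / \<epsilon> \<le> - integral {-L..L} (\<lambda>t. F (W \<omega> t)) / \<epsilon>" using sb.eps by (intro divide_right_mono) auto
      then show ?thesis using True by (simp add: ennreal_leI)
    qed simp
  qed
  finally show ?thesis by (simp add: H_def V_def D_def)
qed

text \<open>Off the bad set \<open>potential_lower\<close> bounds the weight by a constant times exp
  ((1 - \<kappa>) energy / \<epsilon>), whose moment is finite; on the bad set the weight is at most
  1. The far event is not known to be measurable, so it is removed by monotonicity of the
  nonnegative integral.\<close>

lemma numerator_upper:
  "\<exists>c>0. \<exists>d0>0. \<forall>(M :: 'w measure) W \<epsilon> L J \<kappa> \<delta> \<eta>. scaled_bridge M W \<epsilon> L \<longrightarrow> 0 < \<kappa> \<longrightarrow> \<kappa> < 1 \<longrightarrow> 0 < \<delta> \<longrightarrow> \<delta> \<le> d0 \<longrightarrow>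
    \<eta> \<le> \<delta>\<^sup>2 / 4 \<longrightarrow>
    (\<integral>\<^sup>+\<omega>. ennreal (exp (- integral {-L..L} (\<lambda>t. F (W \<omega> t)) / \<epsilon>)) *
       indicator {\<omega>. \<forall>\<xi>. \<delta> \<le> L2norm UNIV (\<lambda>s. (if s < - L then -1 else if s > L then 1 else W \<omega> s) - m (s - \<xi>))} \<omega> \<partial>M)
    \<le> ennreal (exp (- ((1 - \<kappa>) * (surface_tension + c * \<delta>\<^sup>2) - (K + k)\<^sup>2 * \<eta> / (2 * \<kappa>)) / \<epsilon>)
         * (exp (1 / (L * \<epsilon>)) * (1 / sqrt \<kappa>) ^ 2 ^ J)
       + sqrt 2 ^ 2 ^ J * exp (- \<eta> / (\<epsilon> * (2 * L / 2 ^ J)\<^sup>2)))"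
proof -
  obtain c d0 where c: "c > 0" "d0 > 0" and low: "\<forall>L J x \<kappa> \<delta> \<eta>. L > 0 \<longrightarrow> continuous_on {-L..L} x \<longrightarrow> x (- L) = -1 \<longrightarrow> x L = 1 \<longrightarrow>
    0 < \<kappa> \<longrightarrow> \<kappa> < 1 \<longrightarrow> 0 < \<delta> \<longrightarrow> \<delta> \<le> d0 \<longrightarrow> \<eta> \<le> \<delta>\<^sup>2 / 4 \<longrightarrow> interp_error L J x \<le> \<eta> \<longrightarrow>
    (\<forall>\<xi>. \<delta> \<le> L2norm UNIV (\<lambda>s. (if s < - L then -1 else if s > L then 1 else x s) - m (s - \<xi>))) \<longrightarrow>
    (1 - \<kappa>) * (surface_tension + c * \<delta>\<^sup>2 - energy L J x) - (K + k)\<^sup>2 * \<eta> / (2 * \<kappa>) \<le> integral {-L..L} (\<lambda>s. F (x s))"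
    using potential_lower by (elim exE conjE) (rule that; assumption)
  have main: "(\<integral>\<^sup>+\<omega>. ennreal (exp (- integral {-L..L} (\<lambda>t. F (W \<omega> t)) / \<epsilon>)) *
       indicator {\<omega>. \<forall>\<xi>. \<delta> \<le> L2norm UNIV (\<lambda>s. (if s < - L then -1 else if s > L then 1 else W \<omega> s) - m (s - \<xi>))} \<omega> \<partial>M)
    \<le> ennreal (exp (- ((1 - \<kappa>) * (surface_tension + c * \<delta>\<^sup>2) - (K + k)\<^sup>2 * \<eta> / (2 * \<kappa>)) / \<epsilon>)
         * (exp (1 / (L * \<epsilon>)) * (1 / sqrt \<kappa>) ^ 2 ^ J)
       + sqrt 2 ^ 2 ^ J * exp (- \<eta> / (\<epsilon> * (2 * L / 2 ^ J)\<^sup>2)))"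
    if sb: "scaled_bridge M W \<epsilon> L" and \<kappa>: "0 < \<kappa>" "\<kappa> < 1" and \<delta>: "0 < \<delta>" "\<delta> \<le> d0" and \<eta>: "\<eta> \<le> \<delta>\<^sup>2 / 4"
    for M :: "'w measure" and W \<epsilon> L J \<kappa> \<delta> \<eta>
  proof -
    interpret sb: scaled_bridge M W \<epsilon> L by (rule sb)
    define Far where "Far = {\<omega>. \<forall>\<xi>. \<delta> \<le> L2norm UNIV (\<lambda>s. (if s < - L then -1 else if s > L then 1 else W \<omega> s) - m (s - \<xi>))}"
    define V where "V \<omega> = integral {-L..L} (\<lambda>t. F (W \<omega> t))" for \<omega>
    define E where "E = exp (- ((1 - \<kappa>) * (surface_tension + c * \<delta>\<^sup>2) - (K + k)\<^sup>2 * \<eta> / (2 * \<kappa>)) / \<epsilon>)"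
    obtain B where B: "B \<in> sets M" "\<And>\<omega>. \<omega> \<in> space M - B \<Longrightarrow> interp_error L J (W \<omega>) < \<eta>"
      and EB: "emeasure M B \<le> ennreal (sqrt 2 ^ 2 ^ J * exp (- \<eta> / (\<epsilon> * (2 * L / 2 ^ J)\<^sup>2)))"
      using sb.interp_error_tail[of J \<eta>] by blast
    have em: "(\<lambda>\<omega>. energy L J (W \<omega>)) \<in> borel_measurable M"
    proof -
      have "(\<lambda>\<omega>. W \<omega> (dyadic L J i)) \<in> borel_measurable M" if "i \<le> 2 ^ J" for i
        by (rule sb.lin_measurable[OF sb.lin_W]) (use dyadic_bounds[OF sb.L that] in auto)
      then show ?thesis unfolding energy_def
        by (intro borel_measurable_divide borel_measurable_times borel_measurable_sum borel_measurable_power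
            borel_measurable_diff borel_measurable_const) auto
    qed
    have "(\<integral>\<^sup>+\<omega>. ennreal (exp (- V \<omega> / \<epsilon>)) * indicator Far \<omega> \<partial>M)
      \<le> (\<integral>\<^sup>+\<omega>. ennreal E * ennreal (exp ((1 - \<kappa>) * energy L J (W \<omega>) / \<epsilon>)) + indicator B \<omega> \<partial>M)"
    proof (rule nn_integral_mono_AE)
      show "AE \<omega> in M. ennreal (exp (- V \<omega> / \<epsilon>)) * indicator Far \<omega>
        \<le> ennreal E * ennreal (exp ((1 - \<kappa>) * energy L J (W \<omega>) / \<epsilon>)) + indicator B \<omega>"
        using sb.endpoints AE_space
      proof eventually_elim
        case (elim \<omega>)
        have cF: "(\<lambda>t. F (W \<omega> t)) integrable_on {-L..L}"
          by (intro integrable_continuous_interval continuous_on_compose2[OF F_cont[of UNIV] sb.paths[OF elim(3)]]) auto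
        consider "\<omega> \<notin> Far" | "\<omega> \<in> B" | "\<omega> \<in> Far" "\<omega> \<notin> B" by blast
        then show ?case
        proof cases
          case 2
          have "0 \<le> V \<omega>" unfolding V_def by (intro integral_nonneg cF F_nonneg)
          then have "ennreal (exp (- V \<omega> / \<epsilon>)) * indicator Far \<omega> \<le> 1"
            using sb.eps by (auto simp: indicator_def)
          also have "1 \<le> ennreal E * ennreal (exp ((1 - \<kappa>) * energy L J (W \<omega>) / \<epsilon>)) + indicator B \<omega>"
            using 2 by simp
          finally show ?thesis .
        next
          case 3
          have "(1 - \<kappa>) * (surface_tension + c * \<delta>\<^sup>2 - energy L J (W \<omega>)) - (K + k)\<^sup>2 * \<eta> / (2 * \<kappa>) \<le> V \<omega>"
            unfolding V_def
          proof (rule low[rule_format])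
            show "interp_error L J (W \<omega>) \<le> \<eta>" using B(2) 3(2) elim(3) by (simp add: less_imp_le)
            show "\<delta> \<le> L2norm UNIV (\<lambda>s. (if s < - L then -1 else if s > L then 1 else W \<omega> s) - m (s - \<xi>))" for \<xi>
              using 3(1) unfolding Far_def by blast
          qed (use sb.L sb.paths[OF elim(3)] elim \<kappa> \<delta> \<eta> in auto)
          then have "- V \<omega> \<le> - ((1 - \<kappa>) * (surface_tension + c * \<delta>\<^sup>2) - (K + k)\<^sup>2 * \<eta> / (2 * \<kappa>)) + (1 - \<kappa>) * energy L J (W \<omega>)"
            by (simp add: algebra_simps)
          then have "- V \<omega> / \<epsilon> \<le> (- ((1 - \<kappa>) * (surface_tension + c * \<delta>\<^sup>2) - (K + k)\<^sup>2 * \<eta> / (2 * \<kappa>)) + (1 - \<kappa>) * energy L J (W \<omega>)) / \<epsilon>"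
            using sb.eps by (intro divide_right_mono) auto
          then have "exp (- V \<omega> / \<epsilon>) \<le> E * exp ((1 - \<kappa>) * energy L J (W \<omega>) / \<epsilon>)"
            unfolding E_def exp_add[symmetric] add_divide_distrib[symmetric] by simp
          then have "ennreal (exp (- V \<omega> / \<epsilon>)) \<le> ennreal E * ennreal (exp ((1 - \<kappa>) * energy L J (W \<omega>) / \<epsilon>))"
            by (simp add: E_def ennreal_leI flip: ennreal_mult)
          then show ?thesis using 3 by simp
        qed simp
      qed
    qed
    also have "\<dots> = ennreal E * (\<integral>\<^sup>+\<omega>. ennreal (exp ((1 - \<kappa>) * energy L J (W \<omega>) / \<epsilon>)) \<partial>M) + emeasure M B"
    proof -
      have m: "(\<lambda>\<omega>. ennreal (exp ((1 - \<kappa>) * energy L J (W \<omega>) / \<epsilon>))) \<in> borel_measurable M"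
        using em by measurable
      then have m2: "(\<lambda>\<omega>. ennreal E * ennreal (exp ((1 - \<kappa>) * energy L J (W \<omega>) / \<epsilon>))) \<in> borel_measurable M" by measurable
      show ?thesis using B(1) by (simp add: nn_integral_add[OF m2] nn_integral_cmult[OF m])
    qed
    also have "\<dots> \<le> ennreal E * ennreal (exp (1 / (L * \<epsilon>)) * (1 / sqrt \<kappa>) ^ 2 ^ J)
       + ennreal (sqrt 2 ^ 2 ^ J * exp (- \<eta> / (\<epsilon> * (2 * L / 2 ^ J)\<^sup>2)))"
      using sb.energy_exponential_moment[of "1 - \<kappa>" J] \<kappa> by (intro add_mono mult_left_mono EB) auto
    also have "\<dots> = ennreal (E * (exp (1 / (L * \<epsilon>)) * (1 / sqrt \<kappa>) ^ 2 ^ J)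
       + sqrt 2 ^ 2 ^ J * exp (- \<eta> / (\<epsilon> * (2 * L / 2 ^ J)\<^sup>2)))"
      using \<kappa> by (simp add: E_def ennreal_plus ennreal_mult)
    finally show ?thesis by (simp only: V_def Far_def E_def)
  qed
  show ?thesis
    by (rule exI[of _ c], rule conjI[OF c(1)], rule exI[of _ d0], rule conjI[OF c(2)], intro allI impI, rule main; assumption)
qed

end

section \<open>Passage to the measures on \<open>L\<^sup>2\<close>\<close>

lemma L2_continuous:
  assumes "continuous_on {a..b} f" shows "f \<in> L2 {a..b}"
proof -
  have "set_integrable lborel {a..b} (\<lambda>x. (f x)\<^sup>2)"
    by (rule borel_integrable_atLeastAtMost') (intro continuous_intros assms)
  moreover have "set_borel_measurable lborel {a..b} f"
    using borel_integrable_atLeastAtMost'[OF assms] unfolding set_integrable_def set_borel_measurable_def by auto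
  ultimately show ?thesis by (simp add: L2_def)
qed

lemma L2_diff:
  assumes f: "f \<in> L2 S" and g: "g \<in> L2 S"
  shows "set_integrable lborel S (\<lambda>x. (f x - g x)\<^sup>2)"
proof -
  have m: "(\<lambda>x. indicator S x * f x) \<in> borel_measurable lborel" "(\<lambda>x. indicator S x * g x) \<in> borel_measurable lborel"
    using f g by (auto simp: L2_def set_borel_measurable_def)
  have i: "integrable lborel (\<lambda>x. indicator S x * (f x)\<^sup>2)" "integrable lborel (\<lambda>x. indicator S x * (g x)\<^sup>2)"
    using f g by (auto simp: L2_def set_integrable_def)
  have "integrable lborel (\<lambda>x. (indicator S x * f x - indicator S x * g x)\<^sup>2)"
  proof (rule Bochner_Integration.integrable_bound)
    show "integrable lborel (\<lambda>x. 2 * (indicator S x * (f x)\<^sup>2) + 2 * (indicator S x * (g x)\<^sup>2))" using i by auto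
    show "(\<lambda>x. (indicator S x * f x - indicator S x * g x)\<^sup>2) \<in> borel_measurable lborel"
      using m by (intro borel_measurable_power borel_measurable_diff)
    have "(p - q)\<^sup>2 \<le> 2 * p\<^sup>2 + 2 * q\<^sup>2" for p q :: real
      using zero_le_power2[of "p + q"] by (simp add: power2_eq_square algebra_simps)
    then show "AE x in lborel. norm ((indicator S x * f x - indicator S x * g x)\<^sup>2) \<le> norm (2 * (indicator S x * (f x)\<^sup>2) + 2 * (indicator S x * (g x)\<^sup>2))"
      by (auto simp: indicator_def)
  qed
  moreover have "(\<lambda>x. (indicator S x * f x - indicator S x * g x)\<^sup>2) = (\<lambda>x. indicator S x *\<^sub>R (f x - g x)\<^sup>2)"
    by (auto simp: fun_eq_iff indicator_def)
  ultimately show ?thesis by (simp add: set_integrable_def)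
qed

lemma L2norm_nonneg: "0 \<le> L2norm S f"
  by (simp add: L2norm_def set_lebesgue_integral_def)

lemma L2norm_sq: "(L2norm S f)\<^sup>2 = (LINT x:S|lborel. (f x)\<^sup>2)"
  unfolding L2norm_def by (rule real_sqrt_pow2) (simp add: set_lebesgue_integral_def)

lemma L2norm_sq_triangle:
  assumes "f \<in> L2 S" "g \<in> L2 S" "h \<in> L2 S"
  shows "(L2norm S (\<lambda>x. f x - h x))\<^sup>2 \<le> 2 * (L2norm S (\<lambda>x. f x - g x))\<^sup>2 + 2 * (L2norm S (\<lambda>x. g x - h x))\<^sup>2"
proof -
  have i: "set_integrable lborel S (\<lambda>x. (f x - h x)\<^sup>2)" "set_integrable lborel S (\<lambda>x. (f x - g x)\<^sup>2)"
    "set_integrable lborel S (\<lambda>x. (g x - h x)\<^sup>2)" by (intro L2_diff assms)+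
  have "(LINT x:S|lborel. (f x - h x)\<^sup>2) \<le> (LINT x:S|lborel. 2 * (f x - g x)\<^sup>2 + 2 * (g x - h x)\<^sup>2)"
  proof (rule set_integral_mono)
    show "set_integrable lborel S (\<lambda>x. 2 * (f x - g x)\<^sup>2 + 2 * (g x - h x)\<^sup>2)"
      using i by (intro set_integral_add set_integrable_mult_right)
    have "(p - r)\<^sup>2 \<le> 2 * (p - q)\<^sup>2 + 2 * (q - r)\<^sup>2" for p q r :: real
      using zero_le_power2[of "(p - q) - (q - r)"] by (simp add: power2_eq_square algebra_simps)
    then show "(f x - h x)\<^sup>2 \<le> 2 * (f x - g x)\<^sup>2 + 2 * (g x - h x)\<^sup>2" for x .
  qed (rule i)
  also have "\<dots> = 2 * (LINT x:S|lborel. (f x - g x)\<^sup>2) + 2 * (LINT x:S|lborel. (g x - h x)\<^sup>2)"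
    using i by (simp add: set_integral_add)
  finally show ?thesis by (simp add: L2norm_sq)
qed

text \<open>A countable dense family: the number of cells per unit length and the list of rational
  values form an element of a countable type. Times before a fall into the first cell through
  \<open>nat\<close>.\<close>

definition step_fun :: "real \<Rightarrow> nat \<times> rat list \<Rightarrow> real \<Rightarrow> real" where
  "step_fun a p s = (let k = nat \<lfloor>(s - a) * real (fst p)\<rfloor> in if k < length (snd p) then of_rat (snd p ! k) else 0)"

lemma step_fun_measurable [measurable]: "step_fun a p \<in> borel_measurable borel"
proof -
  have "(\<lambda>s. (\<lambda>(k :: nat) s. if k < length (snd p) then of_rat (snd p ! k) else 0 :: real) (nat \<lfloor>(s - a) * real (fst p)\<rfloor>) s) \<in> borel_measurable borel"
    by (rule measurable_compose_countable) auto
  then show ?thesis by (simp add: step_fun_def[abs_def] Let_def)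
qed

lemma step_fun_L2: "step_fun a p \<in> L2 {a..b}"
proof -
  define B where "B = (\<Sum>x\<leftarrow>snd p. \<bar>of_rat x\<bar> :: real)"
  have bd: "\<bar>step_fun a p s\<bar> \<le> B" for s
  proof -
    have "0 \<le> B" unfolding B_def by (rule sum_list_nonneg) auto
    moreover have "\<bar>of_rat (snd p ! k)\<bar> \<le> B" if "k < length (snd p)" for k
      unfolding B_def using that by (intro member_le_sum_list) (auto simp: image_iff intro!: bexI[of _ "snd p ! k"])
    ultimately show ?thesis by (auto simp: step_fun_def Let_def)
  qed
  have "set_integrable lborel {a..b} (\<lambda>x. (step_fun a p x)\<^sup>2)"
    unfolding set_integrable_def
  proof (rule Bochner_Integration.integrable_bound)
    show "integrable lborel (\<lambda>x. indicator {a..b} x *\<^sub>R B\<^sup>2)"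
      using borel_integrable_atLeastAtMost'[of a b "\<lambda>_. B\<^sup>2"] by (simp add: set_integrable_def)
    have "(step_fun a p x)\<^sup>2 \<le> B\<^sup>2" for x using bd[of x] by (metis abs_le_square_iff abs_of_nonneg order_trans abs_ge_zero)
    then show "AE x in lborel. norm (indicator {a..b} x *\<^sub>R (step_fun a p x)\<^sup>2) \<le> norm (indicator {a..b} x *\<^sub>R B\<^sup>2)"
      by (auto simp: indicator_def)
  qed measurable
  then show ?thesis by (simp add: L2_def set_borel_measurable_def)
qed

lemma step_fun_dense:
  assumes w: "continuous_on {a..b} w" and e: "e > 0"
  shows "\<exists>p. \<forall>s\<in>{a..b}. \<bar>w s - step_fun a p s\<bar> \<le> e"
proof -
  have "uniformly_continuous_on {a..b} w" by (rule compact_uniformly_continuous[OF w]) simp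
  moreover have "e / 2 > 0" using e by simp
  ultimately obtain d where d: "d > 0" "\<And>x y. x \<in> {a..b} \<Longrightarrow> y \<in> {a..b} \<Longrightarrow> dist y x < d \<Longrightarrow> dist (w y) (w x) < e / 2"
    unfolding uniformly_continuous_on_def by blast
  obtain n where n: "inverse (real (Suc n)) < d" using reals_Archimedean[OF d(1)] by blast
  define N where "N = real (Suc n)"
  have N: "N > 0" "1 / N < d" using n by (auto simp: N_def inverse_eq_divide)
  have "\<exists>r :: rat. \<bar>w (a + real i / N) - of_rat r\<bar> < e / 2" for i :: nat
  proof -
    have "w (a + real i / N) - e / 2 < w (a + real i / N) + e / 2" using e by simp
    from of_rat_dense[OF this] obtain r where "w (a + real i / N) - e / 2 < of_rat r" "of_rat r < w (a + real i / N) + e / 2" by blast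
    then have "\<bar>w (a + real i / N) - of_rat r\<bar> < e / 2" by linarith
    then show ?thesis ..
  qed
  then obtain r :: "nat \<Rightarrow> rat" where r: "\<And>i. \<bar>w (a + real i / N) - of_rat (r i)\<bar> < e / 2" by metis
  define m where "m = nat \<lfloor>(b - a) * N\<rfloor>"
  \<comment> \<open>The list has m + 1 entries because the right endpoint b falls into the cell with
    index m.\<close>
  define p where "p = (Suc n, map r [0..<Suc m])"
  have "\<bar>w s - step_fun a p s\<bar> \<le> e" if s: "s \<in> {a..b}" for s
  proof -
    define k where "k = nat \<lfloor>(s - a) * N\<rfloor>"
    have nn: "0 \<le> (s - a) * N" using s N by simp
    have "k \<le> m" unfolding k_def m_def using s N by (intro nat_mono floor_mono mult_right_mono) auto
    then have st: "step_fun a p s = of_rat (r k)" by (simp add: step_fun_def p_def k_def N_def Let_def del: upt_Suc of_nat_Suc)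
    have "real k = of_int \<lfloor>(s - a) * N\<rfloor>" using nn by (simp add: k_def)
    then have k: "real k \<le> (s - a) * N" "(s - a) * N < real k + 1" using floor_correct[of "(s - a) * N"] by auto
    have k1: "real k / N \<le> s - a" using k(1) N by (simp add: pos_divide_le_eq)
    have "s - a < (real k + 1) / N" using k(2) N by (simp add: pos_less_divide_eq)
    then have k2: "s - a < real k / N + 1 / N" by (simp add: add_divide_distrib)
    have k0: "0 \<le> real k / N" using N by simp
    have "a + real k / N \<in> {a..b}" using k0 k1 s by auto
    moreover have "dist s (a + real k / N) < d" unfolding dist_real_def using k1 k2 N(2) by linarith
    ultimately have "dist (w s) (w (a + real k / N)) < e / 2" using d(2)[of "a + real k / N" s] s by blast
    then show ?thesis using r[of k] unfolding st dist_real_def by linarith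
  qed
  then show ?thesis by blast
qed

lemma L2norm_le_sup:
  assumes ab: "a \<le> b" and b: "\<And>s. s \<in> {a..b} \<Longrightarrow> \<bar>f s\<bar> \<le> e"
    and i: "set_integrable lborel {a..b} (\<lambda>x. (f x)\<^sup>2)"
  shows "(L2norm {a..b} f)\<^sup>2 \<le> (b - a) * e\<^sup>2"
proof -
  have "(LINT x:{a..b}|lborel. (f x)\<^sup>2) \<le> (LINT x:{a..b}|lborel. e\<^sup>2)"
  proof (rule set_integral_mono[OF i])
    show "set_integrable lborel {a..b} (\<lambda>x. e\<^sup>2)" by (rule borel_integrable_atLeastAtMost') (intro continuous_intros)
    show "(f x)\<^sup>2 \<le> e\<^sup>2" if "x \<in> {a..b}" for x
      using power_mono[OF b[OF that], of 2] by simp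
  qed
  also have "(LINT x:{a..b}|lborel. e\<^sup>2) = (b - a) * e\<^sup>2"
    using ab by (simp add: set_lebesgue_integral_def)
  finally show ?thesis by (simp add: L2norm_sq)
qed

text \<open>Separability: a continuous path in an open set A lies in some ball of rational radius
  about a rational step function, with the ball contained in A. The preimage of A is thus a
  countable union of events about the distance to one step function, and these are measurable by
  Fubini's theorem.\<close>

lemma continuous_process_L2_measurable:
  fixes X :: "'w \<Rightarrow> real \<Rightarrow> real"
  assumes ab: "a < b" and meas: "\<And>t. t \<in> {a..b} \<Longrightarrow> (\<lambda>\<omega>. X \<omega> t) \<in> borel_measurable M"
    and cont: "\<And>\<omega>. \<omega> \<in> space M \<Longrightarrow> continuous_on {a..b} (X \<omega>)"
  shows "X \<in> M \<rightarrow>\<^sub>M L2_borel {a..b} (L2 {a..b})"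
  unfolding L2_borel_def
proof (rule measurable_measure_of)
  show "{A. L2_open {a..b} (L2 {a..b}) A} \<subseteq> Pow (L2 {a..b})" by (auto simp: L2_open_def)
  show "X \<in> space M \<rightarrow> L2 {a..b}" using cont L2_continuous by blast
  fix A assume "A \<in> {A. L2_open {a..b} (L2 {a..b}) A}"
  then have A: "A \<subseteq> L2 {a..b}"
    "\<And>u. u \<in> A \<Longrightarrow> \<exists>r>0. \<forall>v\<in>L2 {a..b}. L2norm {a..b} (\<lambda>x. v x - u x) < r \<longrightarrow> v \<in> A"
    by (auto simp: L2_open_def)
  define N where "N p \<omega> = L2norm {a..b} (\<lambda>x. X \<omega> x - step_fun a p x)" for p \<omega>
  have Nm: "N p \<in> borel_measurable M" for p
  proof -
    define c where "c t = max a (min b t)" for t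
    have jm[measurable]: "(\<lambda>(\<omega>, t). X \<omega> (c t)) \<in> borel_measurable (M \<Otimes>\<^sub>M lborel)"
      unfolding c_def by (rule continuous_paths_jointly_measurable) (use ab meas cont in auto)
    have "(\<lambda>\<omega>. \<integral>t. indicator {a..b} t * (X \<omega> (c t) - step_fun a p t)\<^sup>2 \<partial>lborel) \<in> borel_measurable M"
      by (rule lborel.borel_measurable_lebesgue_integral) measurable
    moreover have "(\<integral>t. indicator {a..b} t * (X \<omega> (c t) - step_fun a p t)\<^sup>2 \<partial>lborel) = (N p \<omega>)\<^sup>2" for \<omega>
      unfolding N_def L2norm_sq set_lebesgue_integral_def
      by (intro Bochner_Integration.integral_cong refl) (auto simp: indicator_def c_def)
    ultimately have "(\<lambda>\<omega>. (N p \<omega>)\<^sup>2) \<in> borel_measurable M" by simp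
    then have "(\<lambda>\<omega>. sqrt ((N p \<omega>)\<^sup>2)) \<in> borel_measurable M" by measurable
    moreover have "sqrt ((N p \<omega>)\<^sup>2) = N p \<omega>" for \<omega> by (simp add: N_def L2norm_nonneg)
    ultimately show ?thesis by simp
  qed
  define I where "I = {(p, q :: rat). \<forall>v\<in>L2 {a..b}. L2norm {a..b} (\<lambda>x. v x - step_fun a p x) < of_rat q \<longrightarrow> v \<in> A}"
  have "X -` A \<inter> space M = (\<Union>(p, q)\<in>I. {\<omega> \<in> space M. N p \<omega> < of_rat q})"
  proof (intro antisym subsetI)
    fix \<omega> assume "\<omega> \<in> (\<Union>(p, q)\<in>I. {\<omega> \<in> space M. N p \<omega> < of_rat q})"
    then show "\<omega> \<in> X -` A \<inter> space M" using L2_continuous[OF cont] by (auto simp: I_def N_def)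
  next
    fix \<omega> assume \<omega>: "\<omega> \<in> X -` A \<inter> space M"
    then obtain r where r: "r > 0" "\<And>v. v \<in> L2 {a..b} \<Longrightarrow> L2norm {a..b} (\<lambda>x. v x - X \<omega> x) < r \<Longrightarrow> v \<in> A"
      using A(2)[of "X \<omega>"] by blast
    have XL: "X \<omega> \<in> L2 {a..b}" using L2_continuous cont \<omega> by blast
    \<comment> \<open>This puts the step function within r / 4 of the path. For a rational q between
      r / 4 and r / 2, \<open>L2norm_sq_triangle\<close> then places the ball of radius q about it
      within 2 q < r of the path.\<close>
    define e where "e = r / (4 * sqrt (b - a))"
    have e: "e > 0" using r ab by (simp add: e_def)
    have "\<exists>p. \<forall>s\<in>{a..b}. \<bar>X \<omega> s - step_fun a p s\<bar> \<le> e"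
      by (rule step_fun_dense) (use cont \<omega> e in auto)
    then obtain p where p: "\<And>s. s \<in> {a..b} \<Longrightarrow> \<bar>X \<omega> s - step_fun a p s\<bar> \<le> e" by blast
    have "(N p \<omega>)\<^sup>2 \<le> (b - a) * e\<^sup>2"
      unfolding N_def by (rule L2norm_le_sup) (use ab p L2_diff[OF XL step_fun_L2] in auto)
    also have "\<dots> = (r / 4)\<^sup>2"
    proof -
      have "e\<^sup>2 = r\<^sup>2 / (16 * (b - a))" using ab by (simp add: e_def power_divide power_mult_distrib)
      then show ?thesis using ab by (simp add: power_divide field_simps)
    qed
    finally have "(N p \<omega>)\<^sup>2 \<le> (r / 4)\<^sup>2" .
    then have "N p \<omega> \<le> r / 4" by (rule power2_le_imp_le) (use r in simp)
    have "r / 4 < r / 2" using r by simp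
    from of_rat_dense[OF this] obtain q where q: "r / 4 < of_rat q" "of_rat q < r / 2" by blast
    have Nq: "N p \<omega> < of_rat q" using \<open>N p \<omega> \<le> r / 4\<close> q by linarith
    have "v \<in> A" if v: "v \<in> L2 {a..b}" "L2norm {a..b} (\<lambda>x. v x - step_fun a p x) < of_rat q" for v
    proof (rule r(2)[OF v(1)])
      have q0: "0 < (of_rat q :: real)" using q r by linarith
      have "(L2norm {a..b} (\<lambda>x. v x - X \<omega> x))\<^sup>2 \<le> 2 * (L2norm {a..b} (\<lambda>x. v x - step_fun a p x))\<^sup>2 + 2 * (L2norm {a..b} (\<lambda>x. step_fun a p x - X \<omega> x))\<^sup>2"
        by (rule L2norm_sq_triangle[OF v(1) step_fun_L2 XL])
      also have "L2norm {a..b} (\<lambda>x. step_fun a p x - X \<omega> x) = N p \<omega>"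
        unfolding N_def L2norm_def by (simp add: power2_commute)
      also have "2 * (L2norm {a..b} (\<lambda>x. v x - step_fun a p x))\<^sup>2 + 2 * (N p \<omega>)\<^sup>2 \<le> 2 * (of_rat q)\<^sup>2 + 2 * (of_rat q)\<^sup>2"
        using v(2) Nq by (intro add_mono mult_left_mono power_mono) (auto simp: N_def L2norm_nonneg)
      also have "\<dots> = (2 * of_rat q)\<^sup>2" by (simp add: power2_eq_square)
      also have "\<dots> < r\<^sup>2" using q q0 by (intro power_strict_mono) auto
      finally show "L2norm {a..b} (\<lambda>x. v x - X \<omega> x) < r" by (rule power2_less_imp_less) (use r in simp)
    qed
    then have "(p, q) \<in> I" by (auto simp: I_def)
    then show "\<omega> \<in> (\<Union>(p, q)\<in>I. {\<omega> \<in> space M. N p \<omega> < of_rat q})" using Nq \<omega> by blast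
  qed
  moreover have "(\<Union>(p, q)\<in>I. {\<omega> \<in> space M. N p \<omega> < of_rat q}) \<in> sets M"
  proof (rule sets.countable_UN'')
    show "countable I" by (rule countableI_type)
    fix i assume "i \<in> I"
    obtain p q where i: "i = (p, q)" by (cases i)
    show "(case i of (p, q) \<Rightarrow> {\<omega> \<in> space M. N p \<omega> < of_rat q}) \<in> sets M"
      unfolding i using Nm[of p] by simp measurable
  qed
  ultimately show "X -` A \<inter> space M \<in> sets M" by simp
qed

section \<open>From the rescaled bridge to the measure on the line\<close>

lemma emeasure_distr_le: "emeasure (distr M N f) A \<le> emeasure M (f -` A \<inter> space M)"
  unfolding distr_def by (subst emeasure_measure_of_conv) auto

lemma emeasure_density_le: "emeasure (density M f) A \<le> (\<integral>\<^sup>+x. f x * indicator A x \<partial>M)"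
  unfolding density_def by (subst emeasure_measure_of_conv) auto

lemma bridge_process_scaled:
  assumes bp: "bridge_process \<gamma> \<epsilon> P U" and eps: "\<epsilon> > 0"
  shows "scaled_bridge P (\<lambda>\<omega>. rescale \<gamma> \<epsilon> (U \<omega>)) \<epsilon> (\<epsilon> powr (- \<gamma>))"
proof -
  define g where "g = \<epsilon> powr \<gamma>"
  define L where "L = \<epsilon> powr (- \<gamma>)"
  have g: "g > 0" and L: "L > 0" and gL: "g * L = 1" using eps by (auto simp: g_def L_def simp flip: powr_add)
  have Lg: "L = 1 / g" using gL g by (simp add: field_simps)
  have sc: "g * t \<in> {-1..1}" if "t \<in> {-L..L}" for t
    using mult_left_mono[of "-L" t g] mult_left_mono[of t L g] that g gL by auto
  have ps: "prob_space P" and ct: "\<And>\<omega>. \<omega> \<in> space P \<Longrightarrow> continuous_on {-1..1} (U \<omega>)"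
    and gp: "gaussian_process P {-1..1} U" and mn: "\<And>s. s \<in> {-1..1} \<Longrightarrow> (\<integral>\<omega>. U \<omega> s \<partial>P) = s"
    and cv: "\<And>s t. s \<in> {-1..1} \<Longrightarrow> t \<in> {-1..1} \<Longrightarrow> covariance P (\<lambda>\<omega>. U \<omega> s) (\<lambda>\<omega>. U \<omega> t) =
        \<epsilon> powr (1 - \<gamma>) * (min s t + 1 - (s + 1) * (t + 1) / 2)"
    using bp by (auto simp: bridge_process_def)
  \<comment> \<open>The prefactor splits as \<epsilon> L, and L cancels against the factor g that
    the covariance kernel picks up under t \<mapsto> g t, because g L = 1.\<close>
  have pw: "\<epsilon> powr (1 - \<gamma>) = \<epsilon> * L" using eps by (simp add: L_def powr_diff powr_minus divide_inverse)
  interpret prob_space P by (rule ps)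
  have W: "rescale \<gamma> \<epsilon> (U \<omega>) t = U \<omega> (g * t)" for \<omega> t by (simp add: rescale_def g_def)
  show ?thesis unfolding L_def[symmetric]
  proof
    show "continuous_on {-L..L} (rescale \<gamma> \<epsilon> (U \<omega>))" if "\<omega> \<in> space P" for \<omega>
      unfolding W[abs_def] by (rule continuous_on_compose2[OF ct[OF that]]) (use sc in \<open>auto intro!: continuous_intros\<close>)
    show "gaussian_process P {-L..L} (\<lambda>\<omega>. rescale \<gamma> \<epsilon> (U \<omega>))"
      unfolding gaussian_process_def
    proof (intro allI impI)
      fix I and c :: "real \<Rightarrow> real" assume I: "finite I \<and> I \<subseteq> {-L..L}"
      have inj: "inj_on ((*) g) I" using g by (auto simp: inj_on_def)
      have "gaussian_rv P (\<lambda>\<omega>. \<Sum>s\<in>(*) g ` I. c (s / g) * U \<omega> s)"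
        using gp I sc unfolding gaussian_process_def by (meson finite_imageI image_subsetI subsetD)
      moreover have "(\<Sum>s\<in>(*) g ` I. c (s / g) * U \<omega> s) = (\<Sum>t\<in>I. c t * rescale \<gamma> \<epsilon> (U \<omega>) t)" for \<omega>
        using g by (simp add: sum.reindex[OF inj] W)
      ultimately show "gaussian_rv P (\<lambda>\<omega>. \<Sum>t\<in>I. c t * rescale \<gamma> \<epsilon> (U \<omega>) t)" by simp
    qed
    show "expectation (\<lambda>\<omega>. rescale \<gamma> \<epsilon> (U \<omega>) t) = t / L" if "t \<in> {-L..L}" for t
      using mn[OF sc[OF that]] g by (simp add: W Lg)
    show "covariance P (\<lambda>\<omega>. rescale \<gamma> \<epsilon> (U \<omega>) s) (\<lambda>\<omega>. rescale \<gamma> \<epsilon> (U \<omega>) t)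
      = \<epsilon> * (min s t + L - (s + L) * (t + L) / (2 * L))" if "s \<in> {-L..L}" "t \<in> {-L..L}" for s t
    proof -
      have "min (g * s) (g * t) = g * min s t" using g by (simp add: min_mult_distrib_left)
      then have "min (g * s) (g * t) + 1 - (g * s + 1) * (g * t + 1) / 2 = g * (min s t + L - (s + L) * (t + L) / (2 * L))"
        using g by (simp add: Lg field_simps)
      then have "covariance P (\<lambda>\<omega>. rescale \<gamma> \<epsilon> (U \<omega>) s) (\<lambda>\<omega>. rescale \<gamma> \<epsilon> (U \<omega>) t) = \<epsilon> * L * (g * (min s t + L - (s + L) * (t + L) / (2 * L)))"
        unfolding W cv[OF sc[OF that(1)] sc[OF that(2)]] pw by simp
      also have "\<dots> = \<epsilon> * (g * L) * (min s t + L - (s + L) * (t + L) / (2 * L))" by (simp only: mult_ac)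
      finally show ?thesis by (simp add: gL)
    qed
  qed (use eps L in auto)
qed

text \<open>The substitution s = \<epsilon>^\<gamma> t turns the prefactor
  \<open>\<epsilon> powr (- 1 - \<gamma>)\<close> into 1 / \<epsilon>, the factor that also goes
  with the kinetic energy, so that a single rescaled energy governs both.\<close>

lemma weight_rescale:
  fixes \<gamma> \<epsilon> :: real
  assumes F: "continuous_on UNIV F" and u: "continuous_on {-1..1} u" and eps: "\<epsilon> > 0"
  defines "L \<equiv> \<epsilon> powr (- \<gamma>)"
  shows "weight F \<gamma> \<epsilon> u = exp (- integral {-L..L} (\<lambda>t. F (rescale \<gamma> \<epsilon> u t)) / \<epsilon>)"
proof -
  define g where "g = \<epsilon> powr \<gamma>"
  have g: "g > 0" and L: "L > 0" and gL: "g * L = 1" using eps by (auto simp: g_def L_def simp flip: powr_add)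
  have sc: "g * t \<in> {-1..1}" if "t \<in> {-L..L}" for t
    using mult_left_mono[of "-L" t g] mult_left_mono[of t L g] that g gL by auto
  have cF: "continuous_on {-1..1} (\<lambda>s. F (u s))" by (rule continuous_on_compose2[OF F u]) auto
  have i: "set_integrable lborel {-1..1} (\<lambda>s. F (u s))" by (rule borel_integrable_atLeastAtMost'[OF cF])
  have "((\<lambda>t. g *\<^sub>R F (u (g * t))) has_integral (integral {g * (- L)..g * L} (\<lambda>s. F (u s)))) {-L..L}"
  proof (rule has_integral_substitution[where c = "-1" and d = 1])
    show "((*) g has_field_derivative g) (at t within {-L..L})" for t
      by (auto intro!: derivative_eq_intros)
  qed (use L sc cF g in auto)
  from integral_unique[OF this] have "integral {-1..1} (\<lambda>s. F (u s)) = g * integral {-L..L} (\<lambda>t. F (u (g * t)))"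
    using gL by simp
  moreover have "\<epsilon> powr (- 1 - \<gamma>) * g = 1 / \<epsilon>"
    using eps by (simp add: g_def powr_minus_divide flip: powr_add)
  ultimately have "\<epsilon> powr (- 1 - \<gamma>) * (LINT s:{-1..1}|lborel. F (u s)) = integral {-L..L} (\<lambda>t. F (rescale \<gamma> \<epsilon> u t)) / \<epsilon>"
    unfolding set_borel_integral_eq_integral(2)[OF i] rescale_def g_def[symmetric]
    by (simp flip: mult.assoc)
  then show ?thesis using i by (simp add: weight_def)
qed

text \<open>No measurability of the weight or of the two maps has to be checked: off the measurable case the
  library's pushforwards and densities vanish, and a weight that is not measurable has Bochner
  integral \<open>0\<close>, hence density \<open>0\<close>.\<close>

lemma mu_line_bound:
  fixes \<gamma> \<epsilon> \<delta> a B :: real and P :: "'w measure" and U :: "'w \<Rightarrow> real \<Rightarrow> real" and F m :: "real \<Rightarrow> real"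
  assumes bp: "bridge_process \<gamma> \<epsilon> P U" and eps: "\<epsilon> > 0" and F: "continuous_on UNIV F" and Fnn: "\<And>u. 0 \<le> F u"
  defines "L \<equiv> \<epsilon> powr (- \<gamma>)"
  defines "W \<equiv> \<lambda>\<omega>. rescale \<gamma> \<epsilon> (U \<omega>)"
  assumes Z: "ennreal (exp (- a)) \<le> (\<integral>\<^sup>+\<omega>. ennreal (exp (- integral {-L..L} (\<lambda>t. F (W \<omega> t)) / \<epsilon>)) \<partial>P)"
    and Num: "(\<integral>\<^sup>+\<omega>. ennreal (exp (- integral {-L..L} (\<lambda>t. F (W \<omega> t)) / \<epsilon>)) *
       indicator {\<omega>. \<forall>\<xi>. \<delta> \<le> L2norm UNIV (\<lambda>s. (if s < - L then -1 else if s > L then 1 else W \<omega> s) - m (s - \<xi>))} \<omega> \<partial>P) \<le> ennreal B"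
    and B: "0 \<le> B"
  shows "measure (mu_line F m \<gamma> \<epsilon> (nu_tilde P U)) {u \<in> affine_L2 UNIV m. L2_dist_set u (kinks m) \<ge> \<delta>} \<le> B * exp a"
proof -
  define \<nu> where "\<nu> = nu_tilde P U"
  define w where "w = weight F \<gamma> \<epsilon>"
  define Zr where "Zr = (\<integral>v. w v \<partial>\<nu>)"
  define S where "S = {u \<in> affine_L2 UNIV m. L2_dist_set u (kinks m) \<ge> \<delta>}"
  define S' where "S' = {\<omega>. \<forall>\<xi>. \<delta> \<le> L2norm UNIV (\<lambda>s. (if s < - L then -1 else if s > L then 1 else W \<omega> s) - m (s - \<xi>))}"
  define V where "V \<omega> = exp (- integral {-L..L} (\<lambda>t. F (W \<omega> t)) / \<epsilon>)" for \<omega>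
  interpret sb: scaled_bridge P W \<epsilon> L
    unfolding L_def W_def by (rule bridge_process_scaled[OF bp eps])
  have cU: "continuous_on {-1..1} (U \<omega>)" if "\<omega> \<in> space P" for \<omega> using bp that by (auto simp: bridge_process_def)
  have Um: "(\<lambda>\<omega>. U \<omega> t) \<in> borel_measurable P" if "t \<in> {-1..1}" for t
  proof -
    have "gaussian_process P {-1..1} U" using bp by (simp add: bridge_process_def)
    from this[unfolded gaussian_process_def, rule_format, of "{t}" "\<lambda>_. 1"] that
    show ?thesis by (simp add: gaussian_rv_def)
  qed
  have UM: "U \<in> P \<rightarrow>\<^sub>M L2_borel {-1..1} (L2 {-1..1})"
    by (rule continuous_process_L2_measurable) (use cU Um in auto)
  have wV: "w (U \<omega>) = V \<omega>" if "\<omega> \<in> space P" for \<omega>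
    unfolding w_def V_def W_def L_def by (rule weight_rescale[OF F cU[OF that] eps])
  have V01: "0 \<le> V \<omega>" "V \<omega> \<le> 1" if "\<omega> \<in> space P" for \<omega>
  proof -
    have "(\<lambda>t. F (W \<omega> t)) integrable_on {-L..L}"
      by (intro integrable_continuous_interval continuous_on_compose2[OF F sb.paths[OF that]]) auto
    then have "0 \<le> integral {-L..L} (\<lambda>t. F (W \<omega> t))" by (intro integral_nonneg) (auto simp: Fnn)
    then show "0 \<le> V \<omega>" "V \<omega> \<le> 1" using eps by (auto simp: V_def)
  qed
  obtain A where Ad: "emeasure (mu_line F m \<gamma> \<epsilon> \<nu>) S \<le> emeasure (mu_tilde F \<gamma> \<epsilon> \<nu>) A"
    and A: "A \<subseteq> {u. extend \<gamma> \<epsilon> (rescale \<gamma> \<epsilon> u) \<in> S}"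
  proof -
    define A1 where "A1 = extend \<gamma> \<epsilon> -` S \<inter> space (mu F \<gamma> \<epsilon> \<nu>)"
    define A2 where "A2 = rescale \<gamma> \<epsilon> -` A1 \<inter> space (mu_tilde F \<gamma> \<epsilon> \<nu>)"
    have "emeasure (mu_line F m \<gamma> \<epsilon> \<nu>) S \<le> emeasure (mu F \<gamma> \<epsilon> \<nu>) A1"
      unfolding mu_line_def A1_def by (rule emeasure_distr_le)
    also have "\<dots> \<le> emeasure (mu_tilde F \<gamma> \<epsilon> \<nu>) A2"
      unfolding A2_def by (subst mu_def) (rule emeasure_distr_le)
    finally show ?thesis by (rule that) (auto simp: A1_def A2_def)
  qed
  have main: "emeasure (mu_tilde F \<gamma> \<epsilon> \<nu>) A \<le> ennreal (B * exp a)"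
  proof (cases "A \<in> sets \<nu> \<and> w \<in> borel_measurable \<nu>")
    case False
    then consider "A \<notin> sets \<nu>" | "w \<notin> borel_measurable \<nu>" by blast
    then show ?thesis
    proof cases
      case 1
      then have "emeasure (mu_tilde F \<gamma> \<epsilon> \<nu>) A = 0" by (intro emeasure_notin_sets) (simp add: mu_tilde_def)
      then show ?thesis by simp
    next
      case 2
      then have "Zr = 0" unfolding Zr_def by (intro not_integrable_integral_eq) auto
      then have "mu_tilde F \<gamma> \<epsilon> \<nu> = density \<nu> (\<lambda>_. 0)"
        unfolding mu_tilde_def w_def[symmetric] Zr_def[symmetric] by simp
      then have "emeasure (mu_tilde F \<gamma> \<epsilon> \<nu>) A \<le> (\<integral>\<^sup>+u. 0 * indicator A u \<partial>\<nu>)"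
        by (simp only: emeasure_density_le)
      then show ?thesis by simp
    qed
  next
    case True
    then have A\<nu>: "A \<in> sets \<nu>" and w\<nu>: "w \<in> borel_measurable \<nu>" by auto
    have \<nu>: "\<nu> = distr P (L2_borel {-1..1} (L2 {-1..1})) U" by (simp add: \<nu>_def nu_tilde_def)
    have wm[measurable]: "w \<in> borel_measurable (L2_borel {-1..1} (L2 {-1..1}))" using w\<nu> by (simp add: \<nu>)
    have Am[measurable]: "A \<in> sets (L2_borel {-1..1} (L2 {-1..1}))" using A\<nu> by (simp add: \<nu>)
    have wU: "(\<lambda>\<omega>. w (U \<omega>)) \<in> borel_measurable P" by (rule measurable_compose[OF UM wm])
    have iw: "integrable P (\<lambda>\<omega>. w (U \<omega>))"
      by (rule sb.integrable_const_bound[of _ 1]) (use wU wV V01 in \<open>auto intro!: AE_I2\<close>)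
    have "Zr = (\<integral>\<omega>. w (U \<omega>) \<partial>P)" unfolding Zr_def \<nu> by (rule integral_distr[OF UM wm])
    then have "ennreal Zr = (\<integral>\<^sup>+\<omega>. ennreal (w (U \<omega>)) \<partial>P)"
      using nn_integral_eq_integral[OF iw] wV V01 by (simp add: AE_I2)
    also have "\<dots> = (\<integral>\<^sup>+\<omega>. ennreal (V \<omega>) \<partial>P)" by (intro nn_integral_cong) (simp add: wV)
    finally have "ennreal (exp (- a)) \<le> ennreal Zr" using Z by (simp add: V_def)
    then have Zr: "exp (- a) \<le> Zr" "0 < Zr"
    proof -
      show le: "exp (- a) \<le> Zr"
        using \<open>ennreal (exp (- a)) \<le> ennreal Zr\<close> exp_gt_zero[of "- a"] unfolding ennreal_le_iff2 by linarith
      show "0 < Zr" by (rule less_le_trans[OF exp_gt_zero le])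
    qed
    have Zinv: "1 / Zr \<le> exp a"
    proof -
      have "1 / Zr \<le> 1 / exp (- a)" using Zr by (intro divide_left_mono) auto
      then show ?thesis by (simp add: exp_minus divide_inverse)
    qed
    have "emeasure (mu_tilde F \<gamma> \<epsilon> \<nu>) A \<le> (\<integral>\<^sup>+u. ennreal (w u / Zr) * indicator A u \<partial>\<nu>)"
      unfolding mu_tilde_def w_def[symmetric] Zr_def[symmetric] by (rule emeasure_density_le)
    also have "\<dots> = (\<integral>\<^sup>+\<omega>. ennreal (w (U \<omega>) / Zr) * indicator A (U \<omega>) \<partial>P)"
      unfolding \<nu> by (rule nn_integral_distr[OF UM]) measurable
    also have "\<dots> = (\<integral>\<^sup>+\<omega>. ennreal (1 / Zr) * (ennreal (w (U \<omega>)) * indicator A (U \<omega>)) \<partial>P)"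
    proof (rule nn_integral_cong)
      fix \<omega> assume \<omega>: "\<omega> \<in> space P"
      have "ennreal (w (U \<omega>) / Zr) = ennreal (1 / Zr) * ennreal (w (U \<omega>))"
        using wV[OF \<omega>] V01[OF \<omega>] Zr by (simp flip: ennreal_mult)
      then show "ennreal (w (U \<omega>) / Zr) * indicator A (U \<omega>) = ennreal (1 / Zr) * (ennreal (w (U \<omega>)) * indicator A (U \<omega>))"
        by (simp only: mult.assoc)
    qed
    also have "\<dots> = ennreal (1 / Zr) * (\<integral>\<^sup>+\<omega>. ennreal (w (U \<omega>)) * indicator A (U \<omega>) \<partial>P)"
    proof (rule nn_integral_cmult)
      have "(\<lambda>u. ennreal (w u) * indicator A u) \<in> borel_measurable (L2_borel {-1..1} (L2 {-1..1}))" by measurable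
      from measurable_compose[OF UM this]
      show "(\<lambda>\<omega>. ennreal (w (U \<omega>)) * indicator A (U \<omega>)) \<in> borel_measurable P" .
    qed
    also have "\<dots> \<le> ennreal (exp a) * ennreal B"
    proof (rule mult_mono)
      have "(\<integral>\<^sup>+\<omega>. ennreal (w (U \<omega>)) * indicator A (U \<omega>) \<partial>P) \<le> (\<integral>\<^sup>+\<omega>. ennreal (V \<omega>) * indicator S' \<omega> \<partial>P)"
      proof (rule nn_integral_mono)
        fix \<omega> assume \<omega>: "\<omega> \<in> space P"
        have "indicator A (U \<omega>) \<le> (indicator S' \<omega> :: ennreal)"
        proof (cases "U \<omega> \<in> A")
          case True
          then have far: "\<delta> \<le> L2_dist_set (extend \<gamma> \<epsilon> (W \<omega>)) (kinks m)" using A by (auto simp: S_def W_def)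
          have "\<delta> \<le> L2norm UNIV (\<lambda>s. (if s < - L then -1 else if s > L then 1 else W \<omega> s) - m (s - \<xi>))" for \<xi>
          proof -
            have "L2_dist_set (extend \<gamma> \<epsilon> (W \<omega>)) (kinks m) \<le> L2norm UNIV (\<lambda>s. extend \<gamma> \<epsilon> (W \<omega>) s - m (s - \<xi>))"
              unfolding L2_dist_set_def
              by (rule cINF_lower) (auto intro!: bdd_belowI2[of _ 0] L2norm_nonneg simp: kinks_def)
            with far have "\<delta> \<le> L2norm UNIV (\<lambda>s. extend \<gamma> \<epsilon> (W \<omega>) s - m (s - \<xi>))" by (rule order_trans)
            then show ?thesis unfolding extend_def L_def .
          qed
          then have "\<omega> \<in> S'" by (simp add: S'_def)
          then show ?thesis by (simp add: indicator_def)
        qed simp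
        then show "ennreal (w (U \<omega>)) * indicator A (U \<omega>) \<le> ennreal (V \<omega>) * indicator S' \<omega>"
          unfolding wV[OF \<omega>] by (intro mult_left_mono) auto
      qed
      also have "\<dots> \<le> ennreal B" using Num by (simp only: V_def S'_def)
      finally show "(\<integral>\<^sup>+\<omega>. ennreal (w (U \<omega>)) * indicator A (U \<omega>) \<partial>P) \<le> ennreal B" .
    qed (auto intro: ennreal_leI Zinv)
    also have "\<dots> = ennreal (B * exp a)" using B by (simp add: mult.commute flip: ennreal_mult)
    finally show ?thesis .
  qed
  have "measure (mu_line F m \<gamma> \<epsilon> \<nu>) S \<le> B * exp a"
    unfolding measure_def using order_trans[OF Ad main] B by (intro enn2real_leI) auto
  then show ?thesis by (simp add: \<nu>_def S_def)
qed

section \<open>Choice of scales\<close>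

lemma eventually_powr_small:
  fixes A p s :: real
  assumes "p > 0" "s > 0"
  shows "eventually (\<lambda>\<epsilon>. A * \<epsilon> powr p \<le> s) (at_right 0)"
proof -
  have "((\<lambda>\<epsilon>. \<epsilon> powr p) \<longlongrightarrow> 0 powr p) (at_right (0 :: real))"
    by (rule tendsto_powr2) (use assms in \<open>auto simp: eventually_at_filter\<close>)
  then have "((\<lambda>\<epsilon>. A * \<epsilon> powr p) \<longlongrightarrow> A * 0) (at_right 0)"
    by (intro tendsto_mult tendsto_const) simp
  then have "eventually (\<lambda>\<epsilon>. A * \<epsilon> powr p < s) (at_right 0)"
    using assms(2) by (intro order_tendstoD(2)) auto
  then show ?thesis by eventually_elim simp
qed

lemma dyadic_level_exists:
  fixes x :: real
  assumes "1 \<le> x" shows "\<exists>J :: nat. x \<le> 2 ^ J \<and> 2 ^ J \<le> 2 * x"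
proof -
  obtain n :: nat where "x < 2 ^ n" using real_arch_pow[of 2 x] by auto
  then have ex: "\<exists>n :: nat. x \<le> 2 ^ n" by (auto intro: less_imp_le)
  define J where "J = (LEAST n. x \<le> 2 ^ n)"
  have J: "x \<le> 2 ^ J" unfolding J_def by (rule LeastI_ex[OF ex])
  moreover have "2 ^ J \<le> 2 * x"
  proof (cases J)
    case (Suc i)
    then have "\<not> x \<le> 2 ^ i" using not_less_Least[of i "\<lambda>n. x \<le> 2 ^ n"] by (simp add: J_def)
    then show ?thesis using Suc by simp
  qed (use assms in simp)
  ultimately show ?thesis by blast
qed

context drift
begin

text \<open>Bookkeeping at one \<epsilon> for the gap D. In the numerator \<kappa>, \<eta>, the
  chord and the coefficients cost at most D/8 + D/8 + D/16 + D/16 < D/2. In the partition function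
  the excess over the surface tension is at most D/64 + D/16 + D/32 + D/64 = D/8. The quotient keeps
  D/2 - D/8 = 3 D/8, of which D/8 absorbs the factor 2 from the two terms of the numerator.\<close>

lemma small_noise_bound:
  fixes P :: "'w measure" and U :: "'w \<Rightarrow> real \<Rightarrow> real" and \<gamma> \<epsilon> \<delta> \<eta> \<kappa> \<kappa>' c C d0 :: real
  defines "D \<equiv> c * \<delta>\<^sup>2"
  assumes up: "\<And>(M :: 'w measure) W \<epsilon> L J \<kappa> \<delta> \<eta>. scaled_bridge M W \<epsilon> L \<Longrightarrow> 0 < \<kappa> \<Longrightarrow> \<kappa> < 1 \<Longrightarrow> 0 < \<delta> \<Longrightarrow> \<delta> \<le> d0 \<Longrightarrow>
    \<eta> \<le> \<delta>\<^sup>2 / 4 \<Longrightarrow>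
    (\<integral>\<^sup>+\<omega>. ennreal (exp (- integral {-L..L} (\<lambda>t. F (W \<omega> t)) / \<epsilon>)) *
       indicator {\<omega>. \<forall>\<xi>. \<delta> \<le> L2norm UNIV (\<lambda>s. (if s < - L then -1 else if s > L then 1 else W \<omega> s) - m (s - \<xi>))} \<omega> \<partial>M)
    \<le> ennreal (exp (- ((1 - \<kappa>) * (surface_tension + c * \<delta>\<^sup>2) - (K + k)\<^sup>2 * \<eta> / (2 * \<kappa>)) / \<epsilon>)
         * (exp (1 / (L * \<epsilon>)) * (1 / sqrt \<kappa>) ^ 2 ^ J)
       + sqrt 2 ^ 2 ^ J * exp (- \<eta> / (\<epsilon> * (2 * L / 2 ^ J)\<^sup>2)))"
    and C: "\<And>u. u > 0 \<Longrightarrow> exp (- C / u ^ 4) \<le> measure std_normal_distribution {-u..u}" and C0: "C > 0"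
    and bp: "bridge_process \<gamma> \<epsilon> P U" and eps: "0 < \<epsilon>" "\<epsilon> < 1"
    and \<kappa>: "0 < \<kappa>" "\<kappa> < 1" "\<kappa> * (surface_tension + D) \<le> D / 8" and \<delta>: "0 < \<delta>" "\<delta> \<le> d0"
    and \<eta>: "0 < \<eta>" "\<eta> \<le> \<delta>\<^sup>2 / 4" "(K + k)\<^sup>2 * \<eta> / (2 * \<kappa>) \<le> D / 8"
    and \<kappa>': "0 < \<kappa>'" "\<kappa>' * surface_tension / 2 \<le> D / 16" and D0: "D > 0"
    and e1: "2 * ln (1 / sqrt \<kappa>) * \<epsilon> powr (1/6) \<le> D / 16"
    and e1b: "2 * ln (sqrt 2) * \<epsilon> powr (1/6) \<le> 1"
    and e2: "1 * \<epsilon> powr \<gamma> \<le> D / 16"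
    and e3: "1 / k * \<epsilon> powr \<gamma> \<le> 1 / 6"
    and e4: "5 * surface_tension / (2 * k) * \<epsilon> powr \<gamma> \<le> D / 64"
    and e5: "(1 + 1 / \<kappa>') * K\<^sup>2 * 18 / k\<^sup>2 * \<epsilon> powr \<gamma> \<le> D / 64"
    and e6: "(1 + 1 / \<kappa>') * K\<^sup>2 * 200 * \<epsilon> powr (3/4 - \<gamma>) \<le> D / 64"
    and e7: "2 * C * \<epsilon> powr (3/2 - 2 * \<gamma>) \<le> D / 64"
    and e8: "10 * \<epsilon> powr (3/8) \<le> 1 / 2"
    and e9: "4 * (surface_tension + D / 2 + 1) * \<epsilon> powr (5/3 - 2 * \<gamma>) \<le> \<eta>"
    and e10: "8 * ln 2 * \<epsilon> powr 1 \<le> D"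
  shows "measure (mu_line F m \<gamma> \<epsilon> (nu_tilde P U)) {u \<in> affine_L2 UNIV m. L2_dist_set u (kinks m) \<ge> \<delta>}
    \<le> exp (- (D / 4) / \<epsilon>)"
proof -
  define L where "L = \<epsilon> powr (- \<gamma>)"
  define q where "q = exp (- k * L)"
  \<comment> \<open>With r = \<epsilon>^p, smallness of r^2 L asks for 2 p > \<gamma>, and smallness
    of \<epsilon> times the small-ball cost asks for 4 p < 3 - 2 \<gamma>. At \<gamma> = 2/3 this
    leaves 1/3 < p < 5/12, with midpoint 3/8.\<close>
  define r where "r = \<epsilon> powr (3/8)"
  define \<sigma> where "\<sigma> = surface_tension"
  have \<sigma>0: "0 \<le> \<sigma>" unfolding \<sigma>_def by (rule surface_tension_nonneg)
  have L: "L > 0" using eps by (simp add: L_def)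
  have Linv: "1 / L = \<epsilon> powr \<gamma>" using eps by (simp add: L_def powr_minus_divide)
  have q0: "0 < q" by (simp add: q_def)
  \<comment> \<open>The decay is exponential in L, but the inequality exp (- y) \<le> 1 / y already
    makes q and q^2 L of order 1 / L.\<close>
  have q: "q \<le> 1 / k * \<epsilon> powr \<gamma>"
  proof -
    have "k * L \<le> exp (k * L)" using exp_ge_add_one_self[of "k * L"] by linarith
    then have "inverse (exp (k * L)) \<le> inverse (k * L)" using k L by (intro le_imp_inverse_le) auto
    then have "q \<le> 1 / k * (1 / L)" by (simp add: q_def exp_minus inverse_eq_divide)
    then show ?thesis by (simp only: Linv)
  qed
  have r0: "0 < r" using eps by (simp add: r_def)
  have r2: "r\<^sup>2 = \<epsilon> powr (3/4)" and r4: "r ^ 4 = \<epsilon> powr (3/2)"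
    using eps by (simp_all add: r_def powr_powr flip: powr_numeral)
  interpret sb: scaled_bridge P "\<lambda>\<omega>. rescale \<gamma> \<epsilon> (U \<omega>)" \<epsilon> L
    unfolding L_def by (rule bridge_process_scaled[OF bp eps(1)])
  define a where "a = (\<sigma> + D / 8) / \<epsilon>"
  have Z: "ennreal (exp (- a)) \<le> (\<integral>\<^sup>+\<omega>. ennreal (exp (- integral {-L..L} (\<lambda>t. F (rescale \<gamma> \<epsilon> (U \<omega>) t)) / \<epsilon>)) \<partial>P)"
  proof (rule order_trans[OF ennreal_leI partition_lower[OF sb.scaled_bridge_axioms q_def _ C C0 r0 _ \<kappa>'(1)]])
    show "q \<le> 1/4" "10 * r + 3 * q \<le> 1" using q e3 e8 unfolding r_def by linarith+
    have h1: "(1 + 2 * q)\<^sup>2 * \<sigma> / 2 \<le> \<sigma> / 2 + D / 64"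
    proof -
      \<comment> \<open>Because q \<le> 1/4, the square 4 q^2 is at most q.\<close>
      have "q * q \<le> q * (1 / 4)" using q e3 q0 by (intro mult_left_mono) auto
      then have "(1 + 2 * q)\<^sup>2 \<le> 1 + 5 * q" by (simp add: power2_eq_square algebra_simps)
      then have "(1 + 2 * q)\<^sup>2 * \<sigma> \<le> (1 + 5 * q) * \<sigma>" using \<sigma>0 by (rule mult_right_mono)
      moreover have "q * \<sigma> \<le> (1 / k * \<epsilon> powr \<gamma>) * \<sigma>" using q \<sigma>0 by (rule mult_right_mono)
      moreover have "5 / 2 * ((1 / k * \<epsilon> powr \<gamma>) * \<sigma>) \<le> D / 64" using e4 by (simp add: \<sigma>_def field_simps)
      moreover have "(1 + 5 * q) * \<sigma> = \<sigma> + 5 * (q * \<sigma>)" by (simp add: distrib_right)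
      moreover have "X / 2 \<le> \<sigma> / 2 + d" if "X \<le> Y" "z \<le> e" "5 / 2 * e \<le> d" "Y = \<sigma> + 5 * z" for X Y z e d :: real
        using that by linarith
      ultimately show ?thesis by blast
    qed
    have h2: "(1 + 1 / \<kappa>') * K\<^sup>2 * (10 * r + 3 * q)\<^sup>2 * L \<le> D / 32"
    proof -
      have "(10 * r + 3 * q)\<^sup>2 \<le> 200 * r\<^sup>2 + 18 * q\<^sup>2"
        using zero_le_power2[of "10 * r - 3 * q"] by (simp add: power2_eq_square algebra_simps)
      then have "(10 * r + 3 * q)\<^sup>2 * L \<le> (200 * r\<^sup>2 + 18 * q\<^sup>2) * L" using L by (intro mult_right_mono) auto
      also have "\<dots> = 200 * (r\<^sup>2 * L) + 18 * (q\<^sup>2 * L)" by (simp add: algebra_simps)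
      also have "r\<^sup>2 * L = \<epsilon> powr (3/4 - \<gamma>)" using eps by (simp add: r2 L_def flip: powr_add)
      also have "q\<^sup>2 * L \<le> \<epsilon> powr \<gamma> / k\<^sup>2"
      proof -
        have "q\<^sup>2 \<le> (1 / k * (1 / L))\<^sup>2" using q q0 unfolding Linv by (intro power_mono) auto
        then have "q\<^sup>2 * L \<le> (1 / k * (1 / L))\<^sup>2 * L" using L by (intro mult_right_mono) auto
        also have "\<dots> = (1 / L) / k\<^sup>2" using L k by (simp add: power2_eq_square)
        finally show ?thesis by (simp only: Linv)
      qed
      finally have "(10 * r + 3 * q)\<^sup>2 * L \<le> 200 * \<epsilon> powr (3/4 - \<gamma>) + 18 * (\<epsilon> powr \<gamma> / k\<^sup>2)" by simp
      then have "(1 + 1 / \<kappa>') * K\<^sup>2 * ((10 * r + 3 * q)\<^sup>2 * L) \<le> (1 + 1 / \<kappa>') * K\<^sup>2 * (200 * \<epsilon> powr (3/4 - \<gamma>) + 18 * (\<epsilon> powr \<gamma> / k\<^sup>2))"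
        using \<kappa>' by (intro mult_left_mono) auto
      also have "\<dots> = (1 + 1 / \<kappa>') * K\<^sup>2 * 200 * \<epsilon> powr (3/4 - \<gamma>) + (1 + 1 / \<kappa>') * K\<^sup>2 * 18 / k\<^sup>2 * \<epsilon> powr \<gamma>"
        by (simp only: distrib_left times_divide_eq_right times_divide_eq_left mult.assoc)
      also have "\<dots> \<le> D / 64 + D / 64" by (intro add_mono e5 e6)
      finally show ?thesis by (simp add: mult.assoc)
    qed
    have h3: "\<epsilon> * (2 * C * (\<epsilon> * L)\<^sup>2 / r ^ 4) \<le> D / 64"
    proof -
      have "(\<epsilon> * L)\<^sup>2 = \<epsilon> powr (2 - 2 * \<gamma>)"
      proof -
        have "\<epsilon> * L = \<epsilon> powr (1 - \<gamma>)" using eps by (simp add: L_def powr_diff powr_minus divide_inverse)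
        then have "(\<epsilon> * L)\<^sup>2 = (\<epsilon> powr (1 - \<gamma>)) powr 2" using eps by simp
        then show ?thesis by (simp add: powr_powr algebra_simps)
      qed
      then have "\<epsilon> * ((\<epsilon> * L)\<^sup>2 / r ^ 4) = \<epsilon> powr 1 * (\<epsilon> powr (2 - 2 * \<gamma>) / \<epsilon> powr (3/2))" using eps by (simp add: r4)
      also have "\<dots> = \<epsilon> powr (1 + (2 - 2 * \<gamma> - 3/2))" by (simp only: powr_add powr_diff)
      also have "1 + (2 - 2 * \<gamma> - 3/2) = 3/2 - 2 * \<gamma>" by simp
      finally have "\<epsilon> * ((\<epsilon> * L)\<^sup>2 / r ^ 4) = \<epsilon> powr (3/2 - 2 * \<gamma>)" .
      moreover have "\<epsilon> * (2 * C * (\<epsilon> * L)\<^sup>2 / r ^ 4) = 2 * C * (\<epsilon> * ((\<epsilon> * L)\<^sup>2 / r ^ 4))"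
        by (simp only: times_divide_eq_right mult.left_commute[of \<epsilon>])
      ultimately show ?thesis using e7 by (simp only:)
    qed
    have "(1 + 2 * q)\<^sup>2 * \<sigma> / 2 + ((1 + \<kappa>') * \<sigma> / 2 + (1 + 1 / \<kappa>') * K\<^sup>2 * (10 * r + 3 * q)\<^sup>2 * L)
        + \<epsilon> * (2 * C * (\<epsilon> * L)\<^sup>2 / r ^ 4) \<le> \<sigma> + D / 8"
    proof -
      have "(1 + \<kappa>') * \<sigma> / 2 = \<sigma> / 2 + \<kappa>' * \<sigma> / 2" by (simp add: distrib_right add_divide_distrib)
      then show ?thesis using h1 h2 h3 \<kappa>'(2) D0 unfolding \<sigma>_def[symmetric] by linarith
    qed
    then have "((1 + 2 * q)\<^sup>2 * \<sigma> / 2 + ((1 + \<kappa>') * \<sigma> / 2 + (1 + 1 / \<kappa>') * K\<^sup>2 * (10 * r + 3 * q)\<^sup>2 * L)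
        + \<epsilon> * (2 * C * (\<epsilon> * L)\<^sup>2 / r ^ 4)) / \<epsilon> \<le> a"
      unfolding a_def using eps by (intro divide_right_mono) auto
    then have "((1 + 2 * q)\<^sup>2 * \<sigma> / 2 + ((1 + \<kappa>') * \<sigma> / 2 + (1 + 1 / \<kappa>') * K\<^sup>2 * (10 * r + 3 * q)\<^sup>2 * L)) / \<epsilon>
        + 2 * C * (\<epsilon> * L)\<^sup>2 / r ^ 4 \<le> a"
      unfolding add_divide_distrib[of _ "\<epsilon> * _"] using eps by simp
    then have "- a \<le> - ((1 + 2 * q)\<^sup>2 * \<sigma> / 2 + ((1 + \<kappa>') * \<sigma> / 2 + (1 + 1 / \<kappa>') * K\<^sup>2 * (10 * r + 3 * q)\<^sup>2 * L)) / \<epsilon>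
        - 2 * C * (\<epsilon> * L)\<^sup>2 / r ^ 4"
      unfolding minus_divide_left[symmetric] by linarith
    then show "exp (- a) \<le> exp (- ((1 + 2 * q)\<^sup>2 * surface_tension / 2 + ((1 + \<kappa>') * surface_tension / 2
        + (1 + 1 / \<kappa>') * K\<^sup>2 * (10 * r + 3 * q)\<^sup>2 * L)) / \<epsilon> - 2 * C * (\<epsilon> * L)\<^sup>2 / r ^ 4)"
      unfolding \<sigma>_def exp_le_cancel_iff .
  qed
  have "1 \<le> \<epsilon> powr (- 5/6)" using eps powr_mono2'[of "-5/6" \<epsilon> 1] by simp
  then obtain J where J: "\<epsilon> powr (- 5/6) \<le> 2 ^ J" "2 ^ J \<le> 2 * \<epsilon> powr (- 5/6)"
    using dyadic_level_exists by blast
  have eJ: "\<epsilon> * 2 ^ J \<le> 2 * \<epsilon> powr (1/6)"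
  proof -
    have "\<epsilon> * 2 ^ J \<le> \<epsilon> * (2 * \<epsilon> powr (- 5/6))" using J eps by (intro mult_left_mono) auto
    also have "\<dots> = 2 * (\<epsilon> powr 1 * \<epsilon> powr (- 5/6))" using eps by simp
    also have "\<epsilon> powr 1 * \<epsilon> powr (- 5/6) = \<epsilon> powr (1/6)" by (subst powr_add[symmetric]) simp
    finally show ?thesis .
  qed
  define E where "E = exp (- (\<sigma> + D / 2) / \<epsilon>)"
  have pow_exp: "x ^ (2 ^ J) = exp (\<epsilon> * 2 ^ J * ln x / \<epsilon>)" if "x > 0" for x :: real
  proof -
    have "x ^ (2 ^ J) = exp (ln x) ^ (2 ^ J)" using that by simp
    also have "\<dots> = exp (real (2 ^ J) * ln x)" by (rule exp_of_nat_mult[symmetric])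
    finally show ?thesis using eps by simp
  qed
  have "ln (1 / sqrt \<kappa>) \<ge> 0" using \<kappa> by (intro ln_ge_zero) simp
  have n1: "exp (- ((1 - \<kappa>) * (\<sigma> + D) - (K + k)\<^sup>2 * \<eta> / (2 * \<kappa>)) / \<epsilon>)
         * (exp (1 / (L * \<epsilon>)) * (1 / sqrt \<kappa>) ^ 2 ^ J) \<le> E"
  proof -
    have s: "\<epsilon> * 2 ^ J * ln (1 / sqrt \<kappa>) \<le> D / 16"
      using mult_right_mono[OF eJ \<open>ln (1 / sqrt \<kappa>) \<ge> 0\<close>] e1 by (simp add: mult_ac)
    have "(1 / sqrt \<kappa>) ^ 2 ^ J = exp (\<epsilon> * 2 ^ J * ln (1 / sqrt \<kappa>) / \<epsilon>)" using \<kappa> by (intro pow_exp) simp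
    moreover have "exp (1 / (L * \<epsilon>)) = exp (\<epsilon> powr \<gamma> / \<epsilon>)" by (simp flip: Linv)
    ultimately have "exp (- ((1 - \<kappa>) * (\<sigma> + D) - (K + k)\<^sup>2 * \<eta> / (2 * \<kappa>)) / \<epsilon>)
         * (exp (1 / (L * \<epsilon>)) * (1 / sqrt \<kappa>) ^ 2 ^ J)
       = exp ((- ((1 - \<kappa>) * (\<sigma> + D) - (K + k)\<^sup>2 * \<eta> / (2 * \<kappa>)) + (\<epsilon> powr \<gamma> + \<epsilon> * 2 ^ J * ln (1 / sqrt \<kappa>))) / \<epsilon>)"
      unfolding add_divide_distrib exp_add by simp
    also have "\<dots> \<le> E" unfolding E_def exp_le_cancel_iff
    proof (rule divide_right_mono)
      have "(1 - \<kappa>) * (\<sigma> + D) = \<sigma> + D - \<kappa> * (\<sigma> + D)" by (simp add: algebra_simps)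
      then show "- ((1 - \<kappa>) * (\<sigma> + D) - (K + k)\<^sup>2 * \<eta> / (2 * \<kappa>)) + (\<epsilon> powr \<gamma> + \<epsilon> * 2 ^ J * ln (1 / sqrt \<kappa>)) \<le> - (\<sigma> + D / 2)"
        using s e2 \<kappa>(3) \<eta>(3) D0 unfolding \<sigma>_def[symmetric] by linarith
    qed (use eps in simp)
    finally show ?thesis .
  qed
  have n2: "sqrt 2 ^ 2 ^ J * exp (- \<eta> / (\<epsilon> * (2 * L / 2 ^ J)\<^sup>2)) \<le> E"
  proof -
    define h where "h = 2 * L / 2 ^ J"
    have h0: "h > 0" using L by (simp add: h_def)
    have "h \<le> 2 * L / \<epsilon> powr (- 5/6)" unfolding h_def using J L eps by (intro divide_left_mono) auto
    also have "\<dots> = 2 * \<epsilon> powr (5/6 - \<gamma>)" 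
    proof -
      have "\<epsilon> powr (- \<gamma>) / \<epsilon> powr (- 5/6) = \<epsilon> powr (- \<gamma> - (- 5/6))" by (rule powr_diff[symmetric])
      also have "- \<gamma> - (- 5/6) = 5/6 - \<gamma>" by simp
      finally show ?thesis unfolding L_def times_divide_eq_right[symmetric] by (rule arg_cong)
    qed
    finally have "h\<^sup>2 \<le> (2 * \<epsilon> powr (5/6 - \<gamma>))\<^sup>2" using h0 by (intro power_mono) auto
    also have "\<dots> = 4 * (\<epsilon> powr (5/6 - \<gamma>)) powr 2" using eps by (simp add: power_mult_distrib)
    also have "(\<epsilon> powr (5/6 - \<gamma>)) powr 2 = \<epsilon> powr (5/3 - 2 * \<gamma>)" by (simp add: powr_powr algebra_simps)
    finally have "(\<sigma> + D / 2 + 1) * h\<^sup>2 \<le> (\<sigma> + D / 2 + 1) * (4 * \<epsilon> powr (5/3 - 2 * \<gamma>))"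
      using \<sigma>0 D0 by (intro mult_left_mono) auto
    also have "\<dots> \<le> \<eta>" using e9 unfolding \<sigma>_def by (simp only: mult.left_commute[of _ 4] mult.assoc)
    finally have hh: "\<sigma> + D / 2 + 1 \<le> \<eta> / h\<^sup>2" using h0 by (simp add: pos_le_divide_eq)
    have ln0: "ln (sqrt 2) \<ge> 0" by simp
    \<comment> \<open>The summand 1 in \<sigma> + D / 2 + 1 pays for the factor
      \<open>sqrt 2 ^ 2 ^ J\<close>, which is thereby at most exp (1 / \<epsilon>).\<close>
    have s: "\<epsilon> * 2 ^ J * ln (sqrt 2) \<le> 1"
      using order_trans[OF mult_right_mono[OF eJ ln0] e1b[unfolded mult.assoc mult.commute[of "ln (sqrt 2)"], folded mult.assoc]] .
    have "sqrt 2 ^ 2 ^ J = exp (\<epsilon> * 2 ^ J * ln (sqrt 2) / \<epsilon>)" by (intro pow_exp) simp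
    moreover have "- \<eta> / (\<epsilon> * h\<^sup>2) = - (\<eta> / h\<^sup>2) / \<epsilon>" by (simp add: mult.commute)
    ultimately have "sqrt 2 ^ 2 ^ J * exp (- \<eta> / (\<epsilon> * h\<^sup>2)) = exp ((\<epsilon> * 2 ^ J * ln (sqrt 2) + - (\<eta> / h\<^sup>2)) / \<epsilon>)"
      unfolding add_divide_distrib exp_add by simp
    also have "\<dots> \<le> E" unfolding E_def exp_le_cancel_iff
      by (rule divide_right_mono) (use s hh eps in auto)
    finally show ?thesis by (simp add: h_def)
  qed
  have Num: "(\<integral>\<^sup>+\<omega>. ennreal (exp (- integral {-L..L} (\<lambda>t. F (rescale \<gamma> \<epsilon> (U \<omega>) t)) / \<epsilon>)) *
       indicator {\<omega>. \<forall>\<xi>. \<delta> \<le> L2norm UNIV (\<lambda>s. (if s < - L then -1 else if s > L then 1 else rescale \<gamma> \<epsilon> (U \<omega>) s) - m (s - \<xi>))} \<omega> \<partial>P)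
     \<le> ennreal (E + E)"
    by (rule order_trans[OF up[OF sb.scaled_bridge_axioms \<kappa>(1,2) \<delta> \<eta>(2), where J = J] ennreal_leI])
      (use add_mono[OF n1 n2] in \<open>simp add: \<sigma>_def D_def\<close>)
  have "measure (mu_line F m \<gamma> \<epsilon> (nu_tilde P U)) {u \<in> affine_L2 UNIV m. L2_dist_set u (kinks m) \<ge> \<delta>} \<le> (E + E) * exp a"
    by (rule mu_line_bound[OF bp eps(1) F_cont F_nonneg, folded L_def, OF Z Num]) (simp add: E_def)
  also have "\<dots> = exp (ln 2) * (E * exp a)" by simp
  also have "\<dots> = exp (ln 2 + (- (\<sigma> + D / 2) / \<epsilon> + (\<sigma> + D / 8) / \<epsilon>))" by (simp only: E_def a_def exp_add)
  also have "\<dots> \<le> exp (- (D / 4) / \<epsilon>)" unfolding exp_le_cancel_iff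
  proof -
    have "ln 2 \<le> D / 8 / \<epsilon>" using e10 eps by (simp add: pos_le_divide_eq)
    moreover have "- (\<sigma> + D / 2) / \<epsilon> + (\<sigma> + D / 8) / \<epsilon> = - (D / 4) / \<epsilon> - D / 8 / \<epsilon>"
      using eps by (simp add: field_simps)
    ultimately show "ln 2 + (- (\<sigma> + D / 2) / \<epsilon> + (\<sigma> + D / 8) / \<epsilon>) \<le> - (D / 4) / \<epsilon>" by linarith
  qed
  finally show ?thesis .
qed

end

theorem theorem1p2:
  fixes F m :: "real \<Rightarrow> real" and \<gamma> :: real
    and P :: "real \<Rightarrow> 'w measure" and U :: "real \<Rightarrow> 'w \<Rightarrow> real \<Rightarrow> real"
  assumes "double_well F"
    and "kink F m"
    and "\<And>\<epsilon>. \<epsilon> > 0 \<Longrightarrow> bridge_process \<gamma> \<epsilon> (P \<epsilon>) (U \<epsilon>)"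
    and "0 < \<gamma>" and "\<gamma> < 2 / 3"
  shows "\<exists>c\<^sub>0>0. \<exists>\<delta>\<^sub>0>0. \<forall>\<delta>. 0 < \<delta> \<and> \<delta> \<le> \<delta>\<^sub>0 \<longrightarrow>
    Limsup (at_right 0) (\<lambda>\<epsilon>. ereal \<epsilon> *
        log_prob (measure (mu_line F m \<gamma> \<epsilon> (nu_tilde (P \<epsilon>) (U \<epsilon>)))
          {u \<in> affine_L2 UNIV m. L2_dist_set u (kinks m) \<ge> \<delta>}))
      \<le> ereal (- c\<^sub>0 * \<delta>\<^sup>2)"
proof -
  interpret well_potential F by unfold_locales (rule assms(1))
  obtain k where k: "k > 0" "\<And>u. k * min \<bar>\<bar>u\<bar> - 1\<bar> 1 \<le> bt u" using bt_lower by blast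
  obtain K where K: "K > 0" "\<And>x y. x \<in> {-2..2} \<Longrightarrow> y \<in> {-2..2} \<Longrightarrow> \<bar>bt x - bt y\<bar> \<le> K * \<bar>x - y\<bar>"
    using bt_lipschitz by blast
  interpret drift F m k K by unfold_locales (use assms(2) k K in auto)
  obtain c d0 where c: "c > 0" and d0: "d0 > 0" and up: "\<forall>(M :: 'w measure) W \<epsilon> L J \<kappa> \<delta> \<eta>. scaled_bridge M W \<epsilon> L \<longrightarrow> 0 < \<kappa> \<longrightarrow> \<kappa> < 1 \<longrightarrow> 0 < \<delta> \<longrightarrow> \<delta> \<le> d0 \<longrightarrow>
    \<eta> \<le> \<delta>\<^sup>2 / 4 \<longrightarrow>
    (\<integral>\<^sup>+\<omega>. ennreal (exp (- integral {-L..L} (\<lambda>t. F (W \<omega> t)) / \<epsilon>)) *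
       indicator {\<omega>. \<forall>\<xi>. \<delta> \<le> L2norm UNIV (\<lambda>s. (if s < - L then -1 else if s > L then 1 else W \<omega> s) - m (s - \<xi>))} \<omega> \<partial>M)
    \<le> ennreal (exp (- ((1 - \<kappa>) * (surface_tension + c * \<delta>\<^sup>2) - (K + k)\<^sup>2 * \<eta> / (2 * \<kappa>)) / \<epsilon>)
         * (exp (1 / (L * \<epsilon>)) * (1 / sqrt \<kappa>) ^ 2 ^ J)
       + sqrt 2 ^ 2 ^ J * exp (- \<eta> / (\<epsilon> * (2 * L / 2 ^ J)\<^sup>2)))"
    using numerator_upper by (elim exE conjE) (rule that; assumption)
  obtain C where C: "C > 0" "\<And>u. u > 0 \<Longrightarrow> exp (- C / u ^ 4) \<le> measure std_normal_distribution {-u..u}"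
    using std_normal_small_ball by blast
  \<comment> \<open>The probability is eventually at most exp (- (D / 4) / \<epsilon>) with D = c
    \<delta>^2, hence the constant c / 4.\<close>
  show ?thesis
  proof (rule exI[of _ "c / 4"], rule conjI, use c in simp, rule exI[of _ d0], rule conjI[OF d0], intro allI impI)
    fix \<delta> assume \<delta>: "0 < \<delta> \<and> \<delta> \<le> d0"
    define D where "D = c * \<delta>\<^sup>2"
    have D: "D > 0" using c \<delta> by (simp add: D_def)
    have \<sigma>D: "surface_tension + D > 0" using surface_tension_nonneg D by simp
    \<comment> \<open>The order matters: \<kappa> is fixed by D, and \<eta> afterwards, since
      comparing b at the path and at its interpolation costs
      \<open>(K + k)\<^sup>2 * \<eta> / (2 * \<kappa>)\<close>. None of the three constants depends
      on \<epsilon>.\<close>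
    define \<kappa> where "\<kappa> = min (1/2) (D / 8 / (surface_tension + D))"
    define \<eta> where "\<eta> = min (\<delta>\<^sup>2 / 4) (D / 8 * (2 * \<kappa>) / (K + k)\<^sup>2)"
    define \<kappa>' where "\<kappa>' = D / 8 / (surface_tension + D)"
    have cancel: "x / (surface_tension + D) * (surface_tension + D) = x" for x
      using less_imp_neq[OF \<sigma>D] by (metis nonzero_eq_divide_eq)
    have \<kappa>: "0 < \<kappa>" "\<kappa> < 1" using D \<sigma>D by (auto simp: \<kappa>_def)
    have \<kappa>3: "\<kappa> * (surface_tension + D) \<le> D / 8"
    proof -
      have "\<kappa> * (surface_tension + D) \<le> D / 8 / (surface_tension + D) * (surface_tension + D)"
        using \<sigma>D by (intro mult_right_mono) (auto simp: \<kappa>_def)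
      then show ?thesis unfolding cancel .
    qed
    have \<eta>: "0 < \<eta>" "\<eta> \<le> \<delta>\<^sup>2 / 4" using \<delta> D \<kappa> K k by (auto simp: \<eta>_def)
    have \<eta>3: "(K + k)\<^sup>2 * \<eta> / (2 * \<kappa>) \<le> D / 8"
    proof -
      have "0 < (K + k)\<^sup>2" using K k by (intro zero_less_power) simp
      moreover have "\<eta> \<le> D / 8 * (2 * \<kappa>) / (K + k)\<^sup>2" by (simp add: \<eta>_def)
      ultimately have "\<eta> * (K + k)\<^sup>2 \<le> D / 8 * (2 * \<kappa>)" by (simp only: pos_le_divide_eq)
      moreover have "0 < 2 * \<kappa>" using \<kappa> by simp
      ultimately show ?thesis by (simp only: pos_divide_le_eq mult.commute[of _ \<eta>])
    qed
    have \<kappa>': "0 < \<kappa>'" using D \<sigma>D by (simp add: \<kappa>'_def)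
    have \<kappa>'2: "\<kappa>' * surface_tension / 2 \<le> D / 16"
    proof -
      have "\<kappa>' * surface_tension \<le> \<kappa>' * (surface_tension + D)" using \<kappa>' D by (intro mult_left_mono) auto
      also have "\<dots> = D / 8" unfolding \<kappa>'_def by (rule cancel)
      finally show ?thesis by simp
    qed
    \<comment> \<open>The bound on \<gamma> enters here: the three exponents belong to the potential
      in the tube, to its small-ball cost and to the squared mesh of the interpolation.\<close>
    have g: "0 < 3/4 - \<gamma>" "0 < 3/2 - 2 * \<gamma>" "0 < 5/3 - 2 * \<gamma>" using assms(5) by auto
    have D': "0 < D / 16" "0 < D / 64" using D by auto
    have ev: "eventually (\<lambda>\<epsilon>. 0 < \<epsilon> \<and> \<epsilon> < (1 :: real)) (at_right 0)"
      by (intro eventually_at_rightI[of 0 1]) auto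
    have "eventually (\<lambda>\<epsilon>. measure (mu_line F m \<gamma> \<epsilon> (nu_tilde (P \<epsilon>) (U \<epsilon>)))
        {u \<in> affine_L2 UNIV m. L2_dist_set u (kinks m) \<ge> \<delta>} \<le> exp (- (D / 4) / \<epsilon>)) (at_right 0)"
    proof -
      have e: "\<forall>\<^sub>F \<epsilon> in at_right (0 :: real). 2 * ln (1 / sqrt \<kappa>) * \<epsilon> powr (1/6) \<le> D / 16"
        "\<forall>\<^sub>F \<epsilon> in at_right (0 :: real). 2 * ln (sqrt 2) * \<epsilon> powr (1/6) \<le> 1"
        "\<forall>\<^sub>F \<epsilon> in at_right (0 :: real). 1 * \<epsilon> powr \<gamma> \<le> D / 16"
        "\<forall>\<^sub>F \<epsilon> in at_right (0 :: real). 1 / k * \<epsilon> powr \<gamma> \<le> 1 / 6"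
        "\<forall>\<^sub>F \<epsilon> in at_right (0 :: real). 5 * surface_tension / (2 * k) * \<epsilon> powr \<gamma> \<le> D / 64"
        "\<forall>\<^sub>F \<epsilon> in at_right (0 :: real). (1 + 1 / \<kappa>') * K\<^sup>2 * 18 / k\<^sup>2 * \<epsilon> powr \<gamma> \<le> D / 64"
        "\<forall>\<^sub>F \<epsilon> in at_right (0 :: real). (1 + 1 / \<kappa>') * K\<^sup>2 * 200 * \<epsilon> powr (3/4 - \<gamma>) \<le> D / 64"
        "\<forall>\<^sub>F \<epsilon> in at_right (0 :: real). 2 * C * \<epsilon> powr (3/2 - 2 * \<gamma>) \<le> D / 64"
        "\<forall>\<^sub>F \<epsilon> in at_right (0 :: real). 10 * \<epsilon> powr (3/8) \<le> 1 / 2"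
        "\<forall>\<^sub>F \<epsilon> in at_right (0 :: real). 4 * (surface_tension + D / 2 + 1) * \<epsilon> powr (5/3 - 2 * \<gamma>) \<le> \<eta>"
        "\<forall>\<^sub>F \<epsilon> in at_right (0 :: real). 8 * ln 2 * \<epsilon> powr 1 \<le> D"
        by (rule eventually_powr_small; use g D D' \<eta>(1) assms(4) in simp)+
      show ?thesis using ev e
      proof eventually_elim
        case (elim \<epsilon>)
        note eps = elim(1)[THEN conjunct1] elim(1)[THEN conjunct2]
        show ?case
          by (rule small_noise_bound[of d0 c C \<gamma> \<epsilon> "P \<epsilon>" "U \<epsilon>" \<kappa> \<delta> \<eta> \<kappa>', folded D_def,
              OF up[rule_format, folded D_def] C(2) C(1) assms(3)[OF eps(1)] eps \<kappa> \<kappa>3 \<delta>[THEN conjunct1] \<delta>[THEN conjunct2] \<eta> \<eta>3 \<kappa>' \<kappa>'2 D elim(2-12)])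
      qed
    qed
    then have "eventually (\<lambda>\<epsilon>. ereal \<epsilon> * log_prob (measure (mu_line F m \<gamma> \<epsilon> (nu_tilde (P \<epsilon>) (U \<epsilon>)))
          {u \<in> affine_L2 UNIV m. L2_dist_set u (kinks m) \<ge> \<delta>}) \<le> ereal (- (c / 4) * \<delta>\<^sup>2)) (at_right 0)"
      using ev
    proof eventually_elim
      case (elim \<epsilon>)
      define p where "p = measure (mu_line F m \<gamma> \<epsilon> (nu_tilde (P \<epsilon>) (U \<epsilon>))) {u \<in> affine_L2 UNIV m. L2_dist_set u (kinks m) \<ge> \<delta>}"
      show ?case unfolding p_def[symmetric]
      proof (cases "p \<le> 0")
        \<comment> \<open>Probability 0 has logarithm minus infinity, and multiplication by
          \<epsilon> > 0 leaves it there.\<close>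
        case True
        then show "ereal \<epsilon> * log_prob p \<le> ereal (- (c / 4) * \<delta>\<^sup>2)" using elim by (simp add: log_prob_def)
      next
        case False
        have "ln p \<le> ln (exp (- (D / 4) / \<epsilon>))" using False elim(1) by (subst ln_le_cancel_iff) (auto simp: p_def)
        then have "ln p \<le> - (D / 4) / \<epsilon>" by simp
        then have "\<epsilon> * ln p \<le> \<epsilon> * (- (D / 4) / \<epsilon>)" using elim by (intro mult_left_mono) auto
        then have "\<epsilon> * ln p \<le> - (c / 4) * \<delta>\<^sup>2" using elim by (simp add: D_def)
        then show "ereal \<epsilon> * log_prob p \<le> ereal (- (c / 4) * \<delta>\<^sup>2)" using False by (simp add: log_prob_def)
      qed
    qed
    then show "Limsup (at_right 0) (\<lambda>\<epsilon>. ereal \<epsilon> * log_prob (measure (mu_line F m \<gamma> \<epsilon> (nu_tilde (P \<epsilon>) (U \<epsilon>)))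
          {u \<in> affine_L2 UNIV m. L2_dist_set u (kinks m) \<ge> \<delta>})) \<le> ereal (- (c / 4) * \<delta>\<^sup>2)"
      by (rule Limsup_bounded)
  qed
qed

end
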